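(* Let $\lambda>0$, $\ell>0$ and let $\gamma\in A_\ell$ be a penalized pinned elastica. If the arclength parametrization of $\gamma$ is $\gamma_{\rm sarc}^{\lambda,\ell,n}$, $\gamma_{\rm larc}^{\lambda,\ell,n}$, or $\gamma_{\rm loop}^{\lambda,\ell,n}$ for some integer $n\ge3$ (for which the respective curve is defined), then $\gamma$ is not a local minimizer of $\mathcal{E}_\lambda$ in $A_\ell$.
   Context: Elliptic functions: for $q\in[0,1)$, $x\in\mathbb{R}$, $\mathrm{F}(x,q)=\int_0^x(1-q^2\sin^2\theta)^{-1/2}\,d\theta$, $\mathrm{E}(x,q)=\int_0^x(1-q^2\sin^2\theta)^{1/2}\,d\theta$, $\mathrm{K}(q)=\mathrm{F}(\pi/2,q)$, $\mathrm{E}(q)=\mathrm{E}(\pi/2,q)$; $\mathrm{am}(\cdot,q)$ is the inverse of $x\mapsto\mathrm{F}(x,q)$, $\mathrm{cn}(x,q)=\cos\mathrm{am}(x,q)$. The function $q\mapsto2\mathrm{E}(q)-\mathrm{K}(q)$ is strictly decreasing on $[0,1)$ with unique zero $q_*\in(0,1)$. On $[1/\sqrt2,1)$ let $f(q)=(4q^4-5q^2+1)\mathrm{K}(q)+(-8q^4+8q^2-1)\mathrm{E}(q)$ and $g(q)=8(2\mathrm{E}(q)-\mathrm{K}(q))^2(2q^2-1)$. $f$ has a unique zero $\hat q\in[1/\sqrt2,1)$; $\hat\lambda:=g(\hat q)\approx0.70107$. $g(1/\sqrt2)=0$, $g$ is strictly increasing on $[1/\sqrt2,\hat q]$, strictly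 decreasing on $[\hat q,q_*]$ with $g(q_* )=0$, strictly increasing on $[q_*,1)$ with $g\to\infty$ at $1$. For $c\in(0,\hat\lambda]$ let $q_1(c)\in(1/\sqrt2,\hat q]$, $q_2(c)\in[\hat q,q_* )$ solve $g(q)=c$; for every $c>0$ let $q_3(c)\in(q_*,1)$ solve $g(q)=c$. Let $n_{\lambda,\ell}=\lceil\sqrt{\lambda\ell^2/\hat\lambda}\rceil$. Setting: $A_\ell=\{\gamma\in W^{2,2}(0,1;\mathbb{R}^2): |\gamma'|\neq0$ on $[0,1]$, $\gamma(0)=(0,0),\ \gamma(1)=(\ell,0)\}$; $\mathcal{E}_\lambda[\gamma]=\int_\gamma k^2\,ds+\lambda L[\gamma]$ ($k$ signed curvature, $L$ length). A penalized pinned elastica is $\gamma\in A_\ell$ with $\frac{d}{d\varepsilon}\mathcal{E}_\lambda[\gamma+\varepsilon\eta]|_{\varepsilon=0}=0$ for all $\eta\in W^{2,2}(0,1;\mathbb{R}^2)\cap W^{1,2}_0(0,1;\mathbb{R}^2)$. Local minimizer refers to the $W^{2,2}$-topology. Curves (arclength parametrized on $[0,2n\mathrm{K}(q)/\alpha]$): for $n\ge n_{\lambda,\ell}$, $\gamma_{\rm sarc}^{\lambda,\ell,n}(s)=\frac1\alpha\big(2\mathrm{E}(\mathrm{am}(\alpha s-\mathrm{K}(q),q),q)+2\mathrm{E}(q)-\alpha s,\ 2q\,\mathrm{cn}(\alpha s-\mathrm{K}(q),q)\big)$ with $q=q_1(\lambda\ell^2/n^2)$, $\alpha=\frac{2n}{\ell}(2\mathrm{E}(q)-\mathrm{K}(q))$;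 $\gamma_{\rm larc}^{\lambda,\ell,n}$ is the same formula with $q=q_2(\lambda\ell^2/n^2)$; for $n\ge1$, $\gamma_{\rm loop}^{\lambda,\ell,n}(s)=\frac1\alpha\big(-2\mathrm{E}(\mathrm{am}(\alpha s-\mathrm{K}(q),q),q)-2\mathrm{E}(q)+\alpha s,\ 2q\,\mathrm{cn}(\alpha s-\mathrm{K}(q),q)\big)$ with $q=q_3(\lambda\ell^2/n^2)$, $\alpha=\frac{2n}{\ell}(\mathrm{K}(q)-2\mathrm{E}(q))$. *)

theory Defs
  imports "HOL-Analysis.Analysis"
begin

definition oint :: "(real \<Rightarrow> real) \<Rightarrow> real \<Rightarrow> real" where
  "oint f x = (if 0 \<le> x then integral {0..x} f else - integral {x..0} f)"

definition ellF :: "real \<Rightarrow> real \<Rightarrow> real" where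
  "ellF x q = oint (\<lambda>\<theta>. 1 / sqrt (1 - q\<^sup>2 * (sin \<theta>)\<^sup>2)) x"

definition ellE :: "real \<Rightarrow> real \<Rightarrow> real" where
  "ellE x q = oint (\<lambda>\<theta>. sqrt (1 - q\<^sup>2 * (sin \<theta>)\<^sup>2)) x"

definition ellK :: "real \<Rightarrow> real" where
  "ellK q = ellF (pi/2) q"

definition ellEc :: "real \<Rightarrow> real" where
  "ellEc q = ellE (pi/2) q"

definition am :: "real \<Rightarrow> real \<Rightarrow> real" where
  "am x q = (THE \<phi>. ellF \<phi> q = x)"

definition cn :: "real \<Rightarrow> real \<Rightarrow> real" where
  "cn x q = cos (am x q)"

definition qstar :: real where
  "qstar = (THE q. 0 < q \<and> q < 1 \<and> 2 * ellEc q - ellK q = 0)"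

definition fq :: "real \<Rightarrow> real" where
  "fq q = (4*q^4 - 5*q\<^sup>2 + 1) * ellK q + (-8*q^4 + 8*q\<^sup>2 - 1) * ellEc q"

definition gq :: "real \<Rightarrow> real" where
  "gq q = 8 * (2 * ellEc q - ellK q)\<^sup>2 * (2*q\<^sup>2 - 1)"

definition qhat :: real where
  "qhat = (THE q. 1 / sqrt 2 \<le> q \<and> q < 1 \<and> fq q = 0)"

definition lamhat :: real where
  "lamhat = gq qhat"

definition q1 :: "real \<Rightarrow> real" where
  "q1 c = (THE q. 1 / sqrt 2 < q \<and> q \<le> qhat \<and> gq q = c)"

definition q2 :: "real \<Rightarrow> real" where
  "q2 c = (THE q. qhat \<le> q \<and> q < qstar \<and> gq q = c)"

definition q3 :: "real \<Rightarrow> real" where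
  "q3 c = (THE q. qstar < q \<and> q < 1 \<and> gq q = c)"

definition nlam :: "real \<Rightarrow> real \<Rightarrow> int" where
  "nlam lam l = \<lceil>sqrt (lam * l\<^sup>2 / lamhat)\<rceil>"

definition arc_formula :: "real \<Rightarrow> real \<Rightarrow> real \<Rightarrow> real \<times> real" where
  "arc_formula q \<alpha> s =
     (let u = \<alpha> * s - ellK q in
      ((2 * ellE (am u q) q + 2 * ellEc q - \<alpha> * s) / \<alpha>, 2 * q * cn u q / \<alpha>))"

definition loop_formula :: "real \<Rightarrow> real \<Rightarrow> real \<Rightarrow> real \<times> real" where
  "loop_formula q \<alpha> s =
     (let u = \<alpha> * s - ellK q in
      ((\<alpha> * s - 2 * ellE (am u q) q - 2 * ellEc q) / \<alpha>, 2 * q * cn u q / \<alpha>))"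

definition sarc_q :: "real \<Rightarrow> real \<Rightarrow> nat \<Rightarrow> real" where
  "sarc_q lam l n = q1 (lam * l\<^sup>2 / (real n)\<^sup>2)"
definition larc_q :: "real \<Rightarrow> real \<Rightarrow> nat \<Rightarrow> real" where
  "larc_q lam l n = q2 (lam * l\<^sup>2 / (real n)\<^sup>2)"
definition loop_q :: "real \<Rightarrow> real \<Rightarrow> nat \<Rightarrow> real" where
  "loop_q lam l n = q3 (lam * l\<^sup>2 / (real n)\<^sup>2)"

definition arc_alpha :: "real \<Rightarrow> nat \<Rightarrow> real \<Rightarrow> real" where
  "arc_alpha l n q = 2 * real n / l * (2 * ellEc q - ellK q)"
definition loop_alpha :: "real \<Rightarrow> nat \<Rightarrow> real \<Rightarrow> real" where
  "loop_alpha l n q = 2 * real n / l * (ellK q - 2 * ellEc q)"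

definition gamma_sarc :: "real \<Rightarrow> real \<Rightarrow> nat \<Rightarrow> real \<Rightarrow> real \<times> real" where
  "gamma_sarc lam l n = arc_formula (sarc_q lam l n) (arc_alpha l n (sarc_q lam l n))"
definition gamma_larc :: "real \<Rightarrow> real \<Rightarrow> nat \<Rightarrow> real \<Rightarrow> real \<times> real" where
  "gamma_larc lam l n = arc_formula (larc_q lam l n) (arc_alpha l n (larc_q lam l n))"
definition gamma_loop :: "real \<Rightarrow> real \<Rightarrow> nat \<Rightarrow> real \<Rightarrow> real \<times> real" where
  "gamma_loop lam l n = loop_formula (loop_q lam l n) (loop_alpha l n (loop_q lam l n))"

definition len_sarc :: "real \<Rightarrow> real \<Rightarrow> nat \<Rightarrow> real" where
  "len_sarc lam l n = 2 * real n * ellK (sarc_q lam l n) / arc_alpha l n (sarc_q lam l n)"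
definition len_larc :: "real \<Rightarrow> real \<Rightarrow> nat \<Rightarrow> real" where
  "len_larc lam l n = 2 * real n * ellK (larc_q lam l n) / arc_alpha l n (larc_q lam l n)"
definition len_loop :: "real \<Rightarrow> real \<Rightarrow> nat \<Rightarrow> real" where
  "len_loop lam l n = 2 * real n * ellK (loop_q lam l n) / loop_alpha l n (loop_q lam l n)"

definition D1 :: "(real \<Rightarrow> real \<times> real) \<Rightarrow> real \<Rightarrow> real \<times> real" where
  "D1 \<gamma> t = vector_derivative \<gamma> (at t within {0..1})"

text \<open>h is an L^2 weak second derivative of \<gamma> on (0,1):
  \<gamma>' is the indefinite integral of h.\<close>
definition is_D2 :: "(real \<Rightarrow> real \<times> real) \<Rightarrow> (real \<Rightarrow> real \<times> real) \<Rightarrow> bool" where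
  "is_D2 \<gamma> h \<longleftrightarrow> h absolutely_integrable_on {0..1} \<and>
     (\<lambda>t. (norm (h t))\<^sup>2) integrable_on {0..1} \<and>
     (\<forall>t\<in>{0..1}. (h has_integral (D1 \<gamma> t - D1 \<gamma> 0)) {0..t})"

text \<open>W^{2,2}(0,1;R^2), identified with its continuously differentiable representatives.\<close>
definition W22 :: "(real \<Rightarrow> real \<times> real) \<Rightarrow> bool" where
  "W22 \<gamma> \<longleftrightarrow> (\<forall>t\<in>{0..1}. \<gamma> differentiable (at t within {0..1})) \<and> (\<exists>h. is_D2 \<gamma> h)"

definition D2 :: "(real \<Rightarrow> real \<times> real) \<Rightarrow> real \<Rightarrow> real \<times> real" where
  "D2 \<gamma> = (SOME h. is_D2 \<gamma> h)"

definition w22_norm :: "(real \<Rightarrow> real \<times> real) \<Rightarrow> real" where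
  "w22_norm \<gamma> = sqrt (integral {0..1}
     (\<lambda>t. (norm (\<gamma> t))\<^sup>2 + (norm (D1 \<gamma> t))\<^sup>2 + (norm (D2 \<gamma> t))\<^sup>2))"

definition A_class :: "real \<Rightarrow> (real \<Rightarrow> real \<times> real) set" where
  "A_class l = {\<gamma>. W22 \<gamma> \<and> (\<forall>t\<in>{0..1}. D1 \<gamma> t \<noteq> 0) \<and> \<gamma> 0 = (0,0) \<and> \<gamma> 1 = (l,0)}"

definition cross2 :: "real \<times> real \<Rightarrow> real \<times> real \<Rightarrow> real" where
  "cross2 a b = fst a * snd b - snd a * fst b"

text \<open>Length L[\<gamma>] and bending energy \<integral>_\<gamma> k^2 ds = \<integral>_0^1 (\<gamma>' \<times> \<gamma>'')^2 / |\<gamma>'|^5 dt.\<close>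
definition curve_length :: "(real \<Rightarrow> real \<times> real) \<Rightarrow> real" where
  "curve_length \<gamma> = integral {0..1} (\<lambda>t. norm (D1 \<gamma> t))"

definition bending_energy :: "(real \<Rightarrow> real \<times> real) \<Rightarrow> real" where
  "bending_energy \<gamma> = integral {0..1} (\<lambda>t. (cross2 (D1 \<gamma> t) (D2 \<gamma> t))\<^sup>2 / (norm (D1 \<gamma> t)) ^ 5)"

definition energy :: "real \<Rightarrow> (real \<Rightarrow> real \<times> real) \<Rightarrow> real" where
  "energy lam \<gamma> = bending_energy \<gamma> + lam * curve_length \<gamma>"

definition penalized_pinned_elastica :: "real \<Rightarrow> real \<Rightarrow> (real \<Rightarrow> real \<times> real) \<Rightarrow> bool" where
  "penalized_pinned_elastica lam l \<gamma> \<longleftrightarrow> \<gamma> \<in> A_class l \<and>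
     (\<forall>\<eta>. W22 \<eta> \<and> \<eta> 0 = 0 \<and> \<eta> 1 = 0 \<longrightarrow>
        ((\<lambda>\<epsilon>. energy lam (\<lambda>t. \<gamma> t + \<epsilon> *\<^sub>R \<eta> t)) has_real_derivative 0) (at 0))"

definition local_minimizer :: "real \<Rightarrow> real \<Rightarrow> (real \<Rightarrow> real \<times> real) \<Rightarrow> bool" where
  "local_minimizer lam l \<gamma> \<longleftrightarrow> \<gamma> \<in> A_class l \<and>
     (\<exists>\<delta>>0. \<forall>\<eta>\<in>A_class l. w22_norm (\<lambda>t. \<eta> t - \<gamma> t) < \<delta> \<longrightarrow> energy lam \<gamma> \<le> energy lam \<eta>)"

definition arclength_param_is ::
  "(real \<Rightarrow> real \<times> real) \<Rightarrow> (real \<Rightarrow> real \<times> real) \<Rightarrow> real \<Rightarrow> bool" where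
  "arclength_param_is \<gamma> \<Gamma> L \<longleftrightarrow> curve_length \<gamma> = L \<and>
     (\<forall>t\<in>{0..1}. \<gamma> t = \<Gamma> (integral {0..t} (\<lambda>u. norm (D1 \<gamma> u))))"

end

theory Submission
  imports Defs
begin

text \<open>
  Only the shape of the arcs matters, not that they are critical. Let \<open>S\<close> be the length of one arc.
  The unit tangent \<open>T\<close> is \<open>2 S\<close>-periodic and even about \<open>S\<close>. Cut the small piece over
  \<open>[S - r, S + r]\<close>, whose two end tangents agree, out of the curve and insert it at arclength \<open>3 S\<close>;
  since there are at least three arcs, this is a \<open>C\<^sup>1\<close> curve with the same end points, length and
  bending energy, and it is close to the original one in \<open>W\<^sup>2\<^sup>,\<^sup>2\<close> as \<open>r\<close> tends to \<open>0\<close>. Its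
  curvature jumps at \<open>S - r\<close>, which a minimizer does not allow: subtracting a multiple of an odd bump
  of width \<open>d\<close> there lowers the energy to order \<open>d\<^sup>4\<close>, with an error of order \<open>d\<^sup>5\<close>.

  The moduli enter only through \<open>0 < q < 1\<close> and the sign of \<open>2 E(q) - K(q)\<close>, but since they are given
  by definite descriptions this needs the monotonicity of \<open>g\<close>.
\<close>

section \<open>Complete elliptic integrals\<close>

text \<open>The order of the choices is forced. \<open>S\<close> is an inflection point, so nothing
  jumps at r = 0; for 0 < r < S the derivative of the tangent jumps from a nonzero vector w to -w.
  The required closeness fixes r, and only then does w fix the width d. The bump x (d^2 - x^2)^2
  changes the tangent by O(d^4) and the second derivative by O(d^3). Its second derivative is odd,
  so the term of the bending energy linear in it would cancel to leading order against a continuous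
  curvature; against a curvature that changes sign the two halves add up to order d^4. The change of
  the tangent, length included, costs d^4 over a width of order d, and the quadratic term costs d^6
  over the same width. The second obstacle is regularity: \<gamma> is an arbitrary W^{2,2}
  parametrization, whose speed has merely an L^2 weak derivative. The comparison is therefore made
  in arclength, among piecewise C^2 curves, and carried back by composing both curves with the same
  arclength function.\<close>

definition dn_aux :: "real \<Rightarrow> real \<Rightarrow> real" where
  "dn_aux q \<theta> = sqrt (1 - q\<^sup>2 * (sin \<theta>)\<^sup>2)"

lemma modulus_bound:
  fixes q :: real
  assumes "\<bar>q\<bar> < 1"
  shows "q\<^sup>2 * (sin \<theta>)\<^sup>2 \<le> q\<^sup>2" "q\<^sup>2 < 1" "q\<^sup>2 * (sin \<theta>)\<^sup>2 < 1"
proof -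
  have "(sin \<theta>)\<^sup>2 \<le> 1" by (simp add: abs_square_le_1)
  then show 1: "q\<^sup>2 * (sin \<theta>)\<^sup>2 \<le> q\<^sup>2" by (simp add: mult_left_le)
  show 2: "q\<^sup>2 < 1" using assms by (simp add: abs_square_less_1)
  show "q\<^sup>2 * (sin \<theta>)\<^sup>2 < 1" using 1 2 by linarith
qed

lemma dn_aux_pos: "\<bar>q\<bar> < 1 \<Longrightarrow> dn_aux q \<theta> > 0"
  using modulus_bound(3)[of q \<theta>] by (simp add: dn_aux_def)

lemma dn_aux_sq: "\<bar>q\<bar> < 1 \<Longrightarrow> (dn_aux q \<theta>)\<^sup>2 = 1 - q\<^sup>2 * (sin \<theta>)\<^sup>2"
  using modulus_bound(3)[of q \<theta>] by (simp add: dn_aux_def)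

lemma dn_aux_le_1: "\<bar>q\<bar> < 1 \<Longrightarrow> dn_aux q \<theta> \<le> 1"
  by (simp add: dn_aux_def)

lemma dn_aux_ge: "\<bar>q\<bar> < 1 \<Longrightarrow> 1 - q\<^sup>2 \<le> dn_aux q \<theta>"
proof -
  assume q: "\<bar>q\<bar> < 1"
  have "(dn_aux q \<theta>)\<^sup>2 \<le> dn_aux q \<theta>"
    using dn_aux_le_1[OF q, of \<theta>] dn_aux_pos[OF q, of \<theta>] by (simp add: power2_eq_square mult_left_le)
  then show ?thesis using dn_aux_sq[OF q, of \<theta>] modulus_bound(1)[OF q, of \<theta>] by linarith
qed

lemma dn_aux_continuous [continuous_intros]:
  fixes f g :: "'a::t2_space \<Rightarrow> real"
  shows "continuous_on S f \<Longrightarrow> continuous_on S g \<Longrightarrow> continuous_on S (\<lambda>x. dn_aux (f x) (g x))"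
  unfolding dn_aux_def by (intro continuous_intros)

lemma dn_aux_DERIV:
  assumes "\<bar>q\<bar> < 1"
  shows "(dn_aux q has_real_derivative (- q\<^sup>2 * sin \<theta> * cos \<theta> / dn_aux q \<theta>)) (at \<theta>)"
  using modulus_bound(3)[OF assms, of \<theta>] unfolding dn_aux_def
  by (auto intro!: derivative_eq_intros simp: field_simps)

lemma ellK_eq: "ellK q = integral {0..pi/2} (\<lambda>\<theta>. 1 / dn_aux q \<theta>)"
  by (simp add: ellK_def ellF_def oint_def dn_aux_def)

lemma ellEc_eq: "ellEc q = integral {0..pi/2} (dn_aux q)"
  by (simp add: ellEc_def ellE_def oint_def dn_aux_def[abs_def])

lemma has_integral_sin_sq: "((\<lambda>\<theta>. (sin \<theta>)\<^sup>2) has_integral pi/4) {0..pi/2}"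
proof -
  have "((\<lambda>\<theta>. (sin \<theta>)\<^sup>2) has_integral ((pi/2 - sin (pi/2) * cos (pi/2))/2 - (0 - sin 0 * cos 0)/2)) {0..pi/2}"
    by (rule fundamental_theorem_of_calculus)
      (auto intro!: derivative_eq_intros has_real_derivative_iff_has_vector_derivative[THEN iffD1]
        simp: field_simps power2_eq_square cos_squared_eq[unfolded power2_eq_square])
  then show ?thesis by simp
qed

lemma has_integral_cos_sq: "((\<lambda>\<theta>. (cos \<theta>)\<^sup>2) has_integral pi/4) {0..pi/2}"
proof -
  have "((\<lambda>\<theta>. 1 - (sin \<theta>)\<^sup>2) has_integral (pi/2 - pi/4)) {0..pi/2}"
    using has_integral_diff[OF has_integral_const_real[of 1 0 "pi/2"] has_integral_sin_sq] by simp
  then show ?thesis by (simp add: cos_squared_eq)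
qed

lemma integrable_dn_aux:
  assumes "\<bar>q\<bar> < 1"
  shows "(\<lambda>\<theta>. 1 / dn_aux q \<theta>) integrable_on {a..b}" "dn_aux q integrable_on {a..b}"
  using dn_aux_pos[OF assms] by (auto intro!: integrable_continuous_real continuous_intros simp: less_imp_neq[symmetric])

lemma has_integral_ellK: "\<bar>q\<bar> < 1 \<Longrightarrow> ((\<lambda>\<theta>. 1 / dn_aux q \<theta>) has_integral ellK q) {0..pi/2}"
  and has_integral_ellEc: "\<bar>q\<bar> < 1 \<Longrightarrow> (dn_aux q has_integral ellEc q) {0..pi/2}"
  by (simp_all add: ellK_eq ellEc_eq integrable_dn_aux integrable_integral)

text \<open>Subtracting \<open>q\<^sup>2\<close> times the derivative of sin cos / dn from dn leaves
  exactly \<open>(1 - q\<^sup>2) / dn^3\<close>, and sin cos / dn vanishes at 0 and pi/2. This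
  identity is what expresses the derivative of K through E and K alone.\<close>

lemma has_integral_dn_inv_cube:
  assumes q: "\<bar>q\<bar> < 1"
  shows "((\<lambda>\<theta>. 1 / dn_aux q \<theta> ^ 3) has_integral (ellEc q / (1 - q\<^sup>2))) {0..pi/2}"
proof -
  have id: "dn_aux q \<theta> - q\<^sup>2 * (((cos \<theta>)\<^sup>2 - (sin \<theta>)\<^sup>2) / dn_aux q \<theta> + q\<^sup>2 * (sin \<theta>)\<^sup>2 * (cos \<theta>)\<^sup>2 / dn_aux q \<theta> ^ 3)
     = (1 - q\<^sup>2) / dn_aux q \<theta> ^ 3" for \<theta>
  proof -
    define d x where "d = dn_aux q \<theta>" and "x = (sin \<theta>)\<^sup>2"
    have d: "d > 0" "d^2 = 1 - q^2 * x" using dn_aux_pos[OF q] dn_aux_sq[OF q] by (auto simp: d_def x_def)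
    have "d^4 = (1 - q^2 * x)^2" using d(2) by (metis power_mult numeral_times_numeral semiring_norm(12) semiring_norm(13) power2_eq_square power4_eq_xxxx mult.assoc)
    moreover have "(d - q\<^sup>2 * (((1 - x) - x) / d + q\<^sup>2 * x * (1 - x) / d ^ 3)) * d^3 = d^4 - q^2 * ((1 - 2 * x) * d^2 + q^2 * x * (1 - x))"
      using d(1) by (simp add: field_simps power2_eq_square power3_eq_cube power4_eq_xxxx)
    ultimately have "(d - q\<^sup>2 * (((1 - x) - x) / d + q\<^sup>2 * x * (1 - x) / d ^ 3)) * d^3 = 1 - q^2"
      unfolding d(2) by (simp add: algebra_simps power2_eq_square)
    then have "d - q\<^sup>2 * (((1 - x) - x) / d + q\<^sup>2 * x * (1 - x) / d ^ 3) = (1 - q^2) / d^3"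
      using d(1) by (simp add: eq_divide_eq)
    then show ?thesis by (simp add: d_def x_def cos_squared_eq)
  qed
  have "((\<lambda>\<theta>. ((cos \<theta>)\<^sup>2 - (sin \<theta>)\<^sup>2) / dn_aux q \<theta> + q\<^sup>2 * (sin \<theta>)\<^sup>2 * (cos \<theta>)\<^sup>2 / dn_aux q \<theta> ^ 3) has_integral
      (sin (pi/2) * cos (pi/2) / dn_aux q (pi/2) - sin 0 * cos 0 / dn_aux q 0)) {0..pi/2}"
  proof (rule fundamental_theorem_of_calculus)
    fix \<theta> :: real
    define d where "d = dn_aux q \<theta>"
    have d: "d > 0" using dn_aux_pos[OF q] by (simp add: d_def)
    have D: "((\<lambda>\<theta>. sin \<theta> * cos \<theta> / dn_aux q \<theta>) has_real_derivative
       ((cos \<theta> * cos \<theta> + - sin \<theta> * sin \<theta>) * d - (sin \<theta> * cos \<theta>) * (- q\<^sup>2 * sin \<theta> * cos \<theta> / d)) / (d * d)) (at \<theta>)"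
      using d unfolding d_def by (intro DERIV_divide DERIV_mult DERIV_sin DERIV_cos dn_aux_DERIV[OF q]) auto
    have E: "((c * c + - s * s) * d - (s * c) * (- q\<^sup>2 * s * c / d)) / (d * d) = (c\<^sup>2 - s\<^sup>2) / d + q\<^sup>2 * s\<^sup>2 * c\<^sup>2 / d ^ 3" for c s :: real
      using d by (simp add: field_simps power2_eq_square power3_eq_cube)
    show "((\<lambda>\<theta>. sin \<theta> * cos \<theta> / dn_aux q \<theta>) has_vector_derivative
       ((cos \<theta>)\<^sup>2 - (sin \<theta>)\<^sup>2) / dn_aux q \<theta> + q\<^sup>2 * (sin \<theta>)\<^sup>2 * (cos \<theta>)\<^sup>2 / dn_aux q \<theta> ^ 3) (at \<theta> within {0..pi/2})"
      using has_vector_derivative_at_within[OF D[unfolded E has_real_derivative_iff_has_vector_derivative]]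
      unfolding d_def .
  qed auto
  then have 1: "((\<lambda>\<theta>. q\<^sup>2 * (((cos \<theta>)\<^sup>2 - (sin \<theta>)\<^sup>2) / dn_aux q \<theta> + q\<^sup>2 * (sin \<theta>)\<^sup>2 * (cos \<theta>)\<^sup>2 / dn_aux q \<theta> ^ 3)) has_integral 0) {0..pi/2}"
    by (drule_tac has_integral_mult_right[where c = "q\<^sup>2"]) simp
  have "((\<lambda>\<theta>. (1 - q\<^sup>2) / dn_aux q \<theta> ^ 3) has_integral ellEc q) {0..pi/2}"
    using has_integral_diff[OF has_integral_ellEc[OF q] 1] by (simp add: id)
  from has_integral_mult_right[OF this, of "1 / (1 - q\<^sup>2)"]
  show ?thesis using modulus_bound(2)[OF q] by simp
qed

text \<open>Differentiation under the integral sign gives the integrand q sin^2 / dn^3, which equals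
  (1/dn^3 - 1/dn) / q, and both of these integrals are known. It dominates q sin^2, whose integral q
  pi/4 supplies the strict sign.\<close>

lemma ellK_DERIV:
  assumes "0 < q" "q < 1"
  shows "(ellK has_real_derivative ((ellEc q / (1 - q\<^sup>2) - ellK q) / q)) (at q)"
    and "(ellEc q / (1 - q\<^sup>2) - ellK q) / q > 0"
proof -
  have q: "\<bar>q\<bar> < 1" using assms by simp
  have *: "((\<lambda>\<theta>. (1 / q) * (1 / dn_aux q \<theta> ^ 3 - 1 / dn_aux q \<theta>)) has_integral ((1/q) * (ellEc q / (1 - q\<^sup>2) - ellK q))) {0..pi/2}"
    by (intro has_integral_mult_right has_integral_diff has_integral_dn_inv_cube has_integral_ellK q)
  have e: "(1 / q) * (1 / dn_aux q \<theta> ^ 3 - 1 / dn_aux q \<theta>) = q * (sin \<theta>)\<^sup>2 / dn_aux q \<theta> ^ 3" for \<theta>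
  proof -
    have "(1 / q) * (1 / dn_aux q \<theta> ^ 3 - 1 / dn_aux q \<theta>) = (1/q) * (1 - (dn_aux q \<theta>)\<^sup>2) / dn_aux q \<theta> ^ 3"
      using dn_aux_pos[OF q, of \<theta>] by (simp add: field_simps power2_eq_square power3_eq_cube)
    also have "\<dots> = q * (sin \<theta>)\<^sup>2 / dn_aux q \<theta> ^ 3"
      using assms by (simp add: dn_aux_sq[OF q] field_simps power2_eq_square[of q])
    finally show ?thesis .
  qed
  have I: "((\<lambda>\<theta>. q * (sin \<theta>)\<^sup>2 / dn_aux q \<theta> ^ 3) has_integral ((ellEc q / (1 - q\<^sup>2) - ellK q) / q)) {0..pi/2}"
    using * unfolding e by simp
  have "((\<lambda>q. integral (cbox 0 (pi/2)) (\<lambda>\<theta>. 1 / dn_aux q \<theta>)) has_field_derivative 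
      integral (cbox 0 (pi/2)) (\<lambda>\<theta>. q * (sin \<theta>)\<^sup>2 / dn_aux q \<theta> ^ 3)) (at q within {0<..<1})"
  proof (rule leibniz_rule_field_derivative)
    fix x t :: real assume x: "x \<in> {0<..<1}"
    then have x1: "\<bar>x\<bar> < 1" by simp
    have s: "dn_aux x t = sqrt (1 - x\<^sup>2 * (sin t)\<^sup>2)" "0 < 1 - x\<^sup>2 * (sin t)\<^sup>2"
      using modulus_bound(3)[OF x1, of t] by (auto simp: dn_aux_def)
    have "((\<lambda>x. dn_aux x t) has_field_derivative (- x * (sin t)\<^sup>2 / dn_aux x t)) (at x within {0<..<1})"
      unfolding dn_aux_def using s by (auto intro!: derivative_eq_intros simp: field_simps)
    from DERIV_inverse'[OF this]
    show "((\<lambda>x. 1 / dn_aux x t) has_field_derivative (x * (sin t)\<^sup>2 / dn_aux x t ^ 3)) (at x within {0<..<1})"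
      using dn_aux_pos[OF x1, of t] by (simp add: field_simps power3_eq_cube)
  next
    show "(\<lambda>\<theta>. 1 / dn_aux x \<theta>) integrable_on cbox 0 (pi/2)" if "x \<in> {0<..<1}" for x
      using integrable_dn_aux(1)[of x 0 "pi/2"] that by simp
    show "continuous_on ({0<..<1} \<times> cbox 0 (pi/2)) (\<lambda>(x, t). x * (sin t)\<^sup>2 / dn_aux x t ^ 3)"
      by (auto simp: split_beta intro!: continuous_intros dest!: dn_aux_pos[rotated] )
        (metis abs_of_pos dn_aux_pos less_irrefl)
  qed (use assms in auto)
  then show "(ellK has_real_derivative ((ellEc q / (1 - q\<^sup>2) - ellK q) / q)) (at q)"
    using integral_unique[OF I] at_within_open[of q "{0<..<1}"] assms by (simp add: ellK_eq[abs_def])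
  have "q * (pi/4) \<le> (ellEc q / (1 - q\<^sup>2) - ellK q) / q"
  proof (rule has_integral_le[OF has_integral_mult_right[OF has_integral_sin_sq] I])
    fix \<theta> :: real
    have "dn_aux q \<theta> ^ 3 \<le> 1" using dn_aux_le_1[OF q] dn_aux_pos[OF q, of \<theta>] by (simp add: power_le_one)
    moreover have "dn_aux q \<theta> ^ 3 > 0" using dn_aux_pos[OF q] by simp
    ultimately show "q * (sin \<theta>)\<^sup>2 \<le> q * (sin \<theta>)\<^sup>2 / dn_aux q \<theta> ^ 3"
      using assms by (simp add: le_divide_eq mult_left_le)
  qed
  then show "(ellEc q / (1 - q\<^sup>2) - ellK q) / q > 0"
    using assms by (smt (verit) mult_pos_pos pi_gt_zero zero_less_divide_iff)
qed

text \<open>As for K, now with - q sin^2 / dn = (dn - 1/dn) / q; the comparison with - q sin^2 makes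
  the derivative negative, which is the inequality E < K.\<close>

lemma ellEc_DERIV:
  assumes "0 < q" "q < 1"
  shows "(ellEc has_real_derivative ((ellEc q - ellK q) / q)) (at q)"
    and "ellEc q < ellK q"
proof -
  have q: "\<bar>q\<bar> < 1" using assms by simp
  have *: "((\<lambda>\<theta>. (1 / q) * (dn_aux q \<theta> - 1 / dn_aux q \<theta>)) has_integral ((1/q) * (ellEc q - ellK q))) {0..pi/2}"
    by (intro has_integral_mult_right has_integral_diff has_integral_ellEc has_integral_ellK q)
  have e: "(1 / q) * (dn_aux q \<theta> - 1 / dn_aux q \<theta>) = - q * (sin \<theta>)\<^sup>2 / dn_aux q \<theta>" for \<theta>
  proof -
    have "(1 / q) * (dn_aux q \<theta> - 1 / dn_aux q \<theta>) = (1/q) * ((dn_aux q \<theta>)\<^sup>2 - 1) / dn_aux q \<theta>"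
      using dn_aux_pos[OF q, of \<theta>] by (simp add: field_simps power2_eq_square)
    also have "\<dots> = - q * (sin \<theta>)\<^sup>2 / dn_aux q \<theta>"
      using assms by (simp add: dn_aux_sq[OF q] field_simps power2_eq_square[of q])
    finally show ?thesis .
  qed
  have I: "((\<lambda>\<theta>. - q * (sin \<theta>)\<^sup>2 / dn_aux q \<theta>) has_integral ((ellEc q - ellK q) / q)) {0..pi/2}"
    using * unfolding e by simp
  have "((\<lambda>q. integral (cbox 0 (pi/2)) (\<lambda>\<theta>. dn_aux q \<theta>)) has_field_derivative 
      integral (cbox 0 (pi/2)) (\<lambda>\<theta>. - q * (sin \<theta>)\<^sup>2 / dn_aux q \<theta>)) (at q within {0<..<1})"
  proof (rule leibniz_rule_field_derivative)
    fix x t :: real assume x: "x \<in> {0<..<1}"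
    then have x1: "\<bar>x\<bar> < 1" by simp
    have s: "dn_aux x t = sqrt (1 - x\<^sup>2 * (sin t)\<^sup>2)" "0 < 1 - x\<^sup>2 * (sin t)\<^sup>2"
      using modulus_bound(3)[OF x1, of t] by (auto simp: dn_aux_def)
    show "((\<lambda>x. dn_aux x t) has_field_derivative (- x * (sin t)\<^sup>2 / dn_aux x t)) (at x within {0<..<1})"
      unfolding dn_aux_def using s by (auto intro!: derivative_eq_intros simp: field_simps)
  next
    show "(\<lambda>\<theta>. dn_aux x \<theta>) integrable_on cbox 0 (pi/2)" if "x \<in> {0<..<1}" for x
      using integrable_dn_aux(2)[of x 0 "pi/2"] that by simp
    show "continuous_on ({0<..<1} \<times> cbox 0 (pi/2)) (\<lambda>(x, t). - x * (sin t)\<^sup>2 / dn_aux x t)"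
      by (auto simp: split_beta intro!: continuous_intros)
        (metis abs_of_pos dn_aux_pos less_irrefl)
  qed (use assms in auto)
  then show "(ellEc has_real_derivative ((ellEc q - ellK q) / q)) (at q)"
    using integral_unique[OF I] at_within_open[of q "{0<..<1}"] assms by (simp add: ellEc_eq[abs_def])
  have "(ellEc q - ellK q) / q \<le> - q * (pi/4)"
  proof (rule has_integral_le[OF I has_integral_mult_right[OF has_integral_sin_sq]])
    fix \<theta> :: real
    show "- q * (sin \<theta>)\<^sup>2 / dn_aux q \<theta> \<le> - q * (sin \<theta>)\<^sup>2"
      using assms dn_aux_le_1[OF q, of \<theta>] dn_aux_pos[OF q, of \<theta>] by (simp add: le_divide_eq divide_le_eq mult_left_le)
  qed
  moreover have "- q * (pi/4) < 0" using assms by simp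
  ultimately have "(ellEc q - ellK q) / q < 0" by linarith
  then show "ellEc q < ellK q" using assms by (simp add: divide_less_0_iff)
qed

lemma ellEc_pos: "\<bar>q\<bar> < 1 \<Longrightarrow> ellEc q > 0"
  and ellEc_le: "\<bar>q\<bar> < 1 \<Longrightarrow> ellEc q \<le> pi / 2"
proof -
  assume q: "\<bar>q\<bar> < 1"
  have "(1 - q\<^sup>2) * (pi/2) \<le> ellEc q"
    using has_integral_le[OF has_integral_const_real[of "1 - q\<^sup>2" 0 "pi/2"] has_integral_ellEc[OF q]] dn_aux_ge[OF q]
    by (simp add: mult.commute)
  moreover have "(1 - q\<^sup>2) * (pi/2) > 0" using modulus_bound(2)[OF q] by simp
  ultimately show "ellEc q > 0" by linarith
  show "ellEc q \<le> pi / 2"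
    using has_integral_le[OF has_integral_ellEc[OF q] has_integral_const_real[of 1 0 "pi/2"]] dn_aux_le_1[OF q] by simp
qed

text \<open>With the complementary modulus k, dn is at most cos + k, and cos \<theta> is at most
  pi/2 - \<theta>. So the integrand of K is at least 1 / (pi/2 - \<theta> + k), whose integral is ln
  (pi/2 + k) - ln k. Only the logarithmic blow-up at q = 1 is kept.\<close>

lemma ellK_ge: "\<bar>q\<bar> < 1 \<Longrightarrow> - ln (sqrt (1 - q\<^sup>2)) \<le> ellK q"
proof -
  assume q: "\<bar>q\<bar> < 1"
  define k where "k = sqrt (1 - q\<^sup>2)"
  have k: "k > 0" "k\<^sup>2 = 1 - q\<^sup>2" using modulus_bound(2)[OF q] by (auto simp: k_def)
  have I: "((\<lambda>\<theta>. 1 / (pi/2 - \<theta> + k)) has_integral (- ln (pi/2 - pi/2 + k) - - ln (pi/2 - 0 + k))) {0..pi/2}"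
    using k(1) by (intro fundamental_theorem_of_calculus)
      (auto intro!: derivative_eq_intros has_real_derivative_iff_has_vector_derivative[THEN iffD1] simp: field_simps)
  have "- ln (pi/2 - pi/2 + k) - - ln (pi/2 - 0 + k) \<le> ellK q"
  proof (rule has_integral_le[OF I has_integral_ellK[OF q]])
    fix \<theta> :: real assume \<theta>: "\<theta> \<in> {0..pi/2}"
    have c0: "cos \<theta> \<ge> 0" using \<theta> by (intro cos_ge_zero) auto
    have "cos \<theta> = sin (pi/2 - \<theta>)" by (simp add: sin_diff)
    also have "\<dots> \<le> pi/2 - \<theta>" using \<theta> by (intro sin_x_le_x) auto
    finally have c: "cos \<theta> \<le> pi/2 - \<theta>" .
    have "(sin \<theta>)\<^sup>2 \<le> 1" by (simp add: abs_square_le_1)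
    then have "(dn_aux q \<theta>)\<^sup>2 \<le> (cos \<theta>)\<^sup>2 + k\<^sup>2"
      using modulus_bound(2)[OF q] mult_right_mono[of "q\<^sup>2" 1 "1 - (sin \<theta>)\<^sup>2"] 
      by (simp add: dn_aux_sq[OF q] k(2) cos_squared_eq algebra_simps)
    also have "\<dots> \<le> (cos \<theta> + k)\<^sup>2" using c0 k(1) by (simp add: power2_sum)
    finally have "dn_aux q \<theta> \<le> cos \<theta> + k" by (rule power2_le_imp_le) (use c0 k(1) in simp)
    then have "dn_aux q \<theta> \<le> pi/2 - \<theta> + k" using c by linarith
    then show "1 / (pi/2 - \<theta> + k) \<le> 1 / dn_aux q \<theta>"
      using dn_aux_pos[OF q, of \<theta>] by (intro divide_left_mono) (auto simp: mult_pos_pos)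
  qed
  moreover have "ln (pi/2 + k) \<ge> 0" using k(1) pi_gt3 by (intro ln_ge_zero) linarith
  ultimately show ?thesis by (simp add: k_def)
qed

lemma ellK_unbounded: "\<exists>q. a < q \<and> q < 1 \<and> M \<le> ellK q" if "0 < a" "a < 1"
proof -
  \<comment> \<open>e is the complementary modulus of the q to be found: the first bound makes - ln
    e at least M, the second makes q exceed a.\<close>
  define e where "e = min (exp (- M)) (sqrt (1 - a\<^sup>2) / 2)"
  have a: "a\<^sup>2 < 1" using that by (simp add: power_less_one_iff)
  have e: "e > 0" "e \<le> exp (- M)" "e \<le> sqrt (1 - a\<^sup>2) / 2" using a by (auto simp: e_def)
  have "e < sqrt (1 - a\<^sup>2)" using e a real_sqrt_gt_zero[of "1 - a\<^sup>2"] by linarith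
  then have e2: "e\<^sup>2 < 1 - a\<^sup>2" using e(1) a power_strict_mono[of e "sqrt (1 - a\<^sup>2)" 2] by simp
  define q where "q = sqrt (1 - e\<^sup>2)"
  have "e\<^sup>2 \<le> 1" using e2 zero_le_power2[of a] by linarith
  then have q: "q\<^sup>2 = 1 - e\<^sup>2" "q \<ge> 0" by (auto simp: q_def)
  have "a\<^sup>2 < q\<^sup>2" "q\<^sup>2 < 1" using e2 e(1) q by auto
  then have q1: "a < q" "q < 1"
    using power2_less_imp_less[of a q] power2_less_imp_less[of q 1] q(2) by simp_all
  have "ln e \<le> ln (exp (- M))" using e(1,2) by (subst ln_le_cancel_iff) auto
  then have "M \<le> - ln e" by simp
  moreover have "sqrt (1 - q\<^sup>2) = e" using q e by simp
  ultimately have "M \<le> ellK q" using ellK_ge[of q] q1 q(2) by simp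
  then show ?thesis using q1 by blast
qed

section \<open>The function 2E - K and its zero\<close>

lemma inv_sqrt2: "0 < 1 / sqrt (2::real)" "1 / sqrt (2::real) < 1" "(1 / sqrt (2::real))\<^sup>2 = 1 / 2"
  by (auto simp: power_divide)

lemma elliptic_continuous_on: "S \<subseteq> {0<..<1} \<Longrightarrow> continuous_on S ellK" "S \<subseteq> {0<..<1} \<Longrightarrow> continuous_on S ellEc"
  by (auto intro!: continuous_at_imp_continuous_on DERIV_isCont ellK_DERIV(1) ellEc_DERIV(1) dest!: subsetD)

text \<open>Up to the factor 2 / \<alpha>, the signed distance between the end points of one arc in
  the direction of the axis. Its sign separates arcs from loops.\<close>

definition plen :: "real \<Rightarrow> real" where "plen q = 2 * ellEc q - ellK q"

lemma plen_DERIV: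
  assumes "0 < q" "q < 1"
  shows "(plen has_real_derivative (2 * ((ellEc q - ellK q) / q) - (ellEc q / (1 - q\<^sup>2) - ellK q) / q)) (at q)"
    and "2 * ((ellEc q - ellK q) / q) - (ellEc q / (1 - q\<^sup>2) - ellK q) / q < 0"
proof -
  show "(plen has_real_derivative (2 * ((ellEc q - ellK q) / q) - (ellEc q / (1 - q\<^sup>2) - ellK q) / q)) (at q)"
    unfolding plen_def[abs_def] by (intro DERIV_diff DERIV_cmult ellK_DERIV(1) ellEc_DERIV(1) assms)
  have "(ellEc q - ellK q) / q < 0" using ellEc_DERIV(2)[OF assms] assms by (simp add: divide_less_0_iff)
  then show "2 * ((ellEc q - ellK q) / q) - (ellEc q / (1 - q\<^sup>2) - ellK q) / q < 0"
    using ellK_DERIV(2)[OF assms] by linarith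
qed

lemma plen_strict_antimono: "0 < a \<Longrightarrow> a < b \<Longrightarrow> b < 1 \<Longrightarrow> plen b < plen a"
  by (rule DERIV_neg_imp_decreasing) (use plen_DERIV in force)+

lemma plen_continuous_on: "S \<subseteq> {0<..<1} \<Longrightarrow> continuous_on S plen"
  unfolding plen_def[abs_def] by (intro continuous_intros elliptic_continuous_on)

text \<open>At \<open>q\<^sup>2 = 1/2\<close> one has 2 dn^2 - 1 = cos^2, so the integrand 2 dn -
  1/dn is cos^2 / dn, which is at least cos^2.\<close>

lemma plen_inv_sqrt2_pos: "plen (1 / sqrt 2) > 0"
proof -
  let ?q = "1 / sqrt (2::real)"
  have q: "\<bar>?q\<bar> < 1" using inv_sqrt2 by simp
  have I: "((\<lambda>\<theta>. 2 * dn_aux ?q \<theta> - 1 / dn_aux ?q \<theta>) has_integral plen ?q) {0..pi/2}"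
    unfolding plen_def by (intro has_integral_diff has_integral_mult_right has_integral_ellK has_integral_ellEc q)
  have "pi / 4 \<le> plen ?q"
  proof (rule has_integral_le[OF has_integral_cos_sq I])
    fix \<theta> :: real
    define d where "d = dn_aux ?q \<theta>"
    have d: "d > 0" "d \<le> 1" using dn_aux_pos[OF q] dn_aux_le_1[OF q] by (auto simp: d_def)
    have "2 * d - 1 / d = (2 * d\<^sup>2 - 1) / d" using d by (simp add: field_simps power2_eq_square)
    also have "2 * d\<^sup>2 - 1 = (cos \<theta>)\<^sup>2" unfolding d_def dn_aux_sq[OF q] by (simp add: inv_sqrt2(3) cos_squared_eq)
    finally show "(cos \<theta>)\<^sup>2 \<le> 2 * dn_aux ?q \<theta> - 1 / dn_aux ?q \<theta>"
      using d by (simp add: d_def[symmetric] le_divide_eq mult_left_le)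
  qed
  then show ?thesis using pi_gt_zero by linarith
qed

lemma qstar: "1 / sqrt 2 < qstar" "qstar < 1" "plen qstar = 0"
  and plen_pos: "\<And>q. 0 < q \<Longrightarrow> q < qstar \<Longrightarrow> plen q > 0"
  and plen_neg: "\<And>q. qstar < q \<Longrightarrow> q < 1 \<Longrightarrow> plen q < 0"
proof -
  \<comment> \<open>The threshold is pi because 2E never exceeds pi, so that 2E - K is nonpositive
    at r.\<close>
  obtain r where r: "1 / sqrt 2 < r" "r < 1" "pi \<le> ellK r"
    using ellK_unbounded[OF inv_sqrt2(1,2)] by blast
  have "plen r \<le> 0" using ellEc_le[of r] r inv_sqrt2(1) by (simp add: plen_def)
  then obtain z where z: "1 / sqrt 2 \<le> z" "z \<le> r" "plen z = 0"
    using IVT2'[of plen r 0 "1 / sqrt 2"] plen_inv_sqrt2_pos r inv_sqrt2(1) plen_continuous_on[of "{1 / sqrt 2..r}"]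
    by (auto simp: subset_eq)
  then have z1: "0 < z" "z < 1" using r inv_sqrt2(1) by linarith+
  have "qstar = z" unfolding qstar_def
  proof (rule the_equality)
    fix q assume "0 < q \<and> q < 1 \<and> 2 * ellEc q - ellK q = 0"
    then show "q = z" using plen_strict_antimono[of q z] plen_strict_antimono[of z q] z z1
      by (fastforce simp: plen_def)
  qed (use z z1 in \<open>auto simp: plen_def\<close>)
  moreover have "z \<noteq> 1 / sqrt 2" using plen_inv_sqrt2_pos z by auto
  ultimately show q: "1 / sqrt 2 < qstar" "qstar < 1" "plen qstar = 0" using z z1 by auto
  show "plen q > 0" if "0 < q" "q < qstar" for q using plen_strict_antimono[OF that] q by auto
  show "plen q < 0" if "qstar < q" "q < 1" for q 
    using plen_strict_antimono[of qstar q] that q inv_sqrt2(1) by auto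
qed

section \<open>The sign of f and the critical modulus\<close>

lemma fq_continuous_on: "S \<subseteq> {0<..<1} \<Longrightarrow> continuous_on S fq"
  unfolding fq_def[abs_def] by (intro continuous_intros elliptic_continuous_on)

text \<open>The sign of \<open>f\<close> is that of \<open>E/K\<close> minus a rational function of \<open>m = q\<^sup>2\<close>;
  the former decreases and the latter increases, so \<open>f\<close> changes sign once.\<close>
lemma fq_single_crossing:
  assumes "1 / sqrt 2 \<le> x" "x < y" "y < 1" "fq y \<ge> 0"
  shows "fq x > 0"
proof -
  have x0: "0 < x" "x < 1" "0 < y" using assms inv_sqrt2(1) by linarith+
  define N D where "N = (\<lambda>m::real. (1 - m) * (4 * m - 1))" and "D = (\<lambda>m::real. - 8 * m\<^sup>2 + 8 * m - 1)"
  have fq: "fq q = D (q\<^sup>2) * ellEc q - N (q\<^sup>2) * ellK q" for q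
    by (simp add: fq_def N_def D_def algebra_simps power2_eq_square power4_eq_xxxx)
  have "1 / 2 \<le> x\<^sup>2" using power_mono[OF assms(1), of 2] inv_sqrt2 by simp
  moreover have "x\<^sup>2 < y\<^sup>2" using x0 assms by (intro power_strict_mono) auto
  moreover have "y\<^sup>2 < 1" using x0 assms by (simp add: power_less_one_iff)
  ultimately obtain a b where ab: "a = x\<^sup>2" "b = y\<^sup>2" "1/2 \<le> a" "a < b" "b < 1" by blast
  have Kp: "ellK x > 0" "ellK y > 0" "ellEc x > 0" "ellEc y > 0" "ellK x < ellK y" "ellEc y < ellEc x"
  proof -
    show e: "ellEc x > 0" "ellEc y > 0" using ellEc_pos x0 assms by auto
    show k: "ellK x > 0" "ellK y > 0" using ellEc_DERIV(2)[of x] ellEc_DERIV(2)[of y] x0 assms e by auto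
    show "ellK x < ellK y"
      by (rule DERIV_pos_imp_increasing[OF assms(2)]) (use ellK_DERIV x0 assms in force)
    show "ellEc y < ellEc x"
    proof (rule DERIV_neg_imp_decreasing[OF assms(2)])
      fix t assume t: "x \<le> t" "t \<le> y"
      then have "0 < t" "t < 1" using x0 assms by auto
      then show "\<exists>d. (ellEc has_real_derivative d) (at t) \<and> d < 0"
        using ellEc_DERIV[of t] by (auto simp: divide_less_0_iff intro!: exI[of _ "(ellEc t - ellK t) / t"])
    qed
  qed
  have N: "N a > 0" "N b > 0" using ab by (auto simp: N_def intro!: mult_pos_pos)
  have f: "N b * ellK y \<le> D b * ellEc y" using assms(4) ab by (simp add: fq)
  moreover have "N b * ellK y > 0" using N Kp by simp
  \<comment> \<open>D is negative near m = 1, so its sign cannot be read off the range of b; it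
    comes from the assumption \<open>fq y \<ge> 0\<close>. As D decreases on [1/2, 1], the sign
    passes on to a.\<close>
  ultimately have Db: "D b > 0" using Kp(4) by (meson less_le_trans zero_less_mult_pos2)
  have "D a - D b = (b - a) * (8 * (a + b - 1))" by (simp add: D_def algebra_simps power2_eq_square)
  moreover have "(b - a) * (8 * (a + b - 1)) \<ge> 0" using ab by (intro mult_nonneg_nonneg) auto
  ultimately have Da: "D a > 0" using Db by linarith
  \<comment> \<open>Cross-multiplied form of the claim that N/D increases; centring at 1/2 makes the
    right side visibly positive.\<close>
  have "N b * D a - N a * D b = (b - a) * (8 * ((a - 1/2) * (b - 1/2)) + 1)"
    by (simp add: N_def D_def algebra_simps power2_eq_square)
  moreover have "(b - a) * (8 * ((a - 1/2) * (b - 1/2)) + 1) > 0"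
    using ab by (intro mult_pos_pos add_nonneg_pos mult_nonneg_nonneg) auto
  ultimately have cr: "N a * D b < N b * D a" by linarith
  have "N a * ellK x * D b < N b * D a * ellK y"
  proof -
    have "N a * D b * ellK x < N b * D a * ellK x" using cr Kp by simp
    also have "\<dots> < N b * D a * ellK y" using N Da Kp by simp
    finally show ?thesis by (simp add: mult_ac)
  qed
  also have "\<dots> \<le> D a * (D b * ellEc y)" using mult_left_mono[OF f, of "D a"] Da by (simp add: mult_ac)
  also have "\<dots> < D a * (D b * ellEc x)" using Da Db Kp by simp
  finally have "D b * (N a * ellK x) < D b * (D a * ellEc x)" by (simp add: mult_ac)
  then show ?thesis using Db ab by (simp add: fq)
qed

text \<open>f equals (2E - K) / 2 at 1 / sqrt 2, hence is positive there; at \<open>qstar\<close>,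
  where K = 2E, it collapses to E (1 - 2 q^2), hence is negative. So the zero lies strictly before
  \<open>qstar\<close>, and the single crossing gives uniqueness and both signs.\<close>

lemma qhat: "1 / sqrt 2 < qhat" "qhat < qstar" "fq qhat = 0"
  and fq_pos: "\<And>q. 1 / sqrt 2 \<le> q \<Longrightarrow> q < qhat \<Longrightarrow> fq q > 0"
  and fq_neg: "\<And>q. qhat < q \<Longrightarrow> q < 1 \<Longrightarrow> fq q < 0"
proof -
  let ?a = "1 / sqrt (2::real)"
  have a4: "?a ^ 4 = 1 / 4"
    using power_mult[of ?a 2 2] inv_sqrt2(3) by (simp add: power2_eq_square)
  have fa: "fq ?a > 0"
    unfolding fq_def a4 inv_sqrt2(3) using plen_inv_sqrt2_pos by (simp add: plen_def)
  have s0: "0 < qstar" using qstar inv_sqrt2(1) by linarith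
  have fs: "fq qstar < 0"
  proof -
    have "ellK qstar = 2 * ellEc qstar" using qstar(3) by (simp add: plen_def)
    then have "fq qstar = ellEc qstar * (1 - 2 * qstar\<^sup>2)"
      by (simp add: fq_def algebra_simps)
    moreover have "qstar\<^sup>2 > 1 / 2" using power_strict_mono[OF qstar(1), of 2] inv_sqrt2 by simp
    moreover have "ellEc qstar > 0" using ellEc_pos[of qstar] qstar s0 by simp
    ultimately show ?thesis by (simp add: mult_pos_neg)
  qed
  obtain z where z: "?a \<le> z" "z \<le> qstar" "fq z = 0"
    using IVT2'[of fq qstar 0 ?a] fa fs qstar inv_sqrt2(1) fq_continuous_on[of "{?a..qstar}"]
    by (auto simp: subset_eq)
  have z1: "z \<noteq> ?a" "z \<noteq> qstar" using z fa fs by auto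
  have "qhat = z" unfolding qhat_def
  proof (rule the_equality)
    show "?a \<le> z \<and> z < 1 \<and> fq z = 0" using z qstar by auto
    fix q assume q: "?a \<le> q \<and> q < 1 \<and> fq q = 0"
    show "q = z"
      using fq_single_crossing[of q z] fq_single_crossing[of z q] q z qstar(2) by force
  qed
  then show q: "?a < qhat" "qhat < qstar" "fq qhat = 0" using z z1 by auto
  show "fq q > 0" if "?a \<le> q" "q < qhat" for q
    using fq_single_crossing[of q qhat] that q qstar by auto
  show "fq q < 0" if "qhat < q" "q < 1" for q
    using fq_single_crossing[of qhat q] that q by force
qed

text \<open>This factorization is where f comes from: g' has the sign of (2E - K) f, so the branches
  of g change at \<open>qhat\<close> and \<open>qstar\<close> only.\<close>

lemma gq_DERIV:
  assumes "0 < q" "q < 1"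
  shows "(gq has_real_derivative (16 * plen q * fq q / (q * (1 - q\<^sup>2)))) (at q)"
proof -
  let ?P = "2 * ((ellEc q - ellK q) / q) - (ellEc q / (1 - q\<^sup>2) - ellK q) / q"
  have q1: "1 - q\<^sup>2 > 0" using assms by (simp add: power_less_one_iff)
  have "gq = (\<lambda>q. 8 * (plen q)\<^sup>2 * (2 * q\<^sup>2 - 1))" by (simp add: gq_def[abs_def] plen_def)
  moreover have "((\<lambda>q. 8 * (plen q)\<^sup>2 * (2 * q\<^sup>2 - 1)) has_real_derivative
      (8 * (2 * plen q * ?P) * (2 * q\<^sup>2 - 1) + 8 * (plen q)\<^sup>2 * (4 * q))) (at q)"
    using plen_DERIV(1)[OF assms] by (auto intro!: derivative_eq_intros simp: power2_eq_square)
  moreover have "8 * (2 * plen q * ?P) * (2 * q\<^sup>2 - 1) + 8 * (plen q)\<^sup>2 * (4 * q)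
     = 16 * plen q * (?P * (2 * q\<^sup>2 - 1) + 2 * q * plen q)"
  proof -
    have "8 * (2 * p * P) * w + 8 * p\<^sup>2 * (4 * q) = 16 * p * (P * w + 2 * q * p)" for p P w :: real
      by (simp add: algebra_simps power2_eq_square)
    then show ?thesis .
  qed
  moreover have "?P * (2 * q\<^sup>2 - 1) + 2 * q * plen q = fq q / (q * (1 - q\<^sup>2))"
  proof -
    have "?P = ((1 - 2 * q\<^sup>2) * ellEc q - (1 - q\<^sup>2) * ellK q) / (q * (1 - q\<^sup>2))"
      using q1 assms by (simp add: field_simps)
    then have "?P * (2 * q\<^sup>2 - 1) + 2 * q * plen q = 
       (((1 - 2 * q\<^sup>2) * ellEc q - (1 - q\<^sup>2) * ellK q) * (2 * q\<^sup>2 - 1) + 2 * q\<^sup>2 * (1 - q\<^sup>2) * plen q) / (q * (1 - q\<^sup>2))"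
      using q1 assms by (simp add: add_divide_distrib power2_eq_square)
    also have "((1 - 2 * q\<^sup>2) * ellEc q - (1 - q\<^sup>2) * ellK q) * (2 * q\<^sup>2 - 1) + 2 * q\<^sup>2 * (1 - q\<^sup>2) * plen q = fq q"
      by (simp add: fq_def plen_def algebra_simps power2_eq_square power4_eq_xxxx)
    finally show ?thesis .
  qed
  ultimately show ?thesis by (metis times_divide_eq_right)
qed

lemma gq_continuous_on: "S \<subseteq> {0<..<1} \<Longrightarrow> continuous_on S gq"
  by (auto intro!: continuous_at_imp_continuous_on DERIV_isCont gq_DERIV dest!: subsetD)

text \<open>The sign is required only strictly inside the interval, since \<open>qhat\<close> and
  \<open>qstar\<close>, where the derivative vanishes, occur as end points.\<close>

lemma gq_strict_mono:
  assumes "0 < x" "x < y" "y < 1" and "\<And>t. x < t \<Longrightarrow> t < y \<Longrightarrow> plen t * fq t > 0"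
  shows "gq x < gq y"
proof (rule DERIV_pos_imp_increasing_open[OF assms(2)])
  fix t assume t: "x < t" "t < y"
  then have "0 < t" "t < 1" using assms by auto
  moreover from this have "t * (1 - t\<^sup>2) > 0" by (simp add: power_less_one_iff)
  moreover have "plen t * fq t > 0" using assms(4) t by blast
  ultimately have "16 * plen t * fq t / (t * (1 - t\<^sup>2)) > 0" by (simp add: zero_less_mult_iff)
  then show "\<exists>d. (gq has_real_derivative d) (at t) \<and> 0 < d"
    using gq_DERIV[OF \<open>0 < t\<close> \<open>t < 1\<close>] by blast
next
  show "continuous_on {x..y} gq"
    by (rule gq_continuous_on) (use assms in auto)
qed

lemma gq_strict_antimono:
  assumes "0 < x" "x < y" "y < 1" and "\<And>t. x < t \<Longrightarrow> t < y \<Longrightarrow> plen t * fq t < 0"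
  shows "gq y < gq x"
proof (rule DERIV_neg_imp_decreasing_open[OF assms(2)])
  fix t assume t: "x < t" "t < y"
  then have "0 < t" "t < 1" using assms by auto
  moreover from this have "t * (1 - t\<^sup>2) > 0" by (simp add: power_less_one_iff)
  moreover have "plen t * fq t < 0" using assms(4) t by blast
  ultimately have "16 * plen t * fq t / (t * (1 - t\<^sup>2)) < 0"
    by (simp add: mult_less_0_iff zero_less_mult_iff divide_less_0_iff)
  then show "\<exists>d. (gq has_real_derivative d) (at t) \<and> d < 0"
    using gq_DERIV[OF \<open>0 < t\<close> \<open>t < 1\<close>] by blast
next
  show "continuous_on {x..y} gq"
    by (rule gq_continuous_on) (use assms in auto)
qed

section \<open>The monotone branches of g and the moduli on them\<close>

lemma critical_moduli_pos: "0 < qhat" "0 < qstar"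
  using inv_sqrt2(1) qhat(1) qstar(1) by linarith+

lemma gq_mono_left:
  assumes "1 / sqrt 2 \<le> x" "x < y" "y \<le> qhat"
  shows "gq x < gq y"
proof (rule gq_strict_mono)
  show x: "0 < x" using inv_sqrt2(1) assms by linarith
  show "plen t * fq t > 0" if "x < t" "t < y" for t
    using that assms x qhat(2) by (intro mult_pos_pos plen_pos fq_pos) auto
qed (use assms qhat(2) qstar(2) in auto)

lemma gq_mono_mid:
  assumes "qhat \<le> x" "x < y" "y \<le> qstar"
  shows "gq y < gq x"
proof (rule gq_strict_antimono)
  show "plen t * fq t < 0" if "x < t" "t < y" for t
    using that assms critical_moduli_pos qstar(2) by (intro mult_pos_neg plen_pos fq_neg) auto
qed (use assms critical_moduli_pos qstar(2) in auto)

lemma gq_mono_right: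
  assumes "qstar \<le> x" "x < y" "y < 1"
  shows "gq x < gq y"
proof (rule gq_strict_mono)
  show "plen t * fq t > 0" if "x < t" "t < y" for t
    using that assms qhat(2) by (intro mult_neg_neg plen_neg fq_neg) auto
qed (use assms critical_moduli_pos in auto)

lemma gq_inv_sqrt2: "gq (1 / sqrt 2) = 0"
  unfolding gq_def inv_sqrt2(3) by simp

lemma gq_qstar: "gq qstar = 0"
  using qstar(3) by (simp add: gq_def plen_def)

lemma lamhat_pos: "lamhat > 0"
  using gq_mono_left[of "1 / sqrt 2" qhat] qhat(1) gq_inv_sqrt2 by (simp add: lamhat_def)

text \<open>The intermediate value theorem gives a solution on the branch and strict monotonicity
  its uniqueness, so the definite description denotes it. Of its value only the position relative to
  \<open>qstar\<close> is kept, since that decides the sign of \<alpha>.\<close>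

lemma q1_range:
  assumes "0 < c" "c \<le> lamhat"
  shows "1 / sqrt 2 < q1 c" "q1 c < qstar"
proof -
  obtain z where z: "1 / sqrt 2 \<le> z" "z \<le> qhat" "gq z = c"
    using IVT'[of gq "1 / sqrt 2" c qhat] assms gq_inv_sqrt2 qhat qstar inv_sqrt2(1)
      gq_continuous_on[of "{1 / sqrt 2..qhat}"] by (auto simp: lamhat_def subset_eq)
  have z1: "z \<noteq> 1 / sqrt 2" using z gq_inv_sqrt2 assms by auto
  have "q1 c = z" unfolding q1_def
  proof (rule the_equality)
    show "1 / sqrt 2 < z \<and> z \<le> qhat \<and> gq z = c" using z z1 by auto
    fix q assume "1 / sqrt 2 < q \<and> q \<le> qhat \<and> gq q = c"
    then show "q = z" using gq_mono_left[of q z] gq_mono_left[of z q] z by force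
  qed
  then show "1 / sqrt 2 < q1 c" "q1 c < qstar" using z z1 qhat by auto
qed

lemma q2_range:
  assumes "0 < c" "c \<le> lamhat"
  shows "1 / sqrt 2 < q2 c" "q2 c < qstar"
proof -
  obtain z where z: "qhat \<le> z" "z \<le> qstar" "gq z = c"
    using IVT2'[of gq qstar c qhat] assms gq_qstar qhat qstar inv_sqrt2(1)
      gq_continuous_on[of "{qhat..qstar}"] by (auto simp: lamhat_def subset_eq)
  have z1: "z \<noteq> qstar" using z gq_qstar assms by auto
  have "q2 c = z" unfolding q2_def
  proof (rule the_equality)
    show "qhat \<le> z \<and> z < qstar \<and> gq z = c" using z z1 by auto
    fix q assume "qhat \<le> q \<and> q < qstar \<and> gq q = c"
    then show "q = z" using gq_mono_mid[of q z] gq_mono_mid[of z q] z by force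
  qed
  then show "1 / sqrt 2 < q2 c" "q2 c < qstar" using z z1 qhat by auto
qed

lemma q3_range:
  assumes "0 < c"
  shows "qstar < q3 c" "q3 c < 1"
proof -
  have s0: "0 < qstar" using qstar inv_sqrt2(1) by linarith
  define k where "k = 2 * qstar\<^sup>2 - 1"
  have k: "k > 0" using power_strict_mono[OF qstar(1), of 2] inv_sqrt2 by (simp add: k_def)
  \<comment> \<open>Since 2E is at most pi, this makes K - 2E at least 1 + c/k. The summand 1
    ensures that squaring does not decrease this bound, and k bounds the factor 2 r^2 - 1 of g from
    below.\<close>
  obtain r where r: "qstar < r" "r < 1" "pi + (1 + c / k) \<le> ellK r"
    using ellK_unbounded[OF s0 qstar(2)] by blast
  have "c \<le> gq r"
  proof -
    have "1 + c / k \<le> - plen r" using ellEc_le[of r] r s0 by (simp add: plen_def)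
    moreover have "1 + c / k \<le> (1 + c / k)\<^sup>2" using assms k by (simp add: self_le_power)
    moreover have "(1 + c / k)\<^sup>2 \<le> (- plen r)\<^sup>2" using calculation assms k by (intro power_mono) auto
    ultimately have "c / k \<le> (plen r)\<^sup>2" by simp
    then have "c \<le> (plen r)\<^sup>2 * k" using k by (simp add: divide_le_eq)
    also have "\<dots> \<le> (plen r)\<^sup>2 * (2 * r\<^sup>2 - 1)" 
      using power_mono[of qstar r 2] r s0 by (intro mult_left_mono) (auto simp: k_def)
    finally have "c \<le> (plen r)\<^sup>2 * (2 * r\<^sup>2 - 1)" .
    moreover have "gq r = 8 * ((plen r)\<^sup>2 * (2 * r\<^sup>2 - 1))" by (simp add: gq_def plen_def)
    ultimately show ?thesis using assms by linarith
  qed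
  then obtain z where z: "qstar \<le> z" "z \<le> r" "gq z = c"
    using IVT'[of gq qstar c r] assms gq_qstar r s0
      gq_continuous_on[of "{qstar..r}"] by (auto simp: subset_eq)
  have z1: "z \<noteq> qstar" using z gq_qstar assms by auto
  have "q3 c = z" unfolding q3_def
  proof (rule the_equality)
    show "qstar < z \<and> z < 1 \<and> gq z = c" using z z1 r by auto
    fix q assume "qstar < q \<and> q < 1 \<and> gq q = c"
    then show "q = z" using gq_mono_right[of q z] gq_mono_right[of z q] z r by force
  qed
  then show "qstar < q3 c" "q3 c < 1" using z z1 r by auto
qed

lemma nlam_imp_le_lamhat:
  assumes "lam > 0" "l > 0" "n > 0" "int n \<ge> nlam lam l"
  shows "0 < lam * l\<^sup>2 / (real n)\<^sup>2" "lam * l\<^sup>2 / (real n)\<^sup>2 \<le> lamhat"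
proof -
  show "0 < lam * l\<^sup>2 / (real n)\<^sup>2" using assms by simp
  have "sqrt (lam * l\<^sup>2 / lamhat) \<le> real n"
    using assms(4) unfolding nlam_def by (simp add: ceiling_le_iff)
  then have "lam * l\<^sup>2 / lamhat \<le> (real n)\<^sup>2" by (rule sqrt_le_D)
  then show "lam * l\<^sup>2 / (real n)\<^sup>2 \<le> lamhat" using lamhat_pos assms by (simp add: field_simps)
qed

section \<open>The amplitude function and the elastica\<close>

text \<open>The case distinction at 0 disappears near x once the integral is taken from a point a
  below both x and 0: there \<open>oint f\<close> is the integral from a minus a constant.\<close>

lemma oint_DERIV:
  assumes f: "continuous_on UNIV f"
  shows "(oint f has_real_derivative f x) (at x)"
proof -
  define a b where "a = min x 0 - 1" and "b = max x 0 + 1"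
  have ab: "a < x" "x < b" "a < 0" "0 < b" by (auto simp: a_def b_def)
  have fi: "f integrable_on {u..v}" for u v
    by (rule integrable_continuous_real) (rule continuous_on_subset[OF f], simp)
  have e: "oint f y = integral {a..y} f - integral {a..0} f" if "a < y" for y
    using Henstock_Kurzweil_Integration.integral_combine[of a 0 y f]
      Henstock_Kurzweil_Integration.integral_combine[of a y 0 f] that ab fi
    by (auto simp: oint_def)
  have "((\<lambda>y. integral {a..y} f - integral {a..0} f) has_real_derivative f x - 0) (at x within {a..b})"
    by (rule DERIV_diff[OF integral_has_real_derivative DERIV_const])
       (use ab continuous_on_subset[OF f] in auto)
  then have "((\<lambda>y. integral {a..y} f - integral {a..0} f) has_real_derivative f x) (at x)"
    using ab by (subst (asm) at_within_interior) auto
  then show ?thesis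
    by (rule DERIV_cong_ev[THEN iffD1, OF refl _ refl, rotated])
       (use e ab in \<open>auto simp: eventually_nhds intro!: exI[of _ "{a<..}"]\<close>)
qed

lemma oint_0 [simp]: "oint f 0 = 0"
  by (simp add: oint_def)

locale modulus =
  fixes q :: real
  assumes q_bound: "\<bar>q\<bar> < 1"
begin

abbreviation dn where "dn \<equiv> dn_aux q"
abbreviation F where "F x \<equiv> ellF x q"
abbreviation E where "E x \<equiv> ellE x q"
abbreviation a where "a u \<equiv> am u q"

lemma dn_pos [simp]: "dn x > 0" and dn_neq_0 [simp]: "dn x \<noteq> 0"
  using dn_aux_pos[OF q_bound, of x] by auto

lemma F_DERIV: "((\<lambda>x. F x) has_real_derivative 1 / dn x) (at x)"
proof -
  have "continuous_on UNIV (\<lambda>\<theta>. 1 / dn \<theta>)" by (intro continuous_intros) auto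
  from oint_DERIV[OF this] show ?thesis by (simp add: ellF_def[abs_def] dn_aux_def)
qed

lemma E_DERIV: "((\<lambda>x. E x) has_real_derivative dn x) (at x)"
proof -
  have "continuous_on UNIV (\<lambda>\<theta>. dn \<theta>)" by (intro continuous_intros)
  from oint_DERIV[OF this] show ?thesis by (simp add: ellE_def[abs_def] dn_aux_def[abs_def])
qed

lemma F_0 [simp]: "F 0 = 0" by (simp add: ellF_def)

text \<open>The integrand 1/dn is at least 1. This one estimate yields injectivity, surjectivity and
  the Lipschitz continuity of the inverse.\<close>

lemma F_expands: "x \<le> y \<Longrightarrow> y - x \<le> F y - F x"
proof -
  assume "x \<le> y"
  have "F x - x \<le> F y - y"
  proof (rule DERIV_nonneg_imp_nondecreasing[OF \<open>x \<le> y\<close>])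
    fix t show "\<exists>d. ((\<lambda>x. F x - x) has_real_derivative d) (at t) \<and> 0 \<le> d"
      using dn_aux_le_1[OF q_bound, of t] dn_pos[of t]
      by (intro exI[of _ "1 / dn t - 1"] conjI DERIV_diff F_DERIV DERIV_ident) (simp add: le_divide_eq)
  qed
  then show ?thesis by simp
qed

lemma F_inj: "F x = F y \<Longrightarrow> x = y"
  using F_expands[of x y] F_expands[of y x] linear[of x y] by linarith

lemma F_continuous: "continuous_on A (\<lambda>x. F x)"
  by (auto intro!: continuous_at_imp_continuous_on DERIV_isCont F_DERIV)

lemma F_surj: "\<exists>x. F x = u"
proof (cases "u \<ge> 0")
  case True
  then show ?thesis using IVT'[of F 0 u u] F_expands[of 0 u] F_continuous by auto
next
  case False
  then show ?thesis using IVT'[of F u u 0] F_expands[of u 0] F_continuous by auto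
qed

lemma F_a [simp]: "F (a u) = u"
  unfolding am_def by (rule theI') (use F_surj F_inj in metis)

lemma a_mono: "u < v \<Longrightarrow> a u < a v"
  using F_expands[of "a v" "a u"] by (force simp: not_less[symmetric])

lemma a_lipschitz: "\<bar>a v - a u\<bar> \<le> \<bar>v - u\<bar>"
  using F_expands[of "a v" "a u"] F_expands[of "a u" "a v"] by force

lemma a_continuous: "continuous_on A (\<lambda>u. a u)"
  unfolding continuous_on_iff dist_real_def using a_lipschitz by (meson le_less_trans)

lemma a_DERIV: "((\<lambda>u. a u) has_real_derivative dn (a u)) (at u)"
proof -
  have "((\<lambda>u. a u) has_real_derivative inverse (1 / dn (a u))) (at u)"
    by (rule DERIV_inverse_function[where f = F and a = "u - 1" and b = "u + 1"])
       (use F_DERIV a_continuous[of UNIV] in \<open>auto simp: continuous_on_eq_continuous_at\<close>)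
  then show ?thesis by simp
qed

lemma F_minus: "F (- x) = - F x"
proof -
  have "((\<lambda>x. F x + F (- x)) has_real_derivative 0) (at x)" for x
  proof -
    have "(uminus has_real_derivative - 1) (at x)" by (auto intro!: derivative_eq_intros)
    from DERIV_add[OF F_DERIV[of x] DERIV_chain2[OF F_DERIV this]] show ?thesis
      by (simp add: dn_aux_def)
  qed
  then have "F x + F (- x) = F 0 + F (- 0)" by (rule DERIV_isconst_all[rule_format]) 
  then show ?thesis by simp
qed

lemma F_plus_pi: "F (x + pi) = F x + 2 * ellK q"
proof -
  have "((\<lambda>x. F (x + pi) - F x) has_real_derivative 0) (at x)" for x
  proof -
    have "((\<lambda>x. x + pi) has_real_derivative 1) (at x)" by (auto intro!: derivative_eq_intros)
    from DERIV_diff[OF DERIV_chain2[OF F_DERIV this] F_DERIV[of x]] show ?thesis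
      by (simp add: dn_aux_def)
  qed
  \<comment> \<open>The constant is evaluated at - pi/2, where the oddness of F turns it into
    2K.\<close>
  then have "F (x + pi) - F x = F (- pi / 2 + pi) - F (- pi / 2)" by (rule DERIV_isconst_all[rule_format]) 
  also have "- pi / 2 + pi = pi / 2" by simp
  finally show ?thesis using F_minus[of "pi/2"] by (simp add: ellK_def)
qed

lemma a_minus: "a (- u) = - a u"
  by (rule F_inj) (simp add: F_minus)

lemma a_plus_2K: "a (u + 2 * ellK q) = a u + pi"
  by (rule F_inj) (simp add: F_plus_pi)

lemma a_K: "a (ellK q) = pi / 2"
  by (rule F_inj) (simp add: ellK_def)

lemma K_pos: "ellK q > 0"
  unfolding ellK_def using F_expands[of 0 "pi/2"] pi_gt_zero F_0 by linarith

end

text \<open>The sign \<kappa> treats arcs (\<kappa> = 1) and loops (\<kappa> = -1) together: the two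
  formulas differ by a reflection of the first coordinate, and \<alpha> is positive in both.\<close>

locale elastica_curve = modulus +
  fixes \<alpha> \<kappa> :: real
  assumes q_pos: "0 < q" and alpha_pos: "\<alpha> > 0" and kappa: "\<kappa>\<^sup>2 = 1"
begin

definition ph :: "real \<Rightarrow> real" where "ph s = a (\<alpha> * s - ellK q)"

definition pos :: "real \<Rightarrow> real \<times> real" where
  "pos s = (\<kappa> * ((2 * E (ph s) + 2 * ellEc q - \<alpha> * s) / \<alpha>), 2 * q * cos (ph s) / \<alpha>)"

text \<open>With sin \<psi> = q sin (ph s) and cos \<psi> = dn (ph s) this is (\<kappa> cos 2\<psi>,
  - sin 2\<psi>).\<close>

definition tang :: "real \<Rightarrow> real \<times> real" where
  "tang s = (\<kappa> * (1 - 2 * q\<^sup>2 * (sin (ph s))\<^sup>2), - 2 * q * sin (ph s) * dn (ph s))"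

text \<open>The vector is a unit normal to \<open>tang\<close>, so the scalar is the curvature up to
  sign, the familiar multiple 2 \<alpha> q of cn.\<close>

definition acc :: "real \<Rightarrow> real \<times> real" where
  "acc s = (- 2 * \<alpha> * q * cos (ph s)) *\<^sub>R
     (\<kappa> * (2 * q * sin (ph s) * dn (ph s)), 1 - 2 * q\<^sup>2 * (sin (ph s))\<^sup>2)"

definition hp :: real where "hp = 2 * ellK q / \<alpha>"

lemma ph_DERIV: "(ph has_real_derivative \<alpha> * dn (ph s)) (at s)"
proof -
  have "((\<lambda>s. \<alpha> * s - ellK q) has_real_derivative \<alpha>) (at s)"
    by (auto intro!: derivative_eq_intros)
  from DERIV_chain2[OF a_DERIV this] show ?thesis by (simp add: ph_def[abs_def] mult.commute)
qed

lemma dn_sq: "dn x * dn x = 1 - q\<^sup>2 * (sin x)\<^sup>2"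
  using dn_aux_sq[OF q_bound, of x] by (simp add: power2_eq_square)

lemma pos_deriv: "(pos has_vector_derivative tang s) (at s)"
proof -
  have x: "((\<lambda>s. \<kappa> * ((2 * E (ph s) + 2 * ellEc q - \<alpha> * s) / \<alpha>)) has_real_derivative
      \<kappa> * ((2 * (dn (ph s) * (\<alpha> * dn (ph s))) + 0 - \<alpha>) / \<alpha>)) (at s)"
    by (intro DERIV_cmult DERIV_cdivide DERIV_diff DERIV_add DERIV_chain2[OF E_DERIV ph_DERIV] DERIV_const)
       (auto intro!: derivative_eq_intros)
  have "\<kappa> * ((2 * (dn (ph s) * (\<alpha> * dn (ph s))) + 0 - \<alpha>) / \<alpha>) = \<kappa> * (1 - 2 * q\<^sup>2 * (sin (ph s))\<^sup>2)"
    using alpha_pos dn_sq[of "ph s"] by (simp add: field_simps) algebra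
  moreover have "((\<lambda>s. 2 * q * cos (ph s) / \<alpha>) has_real_derivative
     2 * q * (- sin (ph s) * (\<alpha> * dn (ph s))) / \<alpha>) (at s)"
    by (intro DERIV_cmult DERIV_cdivide DERIV_chain2[OF DERIV_cos ph_DERIV])
  moreover have "2 * q * (- sin (ph s) * (\<alpha> * dn (ph s))) / \<alpha> = - 2 * q * sin (ph s) * dn (ph s)"
    using alpha_pos by simp
  ultimately show ?thesis
    using has_vector_derivative_Pair[OF x[unfolded has_real_derivative_iff_has_vector_derivative],
      of "\<lambda>s. 2 * q * cos (ph s) / \<alpha>"]
    unfolding tang_def pos_def[abs_def] has_real_derivative_iff_has_vector_derivative by simp
qed

lemma tang_deriv: "(tang has_vector_derivative acc s) (at s)"
proof -
  let ?p = "ph s" 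
  have sn: "((\<lambda>s. sin (ph s)) has_real_derivative cos ?p * (\<alpha> * dn ?p)) (at s)"
    by (rule DERIV_chain2[OF DERIV_sin ph_DERIV])
  have dnd: "((\<lambda>s. dn (ph s)) has_real_derivative (- q\<^sup>2 * sin ?p * cos ?p / dn ?p) * (\<alpha> * dn ?p)) (at s)"
    by (rule DERIV_chain2[OF dn_aux_DERIV[OF q_bound] ph_DERIV])
  have x: "((\<lambda>s. \<kappa> * (1 - 2 * q\<^sup>2 * (sin (ph s))\<^sup>2)) has_real_derivative
      (- 2 * \<alpha> * q * cos ?p) * (\<kappa> * (2 * q * sin ?p * dn ?p))) (at s)"
    by (rule DERIV_cong[OF DERIV_cmult[OF DERIV_diff[OF DERIV_const DERIV_cmult[OF DERIV_power[OF sn, of 2]]]]])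
       (simp add: algebra_simps power2_eq_square)
  have "((\<lambda>s. - 2 * q * sin (ph s) * dn (ph s)) has_real_derivative
     (- 2 * q * (cos ?p * (\<alpha> * dn ?p)) * dn ?p + (- 2 * q * sin ?p) * ((- q\<^sup>2 * sin ?p * cos ?p / dn ?p) * (\<alpha> * dn ?p)))) (at s)"
    using DERIV_mult[OF DERIV_cmult[OF sn, of "- 2 * q"] dnd] by (simp add: mult_ac add.commute)
  moreover have "- 2 * q * (cos ?p * (\<alpha> * dn ?p)) * dn ?p + (- 2 * q * sin ?p) * ((- q\<^sup>2 * sin ?p * cos ?p / dn ?p) * (\<alpha> * dn ?p))
     = (- 2 * \<alpha> * q * cos ?p) * (dn ?p * dn ?p - q\<^sup>2 * (sin ?p)\<^sup>2)"
    by (simp add: algebra_simps power2_eq_square)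
  moreover have "dn ?p * dn ?p - q\<^sup>2 * (sin ?p)\<^sup>2 = 1 - 2 * q\<^sup>2 * (sin ?p)\<^sup>2"
    unfolding dn_sq by simp
  ultimately have y: "((\<lambda>s. - 2 * q * sin (ph s) * dn (ph s)) has_real_derivative
     (- 2 * \<alpha> * q * cos ?p) * (1 - 2 * q\<^sup>2 * (sin ?p)\<^sup>2)) (at s)" by simp
  show ?thesis
    using has_vector_derivative_Pair[OF x[unfolded has_real_derivative_iff_has_vector_derivative]
      y[unfolded has_real_derivative_iff_has_vector_derivative]]
    unfolding tang_def[abs_def] acc_def by simp
qed

lemma ph_continuous: "continuous_on A ph"
  by (auto intro!: continuous_at_imp_continuous_on DERIV_isCont ph_DERIV)

lemma acc_continuous: "continuous_on A acc"
  unfolding acc_def[abs_def] by (intro continuous_intros ph_continuous)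

lemma norm_tang: "norm (tang s) = 1"
proof -
  have "(\<kappa> * (1 - 2 * (q\<^sup>2 * (sin (ph s))\<^sup>2)))\<^sup>2 + 4 * (q\<^sup>2 * (sin (ph s))\<^sup>2) * (dn (ph s) * dn (ph s)) = 1"
    unfolding dn_sq power_mult_distrib[of \<kappa>] kappa by (simp add: algebra_simps power2_eq_square)
  then show ?thesis
    by (simp add: tang_def norm_Pair power2_eq_square mult_ac)
qed

lemma hp_pos: "hp > 0"
  using K_pos alpha_pos by (simp add: hp_def)

lemma ph_plus_hp: "ph (s + hp) = ph s + pi"
proof -
  have "\<alpha> * (s + hp) - ellK q = (\<alpha> * s - ellK q) + 2 * ellK q"
    using alpha_pos by (simp add: hp_def algebra_simps)
  then show ?thesis by (simp only: ph_def a_plus_2K)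
qed

lemma tang_periodic: "tang (s + 2 * hp) = tang s"
proof -
  have "ph (s + 2 * hp) = ph s + 2 * pi" using ph_plus_hp[of s] ph_plus_hp[of "s + hp"] by (simp add: add.assoc)
  then show ?thesis by (simp add: tang_def dn_aux_def)
qed

text \<open>Reflection about \<open>hp\<close> sends the amplitude x + pi to - x, which preserves
  sin; dn depends only on the square of sin.\<close>

lemma tang_symmetric: "tang (hp + r) = tang (hp - r)"
proof -
  have "\<alpha> * (hp - r) - ellK q = - (\<alpha> * r - ellK q)" using alpha_pos by (simp add: hp_def algebra_simps)
  then have "ph (hp - r) = - ph r" by (simp only: ph_def a_minus)
  moreover have "ph (hp + r) = ph r + pi" using ph_plus_hp[of r] by (simp add: add.commute)
  ultimately show ?thesis by (simp add: tang_def dn_aux_def)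
qed

text \<open>Inside the first arc the amplitude stays strictly between - pi/2 and pi/2, where cos is
  positive; the arc has inflections only at its ends.\<close>

lemma acc_nonzero: "0 < r \<Longrightarrow> r < hp \<Longrightarrow> acc (hp - r) \<noteq> 0"
proof -
  assume r: "0 < r" "r < hp"
  have "\<alpha> * r < 2 * ellK q" using r(2) alpha_pos by (simp add: hp_def field_simps)
  then have u: "- ellK q < \<alpha> * (hp - r) - ellK q" "\<alpha> * (hp - r) - ellK q < ellK q"
    using r alpha_pos by (simp_all add: hp_def algebra_simps)
  have "- (pi/2) < ph (hp - r)" "ph (hp - r) < pi/2"
    using a_mono[OF u(1)] a_mono[OF u(2)] by (simp_all add: ph_def a_minus a_K)
  then have c: "cos (ph (hp - r)) \<noteq> 0" using cos_gt_zero_pi by fastforce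
  have "\<kappa> \<noteq> 0" using kappa by auto
  then have "(\<kappa> * (2 * q * sin (ph (hp - r)) * dn (ph (hp - r))), 1 - 2 * q\<^sup>2 * (sin (ph (hp - r)))\<^sup>2) \<noteq> (0, 0)"
    using q_pos by auto
  then show "acc (hp - r) \<noteq> 0"
    using c q_pos alpha_pos by (auto simp: acc_def zero_prod_def)
qed

end

section \<open>Indefinite integrals and reparametrization\<close>

text \<open>All integrals over subintervals vanish, so the error terms in Henstock's lemma are
  exactly the terms of a Riemann sum for |f|. Hence |f| has integral 0, and absolute integrability
  turns this into vanishing almost everywhere.\<close>

lemma negligible_of_zero_integrals:
  fixes f :: "real \<Rightarrow> 'a::euclidean_space"
  assumes "f absolutely_integrable_on {a..b}"
    and zero: "\<And>t. t \<in> {a..b} \<Longrightarrow> (f has_integral 0) {a..t}"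
  shows "negligible {t \<in> {a..b}. f t \<noteq> 0}"
proof -
  have fi: "f integrable_on cbox a b"
    using assms(1) absolutely_integrable_on_def by auto
  have z2: "integral {s..t} f = 0" if "s \<in> {a..b}" "t \<in> {a..b}" for s t
  proof (cases "s \<le> t")
    case True
    have "integral {a..s} f + integral {s..t} f = integral {a..t} f"
      by (rule Henstock_Kurzweil_Integration.integral_combine)
         (use that True fi in \<open>auto intro: integrable_on_subinterval\<close>)
    then show ?thesis using zero[OF that(1)] zero[OF that(2)] by (simp add: integral_unique)
  qed auto
  have "((\<lambda>t. norm (f t)) has_integral 0) (cbox a b)"
    unfolding has_integral
  proof (intro allI impI)
    fix e :: real assume "e > 0"
    obtain \<gamma> where \<gamma>: "gauge \<gamma>" "\<And>p. \<lbrakk>p tagged_partial_division_of (cbox a b); \<gamma> fine p\<rbrakk> \<Longrightarrow>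
             sum (\<lambda>(x,k). norm(measure lborel k *\<^sub>R f x - integral k f)) p < e"
      using Henstock_lemma[OF fi \<open>e>0\<close>] by blast
    have "norm ((\<Sum>(x,k)\<in>\<D>. measure lborel k *\<^sub>R norm (f x)) - 0) < e"
      if D: "\<D> tagged_division_of cbox a b" "\<gamma> fine \<D>" for \<D>
    proof -
      have "(\<Sum>(x,k)\<in>\<D>. measure lborel k *\<^sub>R norm (f x)) = sum (\<lambda>(x,k). norm(measure lborel k *\<^sub>R f x - integral k f)) \<D>"
      proof (rule sum.cong, simp, clarify)
        fix x k assume xk: "(x,k) \<in> \<D>"
        obtain u v where uv: "k = cbox u v" using D(1) xk by blast
        have "k \<subseteq> cbox a b" "k \<noteq> {}" using D(1) xk by blast+
        then have "u \<in> {a..b}" "v \<in> {a..b}" using uv by auto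
        then have "integral k f = 0" using z2 uv by auto
        then show "measure lborel k *\<^sub>R norm (f x) = norm (measure lborel k *\<^sub>R f x - integral k f)" by simp
      qed
      moreover have "\<D> tagged_partial_division_of cbox a b" 
        using D(1) tagged_division_of_def by blast
      ultimately have "(\<Sum>(x,k)\<in>\<D>. measure lborel k *\<^sub>R norm (f x)) < e" 
        using \<gamma>(2)[of \<D>] D(2) by auto
      moreover have "(\<Sum>(x,k)\<in>\<D>. measure lborel k *\<^sub>R norm (f x)) \<ge> 0"
        by (intro sum_nonneg) auto
      ultimately show ?thesis by simp
    qed
    then show "\<exists>\<gamma>. gauge \<gamma> \<and> (\<forall>\<D>. \<D> tagged_division_of cbox a b \<and> \<gamma> fine \<D> \<longrightarrow> norm ((\<Sum>(x,k)\<in>\<D>. measure lborel k *\<^sub>R norm (f x)) - 0) < e)"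
      using \<gamma>(1) by blast
  qed
  then have i0: "integral {a..b} (\<lambda>t. norm (f t)) = 0" by (simp add: integral_unique)
  have ai: "(\<lambda>t. norm (f t)) absolutely_integrable_on {a..b}"
    using absolutely_integrable_norm[OF assms(1)] by (simp add: o_def)
  then have L: "integrable (lebesgue_on {a..b}) (\<lambda>t. norm (f t))"
    by (simp add: integrable_restrict_space set_integrable_def)
  have "integral\<^sup>L (lebesgue_on {a..b}) (\<lambda>t. norm (f t)) = 0"
    using i0 lebesgue_integral_eq_integral[OF L] by simp
  then have "AE t in lebesgue_on {a..b}. norm (f t) = 0"
    using integral_nonneg_eq_0_iff_AE[OF L] by simp
  then have "AE t in lebesgue. t \<in> {a..b} \<longrightarrow> f t = 0"
    by (subst (asm) AE_restrict_space_iff) (auto elim!: eventually_mono)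
  then obtain N where N: "negligible N" "{t. \<not> (t \<in> {a..b} \<longrightarrow> f t = 0)} \<subseteq> N"
    unfolding eventually_ae_filter_negligible by blast
  show ?thesis by (rule negligible_subset[OF N(1)]) (use N(2) in auto)
qed

lemma has_integral_subinterval_diff:
  fixes f :: "real \<Rightarrow> 'a::euclidean_space"
  assumes F: "\<And>t. t \<in> {a..b} \<Longrightarrow> (f has_integral (F t - F a)) {a..t}"
    and "a \<le> s" "s \<le> t" "t \<le> b"
  shows "(f has_integral (F t - F s)) {s..t}"
proof -
  have i: "f integrable_on {a..t}" by (rule has_integral_integrable[OF F]) (use assms in auto)
  then have "f integrable_on {s..t}" by (rule integrable_on_subinterval) (use assms in auto)
  moreover have "integral {a..s} f + integral {s..t} f = integral {a..t} f"
    by (rule Henstock_Kurzweil_Integration.integral_combine) (use assms i in auto)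
  moreover have "integral {a..s} f = F s - F a" "integral {a..t} f = F t - F a"
    using F assms by (auto intro!: integral_unique)
  ultimately show ?thesis by (auto simp: has_integral_iff algebra_simps)
qed

lemma indefinite_integral_continuous_on:
  fixes f :: "real \<Rightarrow> 'a::euclidean_space"
  assumes F: "\<And>t. t \<in> {a..b} \<Longrightarrow> (f has_integral (F t - F a)) {a..t}"
  shows "continuous_on {a..b} F"
proof (cases "a \<le> b")
  case True
  have "f integrable_on {a..b}" using F[of b] True by auto
  then have "continuous_on {a..b} (\<lambda>t. integral {a..t} f)" by (rule indefinite_integral_continuous_1)
  then have "continuous_on {a..b} (\<lambda>t. F a + integral {a..t} f)" by (intro continuous_intros)
  then show ?thesis
    by (rule continuous_on_eq) (simp add: integral_unique[OF F])
qed auto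

text \<open>The difference of the two sides of the product rule is a function \<open>Q\<close> whose increments
  over \<open>[s, t]\<close> are bounded by a constant times \<open>(t - s) * (\<integral>\<^bsub>s\<^esub>\<^bsup>t\<^esup> |h|)\<close>; hence \<open>Q\<close>
  has derivative zero at every point.\<close>
lemma product_rule_indefinite_integral:
  fixes prod :: "'a::euclidean_space \<Rightarrow> 'b::euclidean_space \<Rightarrow> 'c::euclidean_space"
    and m m' :: "real \<Rightarrow> 'a" and W h :: "real \<Rightarrow> 'b"
  assumes bil: "bounded_bilinear prod"
    and m: "\<And>t. t \<in> {a..b} \<Longrightarrow> (m' has_integral (m t - m a)) {a..t}"
    and m'_bdd: "\<And>t. t \<in> {a..b} \<Longrightarrow> norm (m' t) \<le> C"
    and W: "\<And>t. t \<in> {a..b} \<Longrightarrow> (h has_integral (W t - W a)) {a..t}"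
    and h: "h absolutely_integrable_on {a..b}"
    and ab: "a \<le> b"
  shows "(\<lambda>t. prod (m' t) (W t)) absolutely_integrable_on {a..b}"
    and "(\<lambda>t. prod (m t) (h t)) absolutely_integrable_on {a..b}"
    and "t \<in> {a..b} \<Longrightarrow> ((\<lambda>t. prod (m' t) (W t) + prod (m t) (h t)) has_integral
           (prod (m t) (W t) - prod (m a) (W a))) {a..t}"
proof -
  interpret bounded_bilinear prod by (rule bil)
  have bl: "bilinear prod" using bilinear_conv_bounded_bilinear bil by blast
  have cW: "continuous_on {a..b} W" using W by (rule indefinite_integral_continuous_on)
  have cm: "continuous_on {a..b} m" using m by (rule indefinite_integral_continuous_on)
  have mm': "m' \<in> borel_measurable (lebesgue_on {a..b})"
    using m[of b] ab by (intro integrable_imp_measurable) auto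
  have Wm: "W absolutely_integrable_on {a..b}"
    by (rule absolutely_integrable_continuous_real[OF cW])
  have mmeas: "m \<in> borel_measurable (lebesgue_on {a..b})"
    by (rule continuous_imp_measurable_on_sets_lebesgue[OF cm]) simp
  have bm': "bounded (m' ` {a..b})" unfolding bounded_iff by (rule exI[of _ C]) (use m'_bdd in auto)
  have bm: "bounded (m ` {a..b})" by (rule compact_imp_bounded[OF compact_continuous_image[OF cm]]) simp
  show A1: "(\<lambda>t. prod (m' t) (W t)) absolutely_integrable_on {a..b}"
    by (rule absolutely_integrable_bounded_measurable_product[OF bl mm' _ bm' Wm]) simp
  show A2: "(\<lambda>t. prod (m t) (h t)) absolutely_integrable_on {a..b}"
    by (rule absolutely_integrable_bounded_measurable_product[OF bl mmeas _ bm h]) simp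
  define f where "f = (\<lambda>t. prod (m' t) (W t) + prod (m t) (h t))"
  have f: "f integrable_on {a..b}" unfolding f_def
    using A1 A2 by (auto intro!: integrable_add simp: absolutely_integrable_on_def)
  define P where "P = (\<lambda>t. integral {a..t} f)"
  define I where "I = (\<lambda>t. integral {a..t} (\<lambda>r. norm (h r)))"
  define Q where "Q = (\<lambda>t. P t - prod (m t) (W t))"
  have hn: "(\<lambda>r. norm (h r)) integrable_on {a..b}" using h absolutely_integrable_on_def by blast
  have PH: "(f has_integral (P t - P a)) {a..t}" if "t \<in> {a..b}" for t
    using integrable_on_subinterval[OF f, of a t] that by (auto simp: P_def has_integral_iff)
  have IH: "((\<lambda>r. norm (h r)) has_integral (I t - I a)) {a..t}" if "t \<in> {a..b}" for t
    using integrable_on_subinterval[OF hn, of a t] that by (auto simp: I_def has_integral_iff)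
  have cI: "continuous_on {a..b} I" using IH by (rule indefinite_integral_continuous_on)
  obtain K where K: "K > 0" "\<And>x y. norm (prod x y) \<le> norm x * norm y * K"
    using pos_bounded by blast
  have C0: "C \<ge> 0" using order_trans[OF norm_ge_zero m'_bdd[of a]] ab by simp
  have mlip: "norm (m t - m s) \<le> C * (t - s)" if "a \<le> s" "s \<le> t" "t \<le> b" for s t
  proof -
    have "(m' has_integral (m t - m s)) {s..t}"
      by (rule has_integral_subinterval_diff[OF m]) (use that in auto)
    then have "norm (m t - m s) \<le> C * measure lborel (cbox s t)"
      by (intro has_integral_bound[OF C0, of m']) (use that m'_bdd in auto)
    then show ?thesis using that by simp
  qed
  have Wd: "norm (W t - W s) \<le> I t - I s" if "a \<le> s" "s \<le> t" "t \<le> b" for s t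
  proof -
    have 1: "(h has_integral (W t - W s)) {s..t}"
      by (rule has_integral_subinterval_diff[OF W]) (use that in auto)
    have 2: "((\<lambda>r. norm (h r)) has_integral (I t - I s)) {s..t}"
      by (rule has_integral_subinterval_diff[OF IH]) (use that in auto)
    have "norm (integral {s..t} h) \<le> integral {s..t} (\<lambda>r. norm (h r))"
      using 1 2 by (intro integral_norm_bound_integral) auto
    then show ?thesis using 1 2 by (simp add: integral_unique)
  qed
  have Imono: "I s \<le> I t" if "a \<le> s" "s \<le> t" "t \<le> b" for s t
    using Wd[OF that] norm_ge_zero[of "W t - W s"] by linarith
  have Qlip: "norm (Q t - Q s) \<le> 2 * K * C * (t - s) * (I t - I s)" if st: "a \<le> s" "s \<le> t" "t \<le> b" for s t
  proof -
    have 1: "(h has_integral (W t - W s)) {s..t}"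
      by (rule has_integral_subinterval_diff[OF W]) (use that in auto)
    have 2: "((\<lambda>r. norm (h r)) has_integral (I t - I s)) {s..t}"
      by (rule has_integral_subinterval_diff[OF IH]) (use that in auto)
    have 3: "(f has_integral (P t - P s)) {s..t}"
      by (rule has_integral_subinterval_diff[OF PH]) (use that in auto)
    have 4: "(m' has_integral (m t - m s)) {s..t}"
      by (rule has_integral_subinterval_diff[OF m]) (use that in auto)
    have 5: "((\<lambda>r. prod (m' r) (W t)) has_integral (prod (m t - m s) (W t))) {s..t}"
      using has_integral_linear[OF 4 bounded_linear_left[of "W t"]] by (simp add: o_def)
    have 6: "((\<lambda>r. prod (m s) (h r)) has_integral (prod (m s) (W t - W s))) {s..t}"
      using has_integral_linear[OF 1 bounded_linear_right[of "m s"]] by (simp add: o_def)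
    \<comment> \<open>W is frozen at the right end and m at the left end. With this choice the two
      frozen increments add up to the increment of \<open>prod m W\<close> exactly, without a mixed
      term.\<close>
    have 7: "((\<lambda>r. f r - prod (m' r) (W t) - prod (m s) (h r)) has_integral
       (P t - P s - prod (m t - m s) (W t) - prod (m s) (W t - W s))) {s..t}"
      by (intro has_integral_diff 3 5 6)
    have 8: "P t - P s - prod (m t - m s) (W t) - prod (m s) (W t - W s) = Q t - Q s"
      by (simp add: Q_def diff_left diff_right)
    define g where "g = (\<lambda>r. K * C * (I t - I s) + K * C * (t - s) * norm (h r))"
    have 9: "(g has_integral (K * C * (I t - I s) * (t - s) + K * C * (t - s) * (I t - I s))) {s..t}"
      unfolding g_def
      by (intro has_integral_add has_integral_mult_right 2)
         (use has_integral_const_real[of "K * C * (I t - I s)" s t] st in \<open>simp add: algebra_simps\<close>)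
    have "norm (f r - prod (m' r) (W t) - prod (m s) (h r)) \<le> g r" if r: "r \<in> {s..t}" for r
    proof -
      have e: "f r - prod (m' r) (W t) - prod (m s) (h r) = prod (m' r) (W r - W t) + prod (m r - m s) (h r)"
        by (simp add: f_def diff_left diff_right)
      have "norm (W r - W t) \<le> I t - I s"
        using Wd[of r t] Imono[of s r] r st by (simp add: norm_minus_commute)
      then have a1: "norm (prod (m' r) (W r - W t)) \<le> C * (I t - I s) * K"
        using order_trans[OF K(2) mult_right_mono[OF mult_mono[of "norm (m' r)" C "norm (W r - W t)" "I t - I s"]]]
          m'_bdd[of r] r st K(1) C0 by auto
      have "norm (m r - m s) \<le> C * (t - s)"
        using mlip[of s r] r st C0 mult_left_mono[of "r - s" "t - s" C] by auto
      then have a2: "norm (prod (m r - m s) (h r)) \<le> C * (t - s) * norm (h r) * K"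
        using order_trans[OF K(2) mult_right_mono[OF mult_right_mono[of "norm (m r - m s)" "C * (t - s)" "norm (h r)"]]] K(1) by auto
      show ?thesis unfolding e g_def
        using a1 a2 norm_triangle_ineq[of "prod (m' r) (W r - W t)" "prod (m r - m s) (h r)"]
        by (simp add: algebra_simps)
    qed
    then have "norm (integral {s..t} (\<lambda>r. f r - prod (m' r) (W t) - prod (m s) (h r))) \<le> integral {s..t} g"
      using 7 9 by (intro integral_norm_bound_integral) auto
    then have "norm (Q t - Q s) \<le> K * C * (I t - I s) * (t - s) + K * C * (t - s) * (I t - I s)"
      by (simp only: integral_unique[OF 7] integral_unique[OF 9] 8)
    then show ?thesis by (simp add: algebra_simps)
  qed
  have Qlip': "norm (Q y - Q x) \<le> 2 * K * C * \<bar>I y - I x\<bar> * norm (y - x)" if "x \<in> {a..b}" "y \<in> {a..b}" for x y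
  proof (cases "x \<le> y")
    case True
    then show ?thesis using Qlip[of x y] Imono[of x y] that by (simp add: algebra_simps)
  next
    case False
    then have "norm (Q x - Q y) \<le> 2 * K * C * (x - y) * (I x - I y)" using Qlip[of y x] that by auto
    moreover have "\<bar>I y - I x\<bar> = I x - I y" "norm (y - x) = x - y" using False Imono[of y x] that by auto
    ultimately show ?thesis by (simp add: norm_minus_commute algebra_simps)
  qed
  have Q': "(Q has_vector_derivative 0) (at x within {a..b})" if x: "x \<in> {a..b}" for x
    unfolding has_vector_derivative_def has_derivative_within_alt
  proof (intro conjI allI impI)
    show "bounded_linear (\<lambda>x. x *\<^sub>R (0::'c))" by (simp add: bounded_linear_zero)
    fix e :: real assume e: "e > 0"
    define e' where "e' = e / (2 * K * C + 1)"
    have p: "2 * K * C + 1 > 0" using K(1) C0 by (simp add: add_nonneg_pos)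
    then have e': "e' > 0" using e by (simp add: e'_def)
    obtain d where d: "d > 0" "\<And>y. y \<in> {a..b} \<Longrightarrow> dist y x < d \<Longrightarrow> dist (I y) (I x) < e'"
      using cI x e' unfolding continuous_on_iff by metis
    have "norm (Q y - Q x - (y - x) *\<^sub>R 0) \<le> e * norm (y - x)" if y: "y \<in> {a..b}" "norm (y - x) < d" for y
    proof -
      have "\<bar>I y - I x\<bar> \<le> e'" using d(2)[of y] y by (simp add: dist_norm)
      then have "2 * K * C * \<bar>I y - I x\<bar> \<le> 2 * K * C * e'"
        using K(1) C0 by (intro mult_left_mono) auto
      also have "\<dots> \<le> (2 * K * C + 1) * e'" using e' by (simp add: algebra_simps)
      also have "\<dots> = e" using p by (simp add: e'_def)
      finally have "2 * K * C * \<bar>I y - I x\<bar> * norm (y - x) \<le> e * norm (y - x)" by (intro mult_right_mono) auto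
      then show ?thesis using Qlip'[OF x y(1)] by simp
    qed
    then show "\<exists>d>0. \<forall>y\<in>{a..b}. norm (y - x) < d \<longrightarrow> norm (Q y - Q x - (y - x) *\<^sub>R 0) \<le> e * norm (y - x)"
      using d(1) by blast
  qed
  obtain c where c: "\<And>x. x \<in> {a..b} \<Longrightarrow> Q x = c"
    by (rule has_vector_derivative_zero_constant[of "{a..b}" Q]) (use Q' in auto)
  show "((\<lambda>t. prod (m' t) (W t) + prod (m t) (h t)) has_integral
           (prod (m t) (W t) - prod (m a) (W a))) {a..t}" if "t \<in> {a..b}"
  proof -
    have "P t - P a = prod (m t) (W t) - prod (m a) (W a)"
      using c[OF that] c[of a] ab by (simp add: Q_def algebra_simps)
    then show ?thesis using PH[OF that] by (simp add: f_def)
  qed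
qed

lemma integrable_bounded_piecewise_continuous:
  fixes f :: "real \<Rightarrow> 'a::euclidean_space"
  assumes "finite N" "\<And>s. s \<in> {a<..<b} - N \<Longrightarrow> isCont f s" and bdd: "\<And>s. s \<in> {a..b} \<Longrightarrow> norm (f s) \<le> B"
  shows "f integrable_on {a..b}"
proof -
  let ?U = "{a<..<b} - N"
  have "continuous_on ?U f" using assms(2) by (simp add: continuous_at_imp_continuous_on)
  moreover have "?U \<in> sets lebesgue"
    using assms(1) by (intro sets.Diff) (auto intro: negligible_imp_sets negligible_finite)
  ultimately have m: "f \<in> borel_measurable (lebesgue_on ?U)"
    by (rule continuous_imp_measurable_on_sets_lebesgue)
  have "f integrable_on ?U"
  proof (rule measurable_bounded_by_integrable_imp_integrable[OF m])
    have "(\<lambda>_. B) integrable_on {a..b}" by (rule integrable_const_ivl)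
    then show "(\<lambda>_. B) integrable_on ?U"
      by (rule integrable_spike_set)
         (use assms(1) in \<open>auto intro: negligible_subset[of "N \<union> {a, b}"]\<close>)
  qed (use bdd \<open>?U \<in> sets lebesgue\<close> in auto)
  then show ?thesis
    by (rule integrable_spike_set) (use assms(1) in \<open>auto intro: negligible_subset[of "N \<union> {a, b}"]\<close>)
qed

section \<open>Weak second derivatives and composition with the arclength function\<close>

lemma D1_eqI: "(f has_vector_derivative d) (at t within {0..1}) \<Longrightarrow> t \<in> {0..1} \<Longrightarrow> D1 f t = d"
  unfolding D1_def by (rule vector_derivative_within_closed_interval) auto

lemma is_D2_D2: "is_D2 f h \<Longrightarrow> is_D2 f (D2 f)"
  unfolding D2_def by (rule someI[where P = "is_D2 f"])

text \<open>\<open>D2\<close> is a \<open>SOME\<close> choice, so a computed second derivative is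
  known to agree with it only off a null set. That suffices, because the energy and the norm are
  integrals.\<close>

lemma is_D2_ae_unique:
  assumes "is_D2 f h" "is_D2 f k"
  shows "negligible {t \<in> {0..1}. h t \<noteq> k t}"
proof -
  have "negligible {t \<in> {0..1}. h t - k t \<noteq> 0}"
  proof (rule negligible_of_zero_integrals)
    show "(\<lambda>t. h t - k t) absolutely_integrable_on {0..1}"
      using assms unfolding is_D2_def by (intro set_integral_diff) auto
    show "((\<lambda>t. h t - k t) has_integral 0) {0..t}" if "t \<in> {0..1}" for t
    proof -
      have "(h has_integral (D1 f t - D1 f 0)) {0..t}" "(k has_integral (D1 f t - D1 f 0)) {0..t}"
        using assms that unfolding is_D2_def by blast+
      from has_integral_diff[OF this] show ?thesis by simp
    qed
  qed
  then show ?thesis by simp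
qed

text \<open>A class that holds the wave and its competitors alike. At the exceptional points
  \<open>K2\<close> may take any value; it only has to be bounded.\<close>

definition piecewise_C2_on ::
  "real \<Rightarrow> real set \<Rightarrow> (real \<Rightarrow> real \<times> real) \<Rightarrow> (real \<Rightarrow> real \<times> real) \<Rightarrow> (real \<Rightarrow> real \<times> real) \<Rightarrow> bool" where
  "piecewise_C2_on L N K K1 K2 \<longleftrightarrow> finite N \<and>
     (\<forall>s\<in>{0..L}. (K has_vector_derivative K1 s) (at s within {0..L})) \<and> continuous_on {0..L} K1 \<and>
     (\<forall>s\<in>{0<..<L}-N. (K1 has_vector_derivative K2 s) (at s) \<and> isCont K2 s) \<and> bounded (K2 ` {0..L})"

text \<open>The density for a parameter of arbitrary speed, since competitors lose the unit speed:
  k^2 is \<open>cross2\<^sup>2 / norm p ^ 6\<close>, and ds contributes one factor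
  \<open>norm p\<close>.\<close>

definition energy_density :: "real \<Rightarrow> real \<times> real \<Rightarrow> real \<times> real \<Rightarrow> real" where
  "energy_density lam p h = (cross2 p h)\<^sup>2 / norm p ^ 5 + lam * norm p"

text \<open>Here \<sigma> stands for the arclength function of the given curve, v for its speed, and
  g for the weak derivative of the speed, which is only square integrable.\<close>

locale reparametrization =
  fixes \<sigma> v g :: "real \<Rightarrow> real" and L :: real
  assumes \<sigma>_deriv: "t \<in> {0..1} \<Longrightarrow> (\<sigma> has_vector_derivative v t) (at t within {0..1})"
    and v_pos: "t \<in> {0..1} \<Longrightarrow> v t > 0"
    and v_integral: "t \<in> {0..1} \<Longrightarrow> (g has_integral v t - v 0) {0..t}"
    and g_abs: "g absolutely_integrable_on {0..1}"
    and g_sq: "(\<lambda>t. (g t)\<^sup>2) integrable_on {0..1}"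
    and \<sigma>_0: "\<sigma> 0 = 0" and \<sigma>_1: "\<sigma> 1 = L"
begin

lemma \<sigma>_cont: "continuous_on {0..1} \<sigma>"
  by (rule continuous_on_vector_derivative) (rule \<sigma>_deriv)

lemma v_cont: "continuous_on {0..1} v"
  using v_integral by (rule indefinite_integral_continuous_on)

lemma \<sigma>_deriv_at: "t \<in> {0<..<1} \<Longrightarrow> (\<sigma> has_vector_derivative v t) (at t)"
  using \<sigma>_deriv[of t] by (simp add: at_within_Icc_at)

lemma \<sigma>_mono: "0 \<le> s \<Longrightarrow> s < t \<Longrightarrow> t \<le> 1 \<Longrightarrow> \<sigma> s < \<sigma> t"
proof (rule DERIV_pos_imp_increasing_open[of s t \<sigma>])
  assume st: "0 \<le> s" "s < t" "t \<le> 1"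
  show "continuous_on {s..t} \<sigma>" by (rule continuous_on_subset[OF \<sigma>_cont]) (use st in auto)
  show "\<exists>y. (\<sigma> has_real_derivative y) (at x) \<and> 0 < y" if "s < x" "x < t" for x
    using \<sigma>_deriv_at[of x] v_pos[of x] that st by (auto simp: has_real_derivative_iff_has_vector_derivative)
qed

lemma \<sigma>_inj: "inj_on \<sigma> {0..1}"
  by (rule linorder_inj_onI) (use \<sigma>_mono in force)+

lemma \<sigma>_range: "t \<in> {0..1} \<Longrightarrow> \<sigma> t \<in> {0..L}"
  using \<sigma>_mono[of 0 t] \<sigma>_mono[of t 1] by (cases "t = 0"; cases "t = 1") (auto simp: \<sigma>_0 \<sigma>_1)

lemma \<sigma>_range_open: "t \<in> {0<..<1} \<Longrightarrow> \<sigma> t \<in> {0<..<L}"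
  using \<sigma>_mono[of 0 t] \<sigma>_mono[of t 1] by (auto simp: \<sigma>_0 \<sigma>_1)

lemma finite_preimage: "finite N \<Longrightarrow> finite {t \<in> {0<..<1}. \<sigma> t \<in> N}"
proof -
  assume "finite N"
  then have "finite (\<sigma> -` N \<inter> {0..1})" by (rule finite_vimage_IntI) (rule \<sigma>_inj)
  then show ?thesis by (rule finite_subset[rotated]) auto
qed

lemma deriv_compose:
  assumes K: "\<And>s. s \<in> {0..L} \<Longrightarrow> (K has_vector_derivative K1 s) (at s within {0..L})"
    and f: "\<And>t. t \<in> {0..1} \<Longrightarrow> f t = K (\<sigma> t)" and t: "t \<in> {0..1}"
  shows "(f has_vector_derivative v t *\<^sub>R K1 (\<sigma> t)) (at t within {0..1})"
proof -
  have "(K has_vector_derivative K1 (\<sigma> t)) (at (\<sigma> t) within \<sigma> ` {0..1})"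
    by (rule has_vector_derivative_within_subset[OF K]) (use \<sigma>_range t in auto)
  from vector_diff_chain_within[OF \<sigma>_deriv[OF t] this]
  show ?thesis by (rule has_vector_derivative_transform[rotated -1]) (use f t in auto)
qed

text \<open>The indefinite integral of e, composed with \<sigma>, is continuous and is an
  antiderivative except where \<sigma> meets N; injectivity of \<sigma> keeps this exceptional set
  finite.\<close>

lemma substitution:
  assumes "finite N" "\<And>s. s \<in> {0<..<L} - N \<Longrightarrow> isCont e s" and bdd: "\<And>s. s \<in> {0..L} \<Longrightarrow> norm (e s) \<le> B"
  shows "((\<lambda>t. v t * e (\<sigma> t)) has_integral integral {0..L} e) {0..1}"
proof -
  have ei: "e integrable_on {0..L}" by (rule integrable_bounded_piecewise_continuous[OF assms])
  define C where "C = (\<lambda>s. integral {0..s} e)"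
  have Cc: "continuous_on {0..L} C" unfolding C_def by (rule indefinite_integral_continuous_1[OF ei])
  have "((\<lambda>t. v t * e (\<sigma> t)) has_integral (C (\<sigma> 1) - C (\<sigma> 0))) {0..1}"
  proof (rule fundamental_theorem_of_calculus_interior_strong[OF finite_preimage[OF assms(1)]])
    show "continuous_on {0..1} (\<lambda>t. C (\<sigma> t))"
      by (rule continuous_on_compose2[OF Cc \<sigma>_cont]) (use \<sigma>_range in auto)
    fix t assume t: "t \<in> {0<..<1} - {t \<in> {0<..<1}. \<sigma> t \<in> N}"
    then have s: "\<sigma> t \<in> {0<..<L} - N" using \<sigma>_range_open by auto
    have "(C has_vector_derivative e (\<sigma> t)) (at (\<sigma> t) within {0..L} - {})"
      unfolding C_def
      by (rule integral_has_vector_derivative_continuous_at[OF ei])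
         (use s in \<open>auto intro: continuous_at_imp_continuous_within[OF assms(2)[OF s]]\<close>)
    then have "(C has_vector_derivative e (\<sigma> t)) (at (\<sigma> t))"
      using s by (simp add: at_within_Icc_at)
    from vector_diff_chain_at[OF \<sigma>_deriv_at this] t
    show "((\<lambda>t. C (\<sigma> t)) has_vector_derivative v t * e (\<sigma> t)) (at t)" by (simp add: o_def)
  qed auto
  then show ?thesis by (simp add: C_def \<sigma>_0 \<sigma>_1)
qed

text \<open>The chain rule for the second derivative of K o \<sigma>, with g in the role of the
  second derivative of \<sigma>.\<close>

definition second :: "(real \<Rightarrow> real \<times> real) \<Rightarrow> (real \<Rightarrow> real \<times> real) \<Rightarrow> real \<Rightarrow> real \<times> real" where
  "second K1 K2 t = (v t)\<^sup>2 *\<^sub>R K2 (\<sigma> t) + g t *\<^sub>R K1 (\<sigma> t)"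

lemma v_le: obtains V where "V \<ge> 0" "\<And>t. t \<in> {0..1} \<Longrightarrow> \<bar>v t\<bar> \<le> V"
proof -
  have "bounded (v ` {0..1})" by (rule compact_imp_bounded[OF compact_continuous_image[OF v_cont]]) simp
  then obtain V where "\<forall>t\<in>{0..1}. \<bar>v t\<bar> \<le> V" unfolding bounded_iff by auto
  then show ?thesis using that[of V] abs_ge_zero[of "v 0"] by (metis atLeastAtMost_iff order_refl order_trans zero_le_one)
qed

lemma norm_second_sq:
  assumes "norm (K2 (\<sigma> t)) \<le> w" "norm (K1 (\<sigma> t)) \<le> w"
  shows "(norm (second K1 K2 t))\<^sup>2 \<le> w\<^sup>2 * (2 * (v t)^4 + 2 * (g t)\<^sup>2)"
proof -
  have "norm (second K1 K2 t) \<le> (v t)\<^sup>2 * norm (K2 (\<sigma> t)) + \<bar>g t\<bar> * norm (K1 (\<sigma> t))"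
    unfolding second_def by (rule norm_triangle_le) simp
  also have "\<dots> \<le> (v t)\<^sup>2 * w + \<bar>g t\<bar> * w" using assms by (intro add_mono mult_left_mono) auto
  finally have "(norm (second K1 K2 t))\<^sup>2 \<le> ((v t)\<^sup>2 * w + \<bar>g t\<bar> * w)\<^sup>2" by (rule power_mono) simp
  also have "\<dots> \<le> 2 * ((v t)\<^sup>2 * w)\<^sup>2 + 2 * (\<bar>g t\<bar> * w)\<^sup>2"
    using zero_le_power2[of "(v t)\<^sup>2 * w - \<bar>g t\<bar> * w"] by (simp add: power2_sum power2_diff)
  also have "\<dots> = w\<^sup>2 * (2 * (v t)^4 + 2 * (g t)\<^sup>2)"
    by (simp add: power_mult_distrib algebra_simps power2_eq_square power4_eq_xxxx)
  finally show ?thesis .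
qed

lemma weight_integrable: "(\<lambda>t. 1 + (v t)\<^sup>2 + (2 * (v t)^4 + 2 * (g t)\<^sup>2)) integrable_on {0..1}"
    "(\<lambda>t. 2 * (v t)^4 + 2 * (g t)\<^sup>2) integrable_on {0..1}"
proof -
  have 1: "(\<lambda>t. 1 + (v t)\<^sup>2) integrable_on {0..1}" "(\<lambda>t. 2 * (v t)^4) integrable_on {0..1}"
    by (rule integrable_continuous_real, intro continuous_intros v_cont)+
  show 2: "(\<lambda>t. 2 * (v t)^4 + 2 * (g t)\<^sup>2) integrable_on {0..1}"
    by (rule integrable_add[OF 1(2) integrable_on_mult_right[OF g_sq]])
  show "(\<lambda>t. 1 + (v t)\<^sup>2 + (2 * (v t)^4 + 2 * (g t)\<^sup>2)) integrable_on {0..1}"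
    by (rule integrable_add[OF 1(1) 2])
qed

lemma compose_D1:
  assumes "piecewise_C2_on L N K K1 K2" "\<And>t. t \<in> {0..1} \<Longrightarrow> f t = K (\<sigma> t)" "t \<in> {0..1}"
  shows "D1 f t = v t *\<^sub>R K1 (\<sigma> t)"
  using assms by (intro D1_eqI deriv_compose) (auto simp: piecewise_C2_on_def)

text \<open>The first derivative is v times \<open>K1 o \<sigma>\<close>. The product rule applies
  with \<open>K1 o \<sigma>\<close> as the factor of bounded derivative and v as the factor whose
  derivative is merely integrable.\<close>

lemma compose_D2:
  assumes K: "piecewise_C2_on L N K K1 K2" and f: "\<And>t. t \<in> {0..1} \<Longrightarrow> f t = K (\<sigma> t)"
  shows "is_D2 f (second K1 K2)"
proof -
  have D1: "D1 f t = v t *\<^sub>R K1 (\<sigma> t)" if "t \<in> {0..1}" for t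
    using K f that by (rule compose_D1)
  have N: "finite N" and K1c: "continuous_on {0..L} K1" and K2b: "bounded (K2 ` {0..L})"
    and K2: "\<And>s. s \<in> {0<..<L} - N \<Longrightarrow> (K1 has_vector_derivative K2 s) (at s)"
    using K by (auto simp: piecewise_C2_on_def)
  obtain V where V: "V \<ge> 0" "\<And>t. t \<in> {0..1} \<Longrightarrow> \<bar>v t\<bar> \<le> V" using v_le by blast
  have "bounded (K1 ` {0..L})" by (rule compact_imp_bounded[OF compact_continuous_image[OF K1c]]) simp
  then have "bounded (K1 ` {0..L} \<union> K2 ` {0..L})" using K2b by simp
  then obtain B where B: "\<And>s. s \<in> {0..L} \<Longrightarrow> norm (K1 s) \<le> B" "\<And>s. s \<in> {0..L} \<Longrightarrow> norm (K2 s) \<le> B"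
    unfolding bounded_iff by blast
  have m: "((\<lambda>t. v t *\<^sub>R K2 (\<sigma> t)) has_integral (K1 (\<sigma> t) - K1 (\<sigma> 0))) {0..t}" if t: "t \<in> {0..1}" for t
  proof (rule fundamental_theorem_of_calculus_interior_strong[OF finite_preimage[OF N]])
    show "continuous_on {0..t} (\<lambda>t. K1 (\<sigma> t))"
      by (rule continuous_on_compose2[OF K1c continuous_on_subset[OF \<sigma>_cont]]) (use \<sigma>_range t in auto)
    fix x assume x: "x \<in> {0<..<t} - {t \<in> {0<..<1}. \<sigma> t \<in> N}"
    then have "x \<in> {0<..<1}" "\<sigma> x \<in> {0<..<L} - N" using \<sigma>_range_open[of x] t by auto
    from vector_diff_chain_at[OF \<sigma>_deriv_at[OF this(1)] K2[OF this(2)]]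
    show "((\<lambda>t. K1 (\<sigma> t)) has_vector_derivative v x *\<^sub>R K2 (\<sigma> x)) (at x)" by (simp add: o_def)
  qed (use t in auto)
  have mb: "norm (v t *\<^sub>R K2 (\<sigma> t)) \<le> V * B" if "t \<in> {0..1}" for t
    using V(2)[OF that] B(2)[OF \<sigma>_range[OF that]] V(1) by (auto intro!: mult_mono)
  note P = product_rule_indefinite_integral[OF bounded_bilinear.flip[OF bounded_bilinear_scaleR] m mb v_integral g_abs zero_le_one]
  have P1: "(\<lambda>t. v t *\<^sub>R v t *\<^sub>R K2 (\<sigma> t)) absolutely_integrable_on {0..1}"
    by (rule P(1))
  have P2: "(\<lambda>t. g t *\<^sub>R K1 (\<sigma> t)) absolutely_integrable_on {0..1}"
    by (rule P(2))
  have P3: "((\<lambda>t. v t *\<^sub>R v t *\<^sub>R K2 (\<sigma> t) + g t *\<^sub>R K1 (\<sigma> t)) has_integral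
      (v t *\<^sub>R K1 (\<sigma> t) - v 0 *\<^sub>R K1 (\<sigma> 0))) {0..t}" if "t \<in> {0..1}" for t
    using that by (rule P(3)[rotated -1])
  have eq: "v t *\<^sub>R v t *\<^sub>R K2 (\<sigma> t) + g t *\<^sub>R K1 (\<sigma> t) = second K1 K2 t" for t
    by (simp add: second_def power2_eq_square)
  have I: "(second K1 K2 has_integral (D1 f t - D1 f 0)) {0..t}" if t: "t \<in> {0..1}" for t
    using P3[OF t] D1[OF t] D1[of 0] unfolding eq by simp
  have A: "second K1 K2 absolutely_integrable_on {0..1}"
    using set_integral_add(1)[OF P1 P2] unfolding eq by simp
  have "(\<lambda>t. (norm (second K1 K2 t))\<^sup>2) integrable_on {0..1}"
  proof (rule measurable_bounded_by_integrable_imp_integrable_real)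
    show "(\<lambda>t. (norm (second K1 K2 t))\<^sup>2) \<in> borel_measurable (lebesgue_on {0..1})"
      using absolutely_integrable_imp_borel_measurable[OF A] by simp
    show "(\<lambda>t. B\<^sup>2 * (2 * (v t)^4 + 2 * (g t)\<^sup>2)) integrable_on {0..1}"
      using integrable_on_mult_right[OF weight_integrable(2), of "B\<^sup>2"] by simp
    show "\<bar>(norm (second K1 K2 t))\<^sup>2\<bar> \<le> B\<^sup>2 * (2 * (v t)^4 + 2 * (g t)\<^sup>2)" if "t \<in> {0..1}" for t
      using norm_second_sq[of K2 t B K1] B \<sigma>_range[OF that] by simp
  qed simp
  then show ?thesis using A I by (simp add: is_D2_def)
qed

lemma compose_W22:
  assumes "piecewise_C2_on L N K K1 K2" "\<And>t. t \<in> {0..1} \<Longrightarrow> f t = K (\<sigma> t)"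
  shows "W22 f"
  unfolding W22_def
proof (intro conjI ballI)
  fix t :: real assume t: "t \<in> {0..1}"
  have "(f has_vector_derivative v t *\<^sub>R K1 (\<sigma> t)) (at t within {0..1})"
    using assms t by (intro deriv_compose) (auto simp: piecewise_C2_on_def)
  then show "f differentiable (at t within {0..1})" by (rule differentiableI_vector)
qed (use compose_D2[OF assms] in blast)

text \<open>In the cross product the g-term of \<open>second\<close> drops out, being parallel to
  the first derivative. What remains scales as v^6 / v^5 = v, exactly the factor in
  \<open>substitution\<close>; the length scales by v as well.\<close>

lemma compose_energy:
  assumes K: "piecewise_C2_on L N K K1 K2" and f: "\<And>t. t \<in> {0..1} \<Longrightarrow> f t = K (\<sigma> t)"
    and nz: "\<And>s. s \<in> {0..L} \<Longrightarrow> K1 s \<noteq> 0"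
  shows "energy lam f = integral {0..L} (\<lambda>s. energy_density lam (K1 s) (K2 s))"
    and "(\<lambda>s. energy_density lam (K1 s) (K2 s)) integrable_on {0..L}"
proof -
  have D1: "D1 f t = v t *\<^sub>R K1 (\<sigma> t)" if "t \<in> {0..1}" for t
    using K f that by (rule compose_D1)
  have N: "finite N" and K1c: "continuous_on {0..L} K1" and K2b: "bounded (K2 ` {0..L})"
    and K2: "\<And>s. s \<in> {0<..<L} - N \<Longrightarrow> (K1 has_vector_derivative K2 s) (at s) \<and> isCont K2 s"
    using K by (auto simp: piecewise_C2_on_def)
  have K1i: "isCont K1 s" if "s \<in> {0<..<L} - N" for s
    using K2[OF that] by (auto intro: has_vector_derivative_continuous)
  have c1: "bounded (K1 ` {0..L})" by (rule compact_imp_bounded[OF compact_continuous_image[OF K1c]]) simp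
  have c2: "bounded ((\<lambda>s. inverse (norm (K1 s))) ` {0..L})"
    by (rule compact_imp_bounded[OF compact_continuous_image]) (use nz in \<open>auto intro!: continuous_intros K1c\<close>)
  obtain B1 where B1: "\<And>s. s \<in> {0..L} \<Longrightarrow> norm (K1 s) \<le> B1" using c1 unfolding bounded_iff by blast
  obtain B2 where B2: "\<And>s. s \<in> {0..L} \<Longrightarrow> norm (K2 s) \<le> B2" using K2b unfolding bounded_iff by blast
  obtain B3 where "\<And>s. s \<in> {0..L} \<Longrightarrow> norm (inverse (norm (K1 s))) \<le> B3" using c2 unfolding bounded_iff by blast
  then have B3: "\<And>s. s \<in> {0..L} \<Longrightarrow> inverse (norm (K1 s)) \<le> B3" by simp
  let ?c = "\<lambda>s. (cross2 (K1 s) (K2 s))\<^sup>2 / norm (K1 s) ^ 5"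
  let ?l = "\<lambda>s. norm (K1 s)"
  have cr: "\<bar>cross2 p h\<bar> \<le> 2 * (norm p * norm h)" for p h :: "real \<times> real"
  proof -
    have "\<bar>fst p * snd h\<bar> \<le> norm p * norm h" "\<bar>snd p * fst h\<bar> \<le> norm p * norm h"
      unfolding abs_mult by (intro mult_mono; metis norm_fst_le norm_snd_le real_norm_def surjective_pairing norm_ge_zero)+
    then show ?thesis unfolding cross2_def by linarith
  qed
  have cb: "norm (?c s) \<le> (2 * (B1 * B2))\<^sup>2 * B3 ^ 5" if s: "s \<in> {0..L}" for s
  proof -
    have "norm (K1 s) * norm (K2 s) \<le> B1 * B2"
      using B1[OF s] B2[OF s] by (intro mult_mono) (auto intro: order_trans[OF norm_ge_zero])
    then have "\<bar>cross2 (K1 s) (K2 s)\<bar> \<le> 2 * (B1 * B2)" using cr[of "K1 s" "K2 s"] by linarith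
    then have "(cross2 (K1 s) (K2 s))\<^sup>2 \<le> (2 * (B1 * B2))\<^sup>2" by (metis abs_ge_zero power2_abs power_mono)
    moreover have "inverse (norm (K1 s)) ^ 5 \<le> B3 ^ 5" using B3[OF s] by (intro power_mono) auto
    ultimately have "(cross2 (K1 s) (K2 s))\<^sup>2 * inverse (norm (K1 s)) ^ 5 \<le> (2 * (B1 * B2))\<^sup>2 * B3 ^ 5"
      by (intro mult_mono) auto
    then show ?thesis by (simp add: divide_inverse power_inverse)
  qed
  have cc: "isCont ?c s" if s: "s \<in> {0<..<L} - N" for s
  proof -
    have "isCont K2 s" "isCont K1 s" "K1 s \<noteq> 0" using K2[OF s] K1i[OF s] nz[of s] s by auto
    then show ?thesis unfolding cross2_def by (intro continuous_intros) auto
  qed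
  have lc: "isCont ?l s" if s: "s \<in> {0<..<L} - N" for s
    using K1i[OF s] by (intro continuous_intros)
  have lb: "norm (?l s) \<le> B1" if "s \<in> {0..L}" for s using B1[OF that] by simp
  have Sc: "((\<lambda>t. v t * ?c (\<sigma> t)) has_integral integral {0..L} ?c) {0..1}"
    by (rule substitution[OF N cc cb])
  have Sl: "((\<lambda>t. v t * ?l (\<sigma> t)) has_integral integral {0..L} ?l) {0..1}"
    by (rule substitution[OF N lc lb])
  have neg: "negligible {t \<in> {0..1}. D2 f t \<noteq> second K1 K2 t}"
  proof -
    have h: "is_D2 f (second K1 K2)" using K f by (rule compose_D2)
    show ?thesis by (rule is_D2_ae_unique[OF is_D2_D2[OF h] h])
  qed
  have pt: "(cross2 (D1 f t) (D2 f t))\<^sup>2 / norm (D1 f t) ^ 5 = v t * ?c (\<sigma> t)"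
    if "t \<in> {0..1} - {t \<in> {0..1}. D2 f t \<noteq> second K1 K2 t}" for t
  proof -
    have t: "t \<in> {0..1}" "D2 f t = second K1 K2 t" using that by auto
    have v: "v t > 0" using v_pos t by simp
    have "cross2 (D1 f t) (D2 f t) = v t ^ 3 * cross2 (K1 (\<sigma> t)) (K2 (\<sigma> t))"
      by (simp add: t(2) D1[OF t(1)] second_def cross2_def algebra_simps power2_eq_square power3_eq_cube)
    moreover have "norm (D1 f t) = v t * norm (K1 (\<sigma> t))" using v by (simp add: D1[OF t(1)])
    moreover have "(v t ^ 3 * x)\<^sup>2 / (v t * y) ^ 5 = v t * (x\<^sup>2 / y ^ 5)" for x y
    proof -
      have "(v t ^ 3 * x)\<^sup>2 = v t ^ 5 * (v t * x\<^sup>2)" "(v t * y) ^ 5 = v t ^ 5 * y ^ 5"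
        by (simp_all add: power_mult_distrib) (simp add: eval_nat_numeral algebra_simps)
      then show ?thesis using v by simp
    qed
    ultimately show ?thesis by simp
  qed
  have "bending_energy f = integral {0..L} ?c"
    unfolding bending_energy_def
    by (rule integral_unique, rule has_integral_spike[OF neg pt Sc])
  moreover have "curve_length f = integral {0..L} ?l"
    unfolding curve_length_def
  proof (rule integral_unique, rule has_integral_eq[OF _ Sl])
    fix t :: real assume "t \<in> {0..1}"
    then show "v t * norm (K1 (\<sigma> t)) = norm (D1 f t)" using D1 v_pos[of t] by simp
  qed
  moreover have ci: "?c integrable_on {0..L}" by (rule integrable_bounded_piecewise_continuous[OF N cc cb])
  moreover have li: "?l integrable_on {0..L}" by (rule integrable_bounded_piecewise_continuous[OF N lc lb])
  ultimately show "energy lam f = integral {0..L} (\<lambda>s. energy_density lam (K1 s) (K2 s))"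
    unfolding energy_def energy_density_def
    by (simp add: integral_add integrable_on_mult_right)
  show "(\<lambda>s. energy_density lam (K1 s) (K2 s)) integrable_on {0..L}"
    unfolding energy_density_def using ci li by (intro integrable_add integrable_on_mult_right)
qed

definition weight :: real where
  "weight = integral {0..1} (\<lambda>t. 1 + (v t)\<^sup>2 + (2 * (v t)^4 + 2 * (g t)\<^sup>2))"

text \<open>\<open>weight\<close> depends only on the parametrization, so uniform bounds in
  arclength on a curve and its two derivatives control the norm after composition with a factor
  fixed in advance.\<close>

lemma compose_w22_norm_le:
  assumes K: "piecewise_C2_on L N K K1 K2" and f: "\<And>t. t \<in> {0..1} \<Longrightarrow> f t = K (\<sigma> t)"
    and w: "0 \<le> w" "\<And>s. s \<in> {0..L} \<Longrightarrow> norm (K s) \<le> w \<and> norm (K1 s) \<le> w \<and> norm (K2 s) \<le> w"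
  shows "w22_norm f \<le> w * sqrt weight"
proof -
  have D1: "D1 f t = v t *\<^sub>R K1 (\<sigma> t)" if "t \<in> {0..1}" for t
    using K f that by (rule compose_D1)
  let ?h = "second K1 K2"
  have h: "is_D2 f ?h" using K f by (rule compose_D2)
  have neg: "negligible {t \<in> {0..1}. D2 f t \<noteq> ?h t}"
    by (rule is_D2_ae_unique[OF is_D2_D2[OF h] h])
  have fc: "continuous_on {0..1} f" 
  proof -
    have "\<And>t. t \<in> {0..1} \<Longrightarrow> (f has_vector_derivative v t *\<^sub>R K1 (\<sigma> t)) (at t within {0..1})"
      using K f by (intro deriv_compose) (auto simp: piecewise_C2_on_def)
    then show ?thesis by (rule continuous_on_vector_derivative)
  qed
  have D1c: "continuous_on {0..1} (D1 f)"
    by (rule indefinite_integral_continuous_on) (use h in \<open>auto simp: is_D2_def\<close>)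
  have "integral {0..1} (\<lambda>t. (norm (f t))\<^sup>2 + (norm (D1 f t))\<^sup>2 + (norm (D2 f t))\<^sup>2)
      = integral {0..1} (\<lambda>t. (norm (f t))\<^sup>2 + (norm (D1 f t))\<^sup>2 + (norm (?h t))\<^sup>2)"
    by (rule integral_spike[OF neg]) auto
  also have "\<dots> \<le> integral {0..1} (\<lambda>t. w\<^sup>2 * (1 + (v t)\<^sup>2 + (2 * (v t)^4 + 2 * (g t)\<^sup>2)))"
  proof (rule integral_le)
    show "(\<lambda>t. (norm (f t))\<^sup>2 + (norm (D1 f t))\<^sup>2 + (norm (?h t))\<^sup>2) integrable_on {0..1}"
      using h fc D1c unfolding is_D2_def
      by (intro integrable_add) (auto intro!: integrable_continuous_real continuous_intros)
    show "(\<lambda>t. w\<^sup>2 * (1 + (v t)\<^sup>2 + (2 * (v t)^4 + 2 * (g t)\<^sup>2))) integrable_on {0..1}"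
      by (intro integrable_on_mult_right weight_integrable)
    fix t :: real assume t: "t \<in> {0..1}"
    note wt = w(2)[OF \<sigma>_range[OF t]]
    have "(norm (f t))\<^sup>2 \<le> w\<^sup>2" using wt f[OF t] by (intro power_mono) auto
    moreover have "(norm (D1 f t))\<^sup>2 \<le> w\<^sup>2 * (v t)\<^sup>2"
    proof -
      have "norm (D1 f t) \<le> w * v t" using wt v_pos[OF t] by (simp add: D1[OF t] mult.commute mult_right_mono)
      then have "(norm (D1 f t))\<^sup>2 \<le> (w * v t)\<^sup>2" by (rule power_mono) simp
      then show ?thesis by (simp add: power_mult_distrib)
    qed
    moreover have "(norm (?h t))\<^sup>2 \<le> w\<^sup>2 * (2 * (v t)^4 + 2 * (g t)\<^sup>2)" 
      using wt by (intro norm_second_sq) auto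
    ultimately show "(norm (f t))\<^sup>2 + (norm (D1 f t))\<^sup>2 + (norm (?h t))\<^sup>2 
        \<le> w\<^sup>2 * (1 + (v t)\<^sup>2 + (2 * (v t)^4 + 2 * (g t)\<^sup>2))"
      by (simp add: distrib_left)
  qed
  also have "\<dots> = w\<^sup>2 * weight" unfolding weight_def by (rule integral_mult_right)
  finally have "w22_norm f \<le> sqrt (w\<^sup>2 * weight)" unfolding w22_norm_def by (rule real_sqrt_le_mono)
  then show ?thesis using w(1) by (simp add: real_sqrt_mult)
qed

end

section \<open>Perturbation of the energy density\<close>

lemma cross2_bounded_bilinear: "bounded_bilinear cross2"
proof -
  have "bilinear cross2"
    unfolding bilinear_def by (auto intro!: linearI simp: cross2_def algebra_simps)
  then show ?thesis by (simp add: bilinear_conv_bounded_bilinear)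
qed

interpretation cross2: bounded_bilinear cross2 by (rule cross2_bounded_bilinear)

lemma cross2_sq_add_inner_sq: "(cross2 x y)\<^sup>2 + (inner x y)\<^sup>2 = (norm x)\<^sup>2 * (norm y)\<^sup>2"
  by (cases x; cases y)
     (simp add: cross2_def inner_prod_def norm_Pair real_sqrt_pow2 power2_eq_square algebra_simps)

lemma abs_cross2_le: "\<bar>cross2 x y\<bar> \<le> norm x * norm y"
proof -
  have "(cross2 x y)\<^sup>2 \<le> (norm x * norm y)\<^sup>2"
    unfolding power_mult_distrib
    using cross2_sq_add_inner_sq[of x y] zero_le_power2[of "inner x y"] by linarith
  then show ?thesis using abs_le_square_iff[of "cross2 x y" "norm x * norm y"] by (simp add: abs_mult)
qed

text \<open>A one-sided expansion that keeps only the term linear in b. The change a of the tangent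
  may be estimated crudely by its norm, because in the application it is of higher order than
  b.\<close>

lemma energy_density_perturb:
  assumes p: "norm p = 1" and h: "norm h \<le> M" and a: "norm a \<le> 1/2" and b: "norm b \<le> 1"
  shows "energy_density lam (p + a) (h + b) \<le> energy_density lam p h + 2 * cross2 p h * cross2 p b
     + (251 * (M + 1)\<^sup>2 + \<bar>lam\<bar> + 1) * (norm a + (norm b)\<^sup>2)"
proof -
  define x where "x = norm a"
  define c0 \<beta> \<rho> where "c0 = cross2 p h" and "\<beta> = cross2 p b" and "\<rho> = cross2 a (h + b)"
  define X where "X = (c0 + \<beta> + \<rho>)\<^sup>2"
  have x: "0 \<le> x" "x \<le> 1/2" using a by (auto simp: x_def)
  have M: "M \<ge> 0" using h norm_ge_zero[of h] by linarith
  have c0: "\<bar>c0\<bar> \<le> M" using abs_cross2_le[of p h] p h by (simp add: c0_def)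
  have \<beta>: "\<bar>\<beta>\<bar> \<le> norm b" using abs_cross2_le[of p b] p by (simp add: \<beta>_def)
  have "norm (h + b) \<le> M + 1" using norm_triangle_ineq[of h b] h b by linarith
  then have \<rho>: "\<bar>\<rho>\<bar> \<le> x * (M + 1)"
    using abs_cross2_le[of a "h + b"] mult_left_mono[of "norm (h + b)" "M + 1" x] x by (simp add: \<rho>_def x_def)
  have c: "cross2 (p + a) (h + b) = c0 + \<beta> + \<rho>"
    by (simp add: c0_def \<beta>_def \<rho>_def cross2.add_left cross2.add_right)
  have cb: "\<bar>c0 + \<beta>\<bar> \<le> M + 1" using c0 \<beta> b by linarith
  have "(c0 + \<beta>) * \<rho> \<le> (M + 1) * (x * (M + 1))"
    using mult_mono[OF cb \<rho>] M abs_ge_self[of "(c0 + \<beta>) * \<rho>"] by (simp add: abs_mult)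
  moreover have "\<rho>\<^sup>2 \<le> (x * (M + 1))\<^sup>2" using \<rho> by (metis abs_ge_zero power2_abs power_mono)
  moreover have "(x * (M + 1))\<^sup>2 \<le> (M + 1) * (x * (M + 1))"
  proof -
    have "x * x \<le> x" using x by (intro mult_left_le) auto
    then have "x * x * (M + 1)\<^sup>2 \<le> x * (M + 1)\<^sup>2" by (intro mult_right_mono) auto
    then show ?thesis by (simp add: power2_eq_square mult_ac)
  qed
  moreover have "\<beta>\<^sup>2 \<le> (norm b)\<^sup>2" using \<beta> by (metis abs_ge_zero power2_abs power_mono)
  moreover have "X = c0\<^sup>2 + 2 * c0 * \<beta> + \<beta>\<^sup>2 + 2 * ((c0 + \<beta>) * \<rho>) + \<rho>\<^sup>2"
    by (simp add: X_def power2_eq_square algebra_simps)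
  ultimately have "X \<le> c0\<^sup>2 + 2 * c0 * \<beta> + (norm b)\<^sup>2 + 3 * ((M + 1) * (x * (M + 1)))"
    by linarith
  then have X1: "X \<le> c0\<^sup>2 + 2 * c0 * \<beta> + (norm b)\<^sup>2 + 3 * (M + 1)\<^sup>2 * x"
    by (simp add: power2_eq_square mult_ac)
  have "\<bar>c0 + \<beta> + \<rho>\<bar> \<le> 2 * (M + 1)"
  proof -
    have "x * (M + 1) \<le> 1 * (M + 1)" using x M by (intro mult_right_mono) auto
    then show ?thesis using cb \<rho> abs_triangle_ineq[of "c0 + \<beta>" \<rho>] by simp
  qed
  then have X2: "X \<le> 4 * (M + 1)\<^sup>2"
    using power_mono[of "\<bar>c0 + \<beta> + \<rho>\<bar>" "2 * (M + 1)" 2]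
    unfolding X_def power_mult_distrib power2_abs by simp
  have pa: "1 - x \<le> norm (p + a)" "norm (p + a) \<le> 1 + x"
    using norm_triangle_ineq2[of p "- a"] norm_triangle_ineq[of p a] p by (auto simp: x_def)
  have pa0: "norm (p + a) > 0" using pa x by linarith
  \<comment> \<open>1 / (1 - x) is at most 1 + 2x for x up to 1/2. In the fifth power with y = 2x at
    most 1, the binomial coefficients after the first sum to 31, which gives the 62 below.\<close>
  have inv: "1 / norm (p + a) \<le> 1 + 2 * x"
  proof -
    have "x * x \<le> x * (1 / 2)" using x by (intro mult_left_mono) auto
    then have "1 \<le> (1 + 2 * x) * (1 - x)" by (simp add: algebra_simps)
    also have "\<dots> \<le> (1 + 2 * x) * norm (p + a)" using pa x by (intro mult_left_mono) auto
    finally show ?thesis using pa0 by (simp add: divide_le_eq)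
  qed
  have "1 / norm (p + a) ^ 5 \<le> (1 + 2 * x) ^ 5"
    using power_mono[OF inv, of 5] by (simp add: power_one_over)
  also have "\<dots> \<le> 1 + 62 * x"
  proof -
    define y where "y = 2 * x"
    have y: "0 \<le> y" "y \<le> 1" using x by (auto simp: y_def)
    have "y ^ 2 \<le> y" "y ^ 3 \<le> y" "y ^ 4 \<le> y" "y ^ 5 \<le> y"
      using power_decreasing[of 1 2 y] power_decreasing[of 1 3 y] power_decreasing[of 1 4 y] power_decreasing[of 1 5 y] y
      by auto
    moreover have "(1 + y) ^ 5 = 1 + 5 * y + 10 * y^2 + 10 * y^3 + 5 * y^4 + y^5"
      by (simp add: eval_nat_numeral algebra_simps)
    ultimately have "(1 + y) ^ 5 \<le> 1 + 31 * y" by linarith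
    then show ?thesis by (simp add: y_def)
  qed
  finally have "X * (1 / norm (p + a) ^ 5) \<le> X * (1 + 62 * x)" by (rule mult_left_mono) (simp add: X_def)
  also have "\<dots> \<le> X + 4 * (M + 1)\<^sup>2 * (62 * x)"
    using mult_right_mono[OF X2, of "62 * x"] x by (simp add: algebra_simps)
  \<comment> \<open>251 = 3 + 4 * 62: the bound \<open>X1\<close> on the numerator, and the loss 62
    x in the denominator weighted with the crude bound \<open>X2\<close>.\<close>
  finally have Y: "X / norm (p + a) ^ 5 \<le> c0\<^sup>2 + 2 * c0 * \<beta> + (norm b)\<^sup>2 + 251 * (M + 1)\<^sup>2 * x"
    using X1 by (simp add: algebra_simps)
  have Z: "lam * norm (p + a) \<le> lam + \<bar>lam\<bar> * x"
  proof -
    have "lam * (norm (p + a) - 1) \<le> \<bar>lam\<bar> * \<bar>norm (p + a) - 1\<bar>" by (simp add: abs_mult[symmetric])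
    also have "\<dots> \<le> \<bar>lam\<bar> * x" using pa by (intro mult_left_mono) auto
    finally show ?thesis by (simp add: algebra_simps)
  qed
  have "energy_density lam (p + a) (h + b) \<le> c0\<^sup>2 + 2 * c0 * \<beta> + (norm b)\<^sup>2 + 251 * (M + 1)\<^sup>2 * x + (lam + \<bar>lam\<bar> * x)"
    using Y Z by (simp add: energy_density_def c X_def)
  moreover have nn: "0 \<le> (251 * (M + 1)\<^sup>2 + \<bar>lam\<bar>) * (norm b)\<^sup>2" by simp
  moreover have ex: "(C + k + 1) * (x + n) = C * x + k * x + x + (C + k) * n + n" for C k n :: real
    by (simp add: algebra_simps)
  ultimately have "energy_density lam (p + a) (h + b) \<le> c0\<^sup>2 + lam + 2 * c0 * \<beta>
      + (251 * (M + 1)\<^sup>2 + \<bar>lam\<bar> + 1) * (x + (norm b)\<^sup>2)"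
    unfolding ex using x(1) nn by linarith
  then show ?thesis by (simp add: energy_density_def p c0_def \<beta>_def x_def)
qed

text \<open>First and second derivative of the odd bump \<open>x * (d\<^sup>2 - x\<^sup>2)\<^sup>2\<close> supported on \<open>[-d, d]\<close>.\<close>
definition bump1 :: "real \<Rightarrow> real \<Rightarrow> real" where
  "bump1 d x = (if \<bar>x\<bar> \<le> d then (d\<^sup>2 - x\<^sup>2) * (d\<^sup>2 - 5 * x\<^sup>2) else 0)"

definition bump2 :: "real \<Rightarrow> real \<Rightarrow> real" where
  "bump2 d x = (if \<bar>x\<bar> \<le> d then 20 * x^3 - 12 * d\<^sup>2 * x else 0)"

lemma bump1_le: "d \<ge> 0 \<Longrightarrow> \<bar>bump1 d x\<bar> \<le> 4 * d ^ 4"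
proof -
  assume d: "d \<ge> 0"
  show ?thesis
  proof (cases "\<bar>x\<bar> \<le> d")
    case True
    then have "x\<^sup>2 \<le> d\<^sup>2" using d by (simp add: abs_le_square_iff[symmetric])
    then have "\<bar>d\<^sup>2 - x\<^sup>2\<bar> \<le> d\<^sup>2" "\<bar>d\<^sup>2 - 5 * x\<^sup>2\<bar> \<le> 4 * d\<^sup>2"
      unfolding abs_le_iff using zero_le_power2[of x] zero_le_power2[of d] by linarith+
    then have "\<bar>d\<^sup>2 - x\<^sup>2\<bar> * \<bar>d\<^sup>2 - 5 * x\<^sup>2\<bar> \<le> d\<^sup>2 * (4 * d\<^sup>2)" by (intro mult_mono) auto
    then show ?thesis using True by (simp add: bump1_def abs_mult power4_eq_xxxx power2_eq_square mult_ac)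
  qed (use d in \<open>simp add: bump1_def\<close>)
qed

lemma bump2_le: "d \<ge> 0 \<Longrightarrow> \<bar>bump2 d x\<bar> \<le> 32 * d ^ 3"
proof -
  assume d: "d \<ge> 0"
  show ?thesis
  proof (cases "\<bar>x\<bar> \<le> d")
    case True
    then have "\<bar>x\<bar> ^ 3 \<le> d ^ 3" by (intro power_mono) auto
    moreover have "d\<^sup>2 * \<bar>x\<bar> \<le> d\<^sup>2 * d" using True by (intro mult_left_mono) auto
    ultimately have "20 * \<bar>x\<bar> ^ 3 + 12 * (d\<^sup>2 * \<bar>x\<bar>) \<le> 32 * d ^ 3"
      by (simp add: power2_eq_square power3_eq_cube)
    moreover have "\<bar>20 * x^3 - 12 * d\<^sup>2 * x\<bar> \<le> \<bar>20 * x^3\<bar> + \<bar>12 * d\<^sup>2 * x\<bar>" by (rule abs_triangle_ineq4)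
    ultimately show ?thesis using True by (simp add: bump2_def abs_mult power_abs)
  qed (use d in \<open>simp add: bump2_def\<close>)
qed

text \<open>The polynomial vanishes at d and - d, so clamping its argument to [-d, d] reproduces the
  cut-off without a case distinction.\<close>

lemma bump1_continuous: "d \<ge> 0 \<Longrightarrow> continuous_on A (bump1 d)"
proof -
  assume d: "d \<ge> 0"
  have "bump1 d x = (d\<^sup>2 - (max (- d) (min d x))\<^sup>2) * (d\<^sup>2 - 5 * (max (- d) (min d x))\<^sup>2)" for x
  proof -
    consider "\<bar>x\<bar> \<le> d" "max (- d) (min d x) = x" | "\<not> \<bar>x\<bar> \<le> d" "max (- d) (min d x) = d"
      | "\<not> \<bar>x\<bar> \<le> d" "max (- d) (min d x) = - d" using d by linarith
    then show ?thesis by cases (simp_all add: bump1_def)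
  qed
  then have e: "bump1 d = (\<lambda>x. (d\<^sup>2 - (max (- d) (min d x))\<^sup>2) * (d\<^sup>2 - 5 * (max (- d) (min d x))\<^sup>2))"
    by (rule ext)
  show "continuous_on A (bump1 d)" unfolding e by (intro continuous_intros)
qed

lemma bump_poly_deriv:
  "((\<lambda>x. x * (d\<^sup>2 - x\<^sup>2)\<^sup>2) has_real_derivative (d\<^sup>2 - x\<^sup>2) * (d\<^sup>2 - 5 * x\<^sup>2)) (at x)"
  "((\<lambda>x. (d\<^sup>2 - x\<^sup>2) * (d\<^sup>2 - 5 * x\<^sup>2)) has_real_derivative 20 * x^3 - 12 * d\<^sup>2 * x) (at x)"
  for d x :: real
  by (auto intro!: derivative_eq_intros simp: power2_eq_square power3_eq_cube algebra_simps)

lemma bump_local: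
  assumes "\<bar>x\<bar> \<noteq> d"
  shows "(bump1 d has_real_derivative bump2 d x) (at x)" "isCont (bump2 d) x"
proof -
  consider "\<bar>x\<bar> < d" | "d < \<bar>x\<bar>" using assms by linarith
  then have "(bump1 d has_real_derivative bump2 d x) (at x) \<and> isCont (bump2 d) x"
  proof cases
    case 1
    have o: "open {y. \<bar>y\<bar> < d}" by (intro open_Collect_less continuous_intros)
    have ev: "\<forall>\<^sub>F y in nhds x. bump1 d y = (d\<^sup>2 - y\<^sup>2) * (d\<^sup>2 - 5 * y\<^sup>2)"
       "\<forall>\<^sub>F y in nhds x. bump2 d y = 20 * y^3 - 12 * d\<^sup>2 * y"
      using 1 o by (auto simp: eventually_nhds bump1_def bump2_def intro!: exI[of _ "{y. \<bar>y\<bar> < d}"])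
    have "isCont (\<lambda>y. 20 * y^3 - 12 * d\<^sup>2 * y) x" by (intro continuous_intros)
    moreover have "bump2 d x = 20 * x^3 - 12 * d\<^sup>2 * x" using 1 by (simp add: bump2_def)
    ultimately show ?thesis
      using bump_poly_deriv(2)[of d x] DERIV_cong_ev[OF refl ev(1) refl] isCont_cong[OF ev(2)] by simp
  next
    case 2
    have o: "open {y. d < \<bar>y\<bar>}" by (intro open_Collect_less continuous_intros)
    have ev: "\<forall>\<^sub>F y in nhds x. bump1 d y = 0" "\<forall>\<^sub>F y in nhds x. bump2 d y = 0"
      using 2 o by (auto simp: eventually_nhds bump1_def bump2_def intro!: exI[of _ "{y. d < \<bar>y\<bar>}"])
    have "bump2 d x = 0" using 2 by (simp add: bump2_def)
    then show ?thesis
      using DERIV_cong_ev[OF refl ev(1) refl, of 0] isCont_cong[OF ev(2)] by simp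
  qed
  then show "(bump1 d has_real_derivative bump2 d x) (at x)" "isCont (bump2 d) x" by auto
qed

text \<open>The antiderivatives are the bump and \<open>bump1\<close>; the latter is 0 at the ends
  and d^4 in the middle. The vanishing first integral keeps the end point of the curve, and the
  opposite signs of the other two match a curvature that changes sign at c.\<close>

lemma bump_integrals:
  assumes d: "d \<ge> 0"
  shows "((\<lambda>s. bump1 d (s - c)) has_integral 0) {c - d..c + d}"
    and "((\<lambda>s. bump2 d (s - c)) has_integral d ^ 4) {c - d..c}"
    and "((\<lambda>s. bump2 d (s - c)) has_integral - (d ^ 4)) {c..c + d}"
proof -
  note shift = DERIV_chain2[OF _ DERIV_diff[OF DERIV_ident DERIV_const], simplified]
  have F1: "((\<lambda>s. (s - c) * (d\<^sup>2 - (s - c)\<^sup>2)\<^sup>2) has_vector_derivative (d\<^sup>2 - (s - c)\<^sup>2) * (d\<^sup>2 - 5 * (s - c)\<^sup>2)) (at s within A)" for s A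
    using shift[OF bump_poly_deriv(1)[of d "s - c"]]
    by (simp add: has_real_derivative_iff_has_vector_derivative has_vector_derivative_at_within)
  have F2: "((\<lambda>s. (d\<^sup>2 - (s - c)\<^sup>2) * (d\<^sup>2 - 5 * (s - c)\<^sup>2)) has_vector_derivative 20 * (s - c)^3 - 12 * d\<^sup>2 * (s - c)) (at s within A)" for s A
    using shift[OF bump_poly_deriv(2)[of d "s - c"]]
    by (simp add: has_real_derivative_iff_has_vector_derivative has_vector_derivative_at_within)
  show "((\<lambda>s. bump1 d (s - c)) has_integral 0) {c - d..c + d}"
    using fundamental_theorem_of_calculus[OF _ F1, of "c - d" "c + d"] d
    by (intro has_integral_eq[where g = "\<lambda>s. bump1 d (s - c)" and f = "\<lambda>s. (d\<^sup>2 - (s - c)\<^sup>2) * (d\<^sup>2 - 5 * (s - c)\<^sup>2)"]) (auto simp: bump1_def)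
  show "((\<lambda>s. bump2 d (s - c)) has_integral d ^ 4) {c - d..c}"
    using fundamental_theorem_of_calculus[OF _ F2, of "c - d" "c"] d
    by (intro has_integral_eq[where g = "\<lambda>s. bump2 d (s - c)" and f = "\<lambda>s. 20 * (s - c)^3 - 12 * d\<^sup>2 * (s - c)"])
       (auto simp: bump2_def power2_eq_square power4_eq_xxxx mult.assoc)
  show "((\<lambda>s. bump2 d (s - c)) has_integral - (d ^ 4)) {c..c + d}"
    using fundamental_theorem_of_calculus[OF _ F2, of "c" "c + d"] d
    by (intro has_integral_eq[where g = "\<lambda>s. bump2 d (s - c)" and f = "\<lambda>s. 20 * (s - c)^3 - 12 * d\<^sup>2 * (s - c)"])
       (auto simp: bump2_def power2_eq_square power4_eq_xxxx mult.assoc)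
qed

section \<open>The competitor\<close>

lemma has_vector_derivative_shift:
  fixes f :: "real \<Rightarrow> 'a::real_normed_vector"
  assumes "(f has_vector_derivative f') (at (s + c))"
  shows "((\<lambda>s. f (s + c)) has_vector_derivative f') (at s)"
proof -
  have "((\<lambda>s. s + c) has_vector_derivative 1) (at s)" by (auto intro!: derivative_eq_intros)
  from vector_diff_chain_at[OF this assms] show ?thesis by (simp add: o_def)
qed

lemma has_vector_derivative_reflect:
  fixes f :: "real \<Rightarrow> 'a::real_normed_vector"
  assumes "(f has_vector_derivative f') (at (c - s))"
  shows "((\<lambda>s. f (c - s)) has_vector_derivative - f') (at s)"
proof -
  have "((\<lambda>s. c - s) has_vector_derivative - 1) (at s)" by (auto intro!: derivative_eq_intros)
  from vector_diff_chain_at[OF this assms] show ?thesis by (simp add: o_def)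
qed

lemma continuous_energy_density:
  fixes p h :: "real \<Rightarrow> real \<times> real"
  assumes "continuous_on A p" "continuous_on A h" "\<And>s. s \<in> A \<Longrightarrow> p s \<noteq> 0"
  shows "continuous_on A (\<lambda>s. energy_density lam (p s) (h s))"
  unfolding energy_density_def using assms
  by (intro continuous_intros cross2.continuous_on) auto

text \<open>What the comparison argument needs of the curve, with \<open>S\<close> as half period;
  arcs and loops both satisfy it.\<close>

locale symmetric_wave =
  fixes \<Gamma> T T1 :: "real \<Rightarrow> real \<times> real" and S :: real
  assumes \<Gamma>_deriv: "(\<Gamma> has_vector_derivative T s) (at s)"
    and T_deriv: "(T has_vector_derivative T1 s) (at s)"
    and T1_cont: "continuous_on UNIV T1"
    and T_norm: "norm (T s) = 1"
    and S_pos: "S > 0"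
    and T_per: "T (s + 2 * S) = T s"
    and T_sym: "T (S + r) = T (S - r)"
    and T1_nz: "0 < r \<Longrightarrow> r < S \<Longrightarrow> T1 (S - r) \<noteq> 0"
begin

lemma T1_per: "T1 (s + 2 * S) = T1 s"
proof -
  have "((\<lambda>s. T (s + 2 * S)) has_vector_derivative T1 (s + 2 * S)) (at s)"
    by (rule has_vector_derivative_shift[OF T_deriv])
  then show ?thesis unfolding T_per using vector_derivative_unique_at[OF _ T_deriv] by simp
qed

lemma T1_sym: "T1 (S + r) = - T1 (S - r)"
proof -
  have "((\<lambda>r. T (r + S)) has_vector_derivative T1 (r + S)) (at r)"
    by (rule has_vector_derivative_shift[OF T_deriv])
  moreover have "(\<lambda>r. T (r + S)) = (\<lambda>r. T (S - r))"
    by (rule ext) (metis add.commute T_sym)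
  ultimately show ?thesis
    using vector_derivative_unique_at[OF _ has_vector_derivative_reflect[OF T_deriv, of S r]]
    by (simp add: add.commute)
qed

lemma T_cont: "continuous_on A T"
  by (rule continuous_on_vector_derivative) (rule has_vector_derivative_at_within[OF T_deriv])

lemma T_orthogonal: "inner (T s) (T1 s) = 0"
proof -
  have "((\<lambda>s. inner (T s) (T s)) has_vector_derivative inner (T s) (T1 s) + inner (T1 s) (T s)) (at s)"
    by (rule bounded_bilinear.has_vector_derivative[OF bounded_bilinear_inner T_deriv T_deriv])
  moreover have "(\<lambda>s. inner (T s) (T s)) = (\<lambda>s. 1)" using T_norm by (simp add: dot_square_norm)
  ultimately have "((\<lambda>s. 1::real) has_vector_derivative inner (T s) (T1 s) + inner (T1 s) (T s)) (at s)" by simp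
  from vector_derivative_unique_at[OF this has_vector_derivative_const]
  show ?thesis by (simp add: inner_commute)
qed

lemma \<Gamma>_per: "\<Gamma> (s + 2 * S) - \<Gamma> s = \<Gamma> (t + 2 * S) - \<Gamma> t"
proof -
  have "((\<lambda>s. \<Gamma> (s + 2 * S) - \<Gamma> s) has_vector_derivative 0) (at x)" for x
    using has_vector_derivative_diff[OF has_vector_derivative_shift[OF \<Gamma>_deriv] \<Gamma>_deriv, of "2 * S" x]
    by (simp add: T_per)
  then obtain c where "\<And>x. \<Gamma> (x + 2 * S) - \<Gamma> x = c"
    using has_vector_derivative_zero_constant[of UNIV "\<lambda>s. \<Gamma> (s + 2 * S) - \<Gamma> s"] by auto
  then show ?thesis by simp
qed

lemma \<Gamma>_integral: "a \<le> b \<Longrightarrow> (T has_integral (\<Gamma> b - \<Gamma> a)) {a..b}"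
  by (rule fundamental_theorem_of_calculus) (auto intro: has_vector_derivative_at_within[OF \<Gamma>_deriv])

lemma wave_C2: "piecewise_C2_on L {} \<Gamma> T T1"
proof -
  have "bounded (T1 ` {0..L})"
    by (rule compact_imp_bounded[OF compact_continuous_image[OF continuous_on_subset[OF T1_cont]]]) auto
  then show ?thesis using T1_cont
    by (auto simp: piecewise_C2_on_def T_cont T_deriv continuous_on_eq_continuous_at
        intro: has_vector_derivative_at_within[OF \<Gamma>_deriv])
qed

end

text \<open>Moving the arc over \<open>[S - r, S + r]\<close> to the end of the period \<open>[S - r, 3 S + r]\<close> shifts the
  tangent of the remaining part by \<open>2 r\<close>.\<close>
locale shifted_wave = symmetric_wave +
  fixes r L :: real
  assumes r: "0 < r" "r < S" and L: "3 * S \<le> L"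
begin

definition s0 where "s0 = S - r"
definition s1 where "s1 = 3 * S - r"
definition U where "U s = (if s \<le> s0 then T s else if s \<le> s1 then T (s + 2 * r) else T s)"
text \<open>The left-hand value is taken at both junctions; at \<open>s0\<close> it is w.\<close>

definition U1 where "U1 s = (if s \<le> s0 then T1 s else if s \<le> s1 then T1 (s + 2 * r) else T1 s)"
definition w where "w = T1 s0"

lemma breakpoints: "0 < s0" "s0 < s1" "s1 < L" "s1 = s0 + 2 * S" "s0 + 2 * r = S + r" "s1 + 2 * r = s0 + 2 * r + 2 * S"
  using r L S_pos by (auto simp: s0_def s1_def)

lemma w_nz: "w \<noteq> 0"
  using T1_nz r by (simp add: w_def s0_def)

lemma U_junction: "T s0 = T (s0 + 2 * r)" "T (s1 + 2 * r) = T s1"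
proof -
  show 1: "T s0 = T (s0 + 2 * r)" unfolding breakpoints(5) using T_sym[of r] by (simp add: s0_def)
  have "T (s1 + 2 * r) = T (s0 + 2 * r)" unfolding breakpoints(6) by (rule T_per)
  moreover have "T s1 = T s0" unfolding breakpoints(4) by (rule T_per)
  ultimately show "T (s1 + 2 * r) = T s1" using 1 by simp
qed

lemma U_cont: "continuous_on A U"
proof -
  have c: "continuous_on B (\<lambda>s. T (s + 2 * r))" for B
    by (rule continuous_on_compose2[OF T_cont[of UNIV]]) (auto intro!: continuous_intros)
  have "continuous_on UNIV U"
    unfolding U_def[abs_def]
    by (intro continuous_on_cases_le T_cont c continuous_on_id) (use U_junction breakpoints(1-3) in auto)
  then show ?thesis by (rule continuous_on_subset) simp
qed

lemma U_norm: "norm (U s) = 1"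
  by (simp add: U_def T_norm)

lemma local_form:
  assumes "s \<notin> {s0, s1}"
  obtains A c where "open A" "s \<in> A" "\<And>y. y \<in> A \<Longrightarrow> U y = T (y + c)" "\<And>y. y \<in> A \<Longrightarrow> U1 y = T1 (y + c)"
proof -
  consider "s < s0" | "s0 < s" "s < s1" | "s1 < s" using assms by fastforce
  then show ?thesis
  proof cases
    case 1
    show ?thesis by (rule that[of "{..<s0}" 0]) (use 1 in \<open>auto simp: U_def U1_def\<close>)
  next
    case 2
    show ?thesis by (rule that[of "{s0<..<s1}" "2 * r"]) (use 2 in \<open>auto simp: U_def U1_def\<close>)
  next
    case 3
    show ?thesis by (rule that[of "{s1<..}" 0]) (use 3 breakpoints in \<open>auto simp: U_def U1_def\<close>)
  qed
qed

lemma U_deriv: "s \<notin> {s0, s1} \<Longrightarrow> (U has_vector_derivative U1 s) (at s)"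
  and U1_isCont: "s \<notin> {s0, s1} \<Longrightarrow> isCont U1 s"
proof -
  assume "s \<notin> {s0, s1}"
  then obtain A c where A: "open A" "s \<in> A" "\<And>y. y \<in> A \<Longrightarrow> U y = T (y + c)" "\<And>y. y \<in> A \<Longrightarrow> U1 y = T1 (y + c)"
    by (rule local_form) blast
  have "((\<lambda>y. T (y + c)) has_vector_derivative U1 s) (at s)"
    using has_vector_derivative_shift[OF T_deriv, of c s] A by simp
  then show "(U has_vector_derivative U1 s) (at s)"
    by (rule has_vector_derivative_transform_within_open[OF _ A(1,2)]) (simp add: A(3))
  have "continuous_on A (\<lambda>y. T1 (y + c))"
    by (rule continuous_on_compose2[OF T1_cont]) (auto intro!: continuous_intros)
  then have "continuous_on A U1" by (rule continuous_on_eq) (simp add: A(4))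
  then show "isCont U1 s" using A(1,2) continuous_on_eq_continuous_at by blast
qed

text \<open>Around \<open>s0\<close> the shifted tangent is even, so its derivative jumps from \<open>w\<close> to \<open>-w\<close>.\<close>
lemma U_reflect: "0 < x \<Longrightarrow> x \<le> 2 * S \<Longrightarrow> U (s0 + x) = T (s0 - x) \<and> U1 (s0 + x) = - T1 (s0 - x)"
  using T_sym[of "r + x"] T1_sym[of "r + x"] breakpoints(4)
  by (simp add: U_def U1_def s0_def algebra_simps)

text \<open>Between the junctions U runs through one full period of T, only started at another
  phase. By \<open>\<Gamma>_per\<close> the displacement over a period does not depend on the
  phase.\<close>

lemma U_integral: "(U has_integral (\<Gamma> L - \<Gamma> 0)) {0..L}"
proof -
  have 1: "(U has_integral (\<Gamma> s0 - \<Gamma> 0)) {0..s0}"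
    by (rule has_integral_eq[OF _ \<Gamma>_integral]) (use breakpoints in \<open>auto simp: U_def\<close>)
  have "((\<lambda>s. T (s + 2 * r)) has_integral (\<Gamma> (s1 + 2 * r) - \<Gamma> (s0 + 2 * r))) {s0..s1}"
    by (rule fundamental_theorem_of_calculus)
       (use breakpoints in \<open>auto intro!: has_vector_derivative_at_within has_vector_derivative_shift \<Gamma>_deriv\<close>)
  then have 2: "(U has_integral (\<Gamma> (s1 + 2 * r) - \<Gamma> (s0 + 2 * r))) {s0..s1}"
    by (rule has_integral_eq[rotated]) (use U_junction in \<open>auto simp: U_def\<close>)
  have 3: "(U has_integral (\<Gamma> L - \<Gamma> s1)) {s1..L}"
    by (rule has_integral_eq[OF _ \<Gamma>_integral]) (use breakpoints U_junction in \<open>auto simp: U_def\<close>)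
  have "(U has_integral (\<Gamma> s0 - \<Gamma> 0 + (\<Gamma> (s1 + 2 * r) - \<Gamma> (s0 + 2 * r)) + (\<Gamma> L - \<Gamma> s1))) {0..L}"
    by (rule has_integral_combine[OF _ _ has_integral_combine[OF _ _ 1 2] 3]) (use breakpoints in auto)
  moreover have "\<Gamma> (s1 + 2 * r) - \<Gamma> (s0 + 2 * r) = \<Gamma> s1 - \<Gamma> s0"
    using \<Gamma>_per[of "s0 + 2 * r" s0] unfolding breakpoints(6) breakpoints(4)[symmetric] .
  ultimately show ?thesis by simp
qed

lemma U1_bounded: "bounded (U1 ` {0..L})"
proof -
  have "bounded (T1 ` {0..L + 2 * S})"
    by (rule compact_imp_bounded[OF compact_continuous_image[OF continuous_on_subset[OF T1_cont]]]) auto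
  moreover have "U1 ` {0..L} \<subseteq> T1 ` {0..L + 2 * S}"
    using r S_pos by (auto simp: U1_def)
  ultimately show ?thesis by (rule bounded_subset)
qed

text \<open>The density along the wave is periodic, so its integral over the shifted full period is
  unchanged too. The junctions, where \<open>U1\<close> holds only its left-hand value, are removed
  as null sets.\<close>

lemma U_energy: "((\<lambda>s. energy_density lam (U s) (U1 s)) has_integral
    integral {0..L} (\<lambda>s. energy_density lam (T s) (T1 s))) {0..L}"
proof -
  define a where "a = (\<lambda>s. energy_density lam (T s) (T1 s))"
  define A where "A = (\<lambda>s. energy_density lam (U s) (U1 s))"
  have ac: "continuous_on B a" for B
    unfolding a_def
  proof (rule continuous_energy_density)
    show "T s \<noteq> 0" for s using T_norm[of s] by auto
  qed (use continuous_on_subset[OF T1_cont] in \<open>auto simp: T_cont\<close>)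
  have ai: "a integrable_on {u..v}" for u v by (rule integrable_continuous_real[OF ac])
  have per: "a (s + 2 * S) = a s" for s by (simp add: a_def T_per T1_per)
  have sh: "((\<lambda>s. a (s + c)) has_integral integral {u + c..v + c} a) {u..v}" for u v c
  proof -
    have "continuous_on {u..v} (\<lambda>s. a (s + c))"
      by (rule continuous_on_compose2[OF ac[of UNIV]]) (auto intro!: continuous_intros)
    then have "(\<lambda>s. a (s + c)) integrable_on {u..v}" by (rule integrable_continuous_real)
    then show ?thesis using integral_shift[of u c v a, OF ac] by (simp add: has_integral_iff o_def)
  qed
  have "integral {s0 + 2 * r..s1 + 2 * r} a = integral {s0..s1} a"
  proof -
    have "integral {s1..s1 + 2 * r} a = integral {s0..s0 + 2 * r} a"
      using integral_unique[OF sh[of "2 * S" s0 "s0 + 2 * r"]] unfolding per by (simp add: breakpoints(4) algebra_simps)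
    moreover have "integral {s0..s0 + 2 * r} a + integral {s0 + 2 * r..s1} a = integral {s0..s1} a"
      by (rule Henstock_Kurzweil_Integration.integral_combine[OF _ _ ai]) (use r breakpoints(4) in auto)
    moreover have "integral {s0 + 2 * r..s1} a + integral {s1..s1 + 2 * r} a = integral {s0 + 2 * r..s1 + 2 * r} a"
      by (rule Henstock_Kurzweil_Integration.integral_combine[OF _ _ ai]) (use r breakpoints(4) in auto)
    ultimately show ?thesis by simp
  qed
  then have "((\<lambda>s. a (s + 2 * r)) has_integral integral {s0..s1} a) {s0..s1}" using sh[of "2 * r" s0 s1] by simp
  then have 2: "(A has_integral integral {s0..s1} a) {s0..s1}"
    by (rule has_integral_spike[of "{s0}", rotated -1]) (auto simp: A_def a_def U_def U1_def)
  have 1: "(A has_integral integral {0..s0} a) {0..s0}"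
    by (rule has_integral_eq[OF _ integrable_integral[OF ai]]) (auto simp: A_def a_def U_def U1_def)
  have 3: "(A has_integral integral {s1..L} a) {s1..L}"
    by (rule has_integral_spike[of "{s1}", OF _ _ integrable_integral[OF ai]])
       (use breakpoints in \<open>auto simp: A_def a_def U_def U1_def\<close>)
  have "(A has_integral (integral {0..s0} a + integral {s0..s1} a + integral {s1..L} a)) {0..L}"
    by (rule has_integral_combine[OF _ _ has_integral_combine[OF _ _ 1 2] 3]) (use breakpoints in auto)
  moreover have "integral {0..s0} a + integral {s0..s1} a = integral {0..s1} a"
    by (rule Henstock_Kurzweil_Integration.integral_combine[OF _ _ ai]) (use breakpoints in auto)
  moreover have "integral {0..s1} a + integral {s1..L} a = integral {0..L} a"
    by (rule Henstock_Kurzweil_Integration.integral_combine[OF _ _ ai]) (use breakpoints in auto)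
  ultimately show ?thesis by (simp add: A_def a_def)
qed


context
  fixes d :: real
  assumes d: "0 < d" "d \<le> s0" "d \<le> S"
begin

text \<open>The tangent is perturbed and the curve recovered by integration. At \<open>s0\<close>
  the direction w is normal to the tangent; no unit speed is preserved.\<close>

definition G1 where "G1 s = U s - bump1 d (s - s0) *\<^sub>R w"
definition G2 where "G2 s = U1 s - bump2 d (s - s0) *\<^sub>R w"
definition G where "G s = \<Gamma> 0 + integral {0..s} G1"

lemma window: "0 \<le> s0 - d" "s0 + d \<le> L"
  using d breakpoints S_pos by auto

lemma G1_cont: "continuous_on A G1"
proof -
  have "continuous_on A (\<lambda>s. bump1 d (s - s0))"
    by (rule continuous_on_compose2[OF bump1_continuous[of d UNIV]]) (use d in \<open>auto intro!: continuous_intros\<close>)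
  then show ?thesis unfolding G1_def[abs_def] by (intro continuous_intros U_cont)
qed

lemma G_deriv: "s \<in> {0..L} \<Longrightarrow> (G has_vector_derivative G1 s) (at s within {0..L})"
  unfolding G_def[abs_def]
  using has_vector_derivative_add[OF has_vector_derivative_const integral_has_vector_derivative[OF G1_cont]]
  by simp

lemma G_end: "G L = \<Gamma> L"
proof -
  have "((\<lambda>s. bump1 d (s - s0)) has_integral 0) {0..L}"
    by (rule has_integral_on_superset[OF bump_integrals(1)[of d s0]]) (use d window in \<open>auto simp: bump1_def\<close>)
  from has_integral_scaleR_left[OF this, of w]
  have "((\<lambda>s. bump1 d (s - s0) *\<^sub>R w) has_integral 0) {0..L}" by simp
  from has_integral_diff[OF U_integral this] show ?thesis
    by (simp add: G_def G1_def[abs_def] integral_unique)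
qed

lemma G2_local:
  assumes "s \<notin> {s0, s1, s0 - d, s0 + d}"
  shows "(G1 has_vector_derivative G2 s) (at s)" "isCont G2 s"
proof -
  have b: "\<bar>s - s0\<bar> \<noteq> d" "s \<notin> {s0, s1}" using assms d by auto
  have "((\<lambda>s. bump1 d (s - s0)) has_real_derivative bump2 d (s - s0)) (at s)"
    using DERIV_chain2[OF bump_local(1)[OF b(1)] DERIV_diff[OF DERIV_ident DERIV_const]] by simp
  from has_vector_derivative_scaleR[OF this has_vector_derivative_const[of w]]
  show "(G1 has_vector_derivative G2 s) (at s)"
    unfolding G1_def[abs_def] G2_def
    by (intro has_vector_derivative_diff U_deriv b) simp
  have "isCont (\<lambda>s. bump2 d (s - s0)) s"
    by (rule isCont_o2[where g = "bump2 d" and f = "\<lambda>s. s - s0"]) (use bump_local(2)[OF b(1)] in \<open>auto intro!: continuous_intros\<close>)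
  then show "isCont G2 s"
    unfolding G2_def[abs_def] by (intro continuous_intros U1_isCont b)
qed

lemma bump_vectors: "norm (bump1 d x *\<^sub>R w) \<le> 4 * d ^ 4 * norm w" "norm (bump2 d x *\<^sub>R w) \<le> 32 * d ^ 3 * norm w"
  using bump1_le[of d x] bump2_le[of d x] d by (auto intro!: mult_right_mono)

lemma G_C2: "piecewise_C2_on L {s0, s1, s0 - d, s0 + d} G G1 G2"
proof -
  have "bounded ((\<lambda>s. bump2 d (s - s0) *\<^sub>R w) ` {0..L})"
    unfolding bounded_iff using bump_vectors(2) by blast
  then have "bounded (G2 ` {0..L})"
    unfolding G2_def[abs_def] by (rule bounded_minus_comp[OF U1_bounded])
  then show ?thesis
    using G2_local by (auto simp: piecewise_C2_on_def G1_cont G_deriv)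
qed

text \<open>To first order the density changes by - 2 \<open>bump2\<close> m, where m =
  \<open>cross2 U U1 * cross2 U w\<close> is close to W left of \<open>s0\<close> and to - W right
  of it; by \<open>bump_integrals\<close> each half contributes - 2 W d^4. The tolerance W/128 on m
  costs at most W d^4 in total and the remainder 2 C d^5, which leaves d^4 (2 C d - 3 W).\<close>

lemma G_energy_less:
  assumes M: "\<And>s. s \<in> {0..L} \<Longrightarrow> norm (U1 s) \<le> M"
    and d1: "d \<le> 1" and dw: "32 * d * norm w \<le> 1"
    and W: "W = (cross2 (T s0) w)\<^sup>2" "W > 0"
    and \<kappa>: "\<And>x. \<bar>x\<bar> \<le> d \<Longrightarrow> \<bar>cross2 (T (s0 + x)) (T1 (s0 + x)) * cross2 (T (s0 + x)) w - W\<bar> \<le> W / 128"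
    and C: "C = (251 * (M + 1)\<^sup>2 + \<bar>lam\<bar> + 1) * (4 * norm w + 1024 * (norm w)\<^sup>2)"
    and dC: "C * d < W"
    and int: "(\<lambda>s. energy_density lam (G1 s) (G2 s)) integrable_on {0..L}"
  shows "integral {0..L} (\<lambda>s. energy_density lam (G1 s) (G2 s)) < integral {0..L} (\<lambda>s. energy_density lam (T s) (T1 s))"
proof -
  \<comment> \<open>The pointwise loss: 2 * 32 d^3 * W/128 from the tolerance on m, and C d^4 from
    the remainder of the expansion.\<close>
  define k where "k = W / 2 * d ^ 3 + C * d ^ 4"
  define P where "P = (\<lambda>s. (if s \<le> s0 then - (2 * W) * bump2 d (s - s0) else 2 * W * bump2 d (s - s0)) + k)"
  define Q where "Q = (\<lambda>s. if s \<in> {s0 - d..s0 + d} then P s else 0)"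
  have P1: "(P has_integral (- (2 * W) * d ^ 4 + k * d)) {s0 - d..s0}"
  proof (rule has_integral_eq)
    show "((\<lambda>s. - (2 * W) * bump2 d (s - s0) + k) has_integral (- (2 * W) * d ^ 4 + k * d)) {s0 - d..s0}"
      using has_integral_add[OF has_integral_mult_right[OF bump_integrals(2)[of d s0], of "- (2 * W)"] has_integral_const_real[of k "s0 - d" s0]] d
      by (simp add: mult.commute)
  qed (auto simp: P_def)
  have P2: "(P has_integral (2 * W * - (d ^ 4) + k * d)) {s0..s0 + d}"
  proof (rule has_integral_eq)
    show "((\<lambda>s. 2 * W * bump2 d (s - s0) + k) has_integral (2 * W * - (d ^ 4) + k * d)) {s0..s0 + d}"
      using has_integral_add[OF has_integral_mult_right[OF bump_integrals(3)[of d s0], of "2 * W"] has_integral_const_real[of k s0 "s0 + d"]] d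
      by (simp add: mult.commute)
  \<comment> \<open>At \<open>s0\<close> itself P follows its left branch; both branches agree there
    because \<open>bump2\<close> vanishes at 0.\<close>
  qed (auto simp: P_def bump2_def)
  have "(P has_integral (- (2 * W) * d ^ 4 + k * d + (2 * W * - (d ^ 4) + k * d))) {s0 - d..s0 + d}"
    by (rule has_integral_combine[OF _ _ P1 P2]) (use d in auto)
  then have "(Q has_integral (- (2 * W) * d ^ 4 + k * d + (2 * W * - (d ^ 4) + k * d))) {s0 - d..s0 + d}"
    by (rule has_integral_eq[rotated]) (simp add: Q_def)
  then have Q: "(Q has_integral (- (2 * W) * d ^ 4 + k * d + (2 * W * - (d ^ 4) + k * d))) {0..L}"
    by (rule has_integral_on_superset) (use window in \<open>auto simp: Q_def\<close>)
  have pt: "energy_density lam (G1 s) (G2 s) \<le> energy_density lam (U s) (U1 s) + Q s" if s: "s \<in> {0..L}" for s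
  proof (cases "s \<in> {s0 - d..s0 + d}")
    case False
    then have "\<not> \<bar>s - s0\<bar> \<le> d" by auto
    then show ?thesis using False by (auto simp: G1_def G2_def Q_def bump1_def bump2_def)
  next
    case True
    define x where "x = s - s0"
    have x: "\<bar>x\<bar> \<le> d" "s = s0 + x" using True by (auto simp: x_def)
    define a b where "a = - (bump1 d x *\<^sub>R w)" and "b = - (bump2 d x *\<^sub>R w)"
    have d4: "d ^ 4 \<le> d" "d ^ 3 \<le> d" "d ^ 6 \<le> d ^ 4"
      using power_decreasing[of 1 4 d] power_decreasing[of 1 3 d] power_decreasing[of 4 6 d] d d1 by auto
    have na: "norm a \<le> 4 * d ^ 4 * norm w" and nb: "norm b \<le> 32 * d ^ 3 * norm w"
      unfolding a_def b_def using bump_vectors by simp_all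
    have "4 * d ^ 4 * norm w \<le> 4 * d * norm w" "32 * d ^ 3 * norm w \<le> 32 * d * norm w"
      using d4 by (auto intro!: mult_right_mono)
    then have a12: "norm a \<le> 1 / 2" and b1: "norm b \<le> 1" using na nb dw by linarith+
    have "(norm b)\<^sup>2 \<le> (32 * d ^ 3 * norm w)\<^sup>2" using nb by (intro power_mono) auto
    also have "\<dots> = d ^ 6 * (1024 * (norm w)\<^sup>2)" by (simp add: power_mult_distrib power_mult[symmetric])
    also have "\<dots> \<le> d ^ 4 * (1024 * (norm w)\<^sup>2)" using d4 by (intro mult_right_mono) auto
    finally have "norm a + (norm b)\<^sup>2 \<le> d ^ 4 * (4 * norm w + 1024 * (norm w)\<^sup>2)"
      using na by (simp add: algebra_simps)
    then have err: "(251 * (M + 1)\<^sup>2 + \<bar>lam\<bar> + 1) * (norm a + (norm b)\<^sup>2) \<le> C * d ^ 4"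
      unfolding C mult.assoc by (intro mult_left_mono) (auto simp: mult.commute)
    have cb: "cross2 (U s) b = - bump2 d x * cross2 (U s) w"
      unfolding b_def by (simp add: cross2.minus_right cross2.scaleR_right)
    define m where "m = cross2 (U s) (U1 s) * cross2 (U s) w"
    have G12: "G1 s = U s + a" "G2 s = U1 s + b" by (simp_all add: a_def b_def G1_def G2_def x_def)
    have "2 * cross2 (U s) (U1 s) * cross2 (U s) b = - 2 * (bump2 d x * m)"
      unfolding cb m_def by simp
    then have E: "energy_density lam (G1 s) (G2 s) \<le> energy_density lam (U s) (U1 s) + - 2 * (bump2 d x * m) + C * d ^ 4"
      using energy_density_perturb[OF U_norm[of s] M[OF s] a12 b1, of lam] err unfolding G12 by linarith
    have bb: "\<bar>bump2 d x\<bar> * (W / 128) \<le> 32 * d ^ 3 * (W / 128)"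
      using bump2_le[of d x] d W(2) by (intro mult_right_mono) auto
    have sgn: "\<bar>m - W\<bar> \<le> W / 128" if "x \<le> 0"
      using \<kappa>[OF x(1)] that x(2) by (simp add: m_def U_def U1_def)
    have sgp: "\<bar>m + W\<bar> \<le> W / 128" if "0 < x"
    proof -
      \<comment> \<open>Right of the junction U mirrors the left side, so the estimate for the
        unshifted wave at - x applies, with the sign reversed by the derivative.\<close>
      have "U s = T (s0 + - x)" "U1 s = - T1 (s0 + - x)"
        using U_reflect[of x] that x d S_pos by auto
      then have "m = - (cross2 (T (s0 + - x)) (T1 (s0 + - x)) * cross2 (T (s0 + - x)) w)"
        unfolding m_def by (simp add: cross2.minus_right)
      moreover have "\<bar>cross2 (T (s0 + - x)) (T1 (s0 + - x)) * cross2 (T (s0 + - x)) w - W\<bar> \<le> W / 128"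
        using \<kappa>[of "- x"] x(1) by simp
      ultimately show ?thesis by linarith
    qed
    have key: "- 2 * (bump2 d x * m) \<le> (if x \<le> 0 then - (2 * W) * bump2 d x else 2 * W * bump2 d x) + W / 2 * d ^ 3"
    proof (cases "x \<le> 0")
      case True
      have "\<bar>bump2 d x * (m - W)\<bar> \<le> \<bar>bump2 d x\<bar> * (W / 128)"
        unfolding abs_mult using sgn[OF True] by (rule mult_left_mono) simp
      then have "- (bump2 d x * (m - W)) \<le> 32 * d ^ 3 * (W / 128)" using bb by linarith
      then show ?thesis using True by (simp add: algebra_simps)
    next
      case False
      have "\<bar>bump2 d x * (m + W)\<bar> \<le> \<bar>bump2 d x\<bar> * (W / 128)"
        unfolding abs_mult using sgp False by (intro mult_left_mono) auto
      then have "- (bump2 d x * (m + W)) \<le> 32 * d ^ 3 * (W / 128)" using bb by linarith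
      then show ?thesis using False by (simp add: algebra_simps)
    qed
    have "Q s = (if x \<le> 0 then - (2 * W) * bump2 d x else 2 * W * bump2 d x) + k"
      using True by (simp add: Q_def P_def x_def)
    then show ?thesis using E key unfolding k_def by linarith
  qed
  have "integral {0..L} (\<lambda>s. energy_density lam (G1 s) (G2 s)) \<le> 
     integral {0..L} (\<lambda>s. energy_density lam (T s) (T1 s)) + (- (2 * W) * d ^ 4 + k * d + (2 * W * - (d ^ 4) + k * d))"
    by (rule has_integral_le[OF integrable_integral[OF int] has_integral_add[OF U_energy Q]]) (rule pt)
  moreover have "- (2 * W) * d ^ 4 + k * d + (2 * W * - (d ^ 4) + k * d) = d ^ 4 * (2 * (C * d) - 3 * W)"
    by (simp add: k_def algebra_simps eval_nat_numeral)
  moreover have "d ^ 4 * (2 * (C * d) - 3 * W) < 0"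
    using dC d W(2) by (intro mult_pos_neg) auto
  ultimately show ?thesis by linarith
qed

end

end

section \<open>Choice of the shift and of the width of the bump\<close>

lemma piecewise_C2_on_diff:
  assumes "piecewise_C2_on L N K K1 K2" "piecewise_C2_on L N' H H1 H2"
  shows "piecewise_C2_on L (N \<union> N') (\<lambda>s. K s - H s) (\<lambda>s. K1 s - H1 s) (\<lambda>s. K2 s - H2 s)"
  using assms unfolding piecewise_C2_on_def
  by (auto intro!: has_vector_derivative_diff continuous_intros bounded_minus_comp)

context shifted_wave
begin

text \<open>Half of the tolerance e is spent on the shift by 2 r and half on the bump. Integrability
  stays a premise of the energy inequality, because \<open>compose_energy\<close> supplies it once
  the speed is known not to vanish.\<close>

lemma competitor_exists:
  assumes e: "e > 0"
    and close: "\<And>s. s \<in> {0..L} \<Longrightarrow> norm (T (s + 2 * r) - T s) \<le> e / 2 \<and> norm (T1 (s + 2 * r) - T1 s) \<le> e / 2"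
  shows "\<exists>N G G1 G2. piecewise_C2_on L N G G1 G2 \<and> G 0 = \<Gamma> 0 \<and> G L = \<Gamma> L \<and>
     (\<forall>s\<in>{0..L}. norm (G1 s - T s) \<le> e \<and> norm (G2 s - T1 s) \<le> e) \<and>
     ((\<lambda>s. energy_density lam (G1 s) (G2 s)) integrable_on {0..L} \<longrightarrow>
      integral {0..L} (\<lambda>s. energy_density lam (G1 s) (G2 s)) < integral {0..L} (\<lambda>s. energy_density lam (T s) (T1 s)))"
proof -
  obtain M where M: "\<And>s. s \<in> {0..L} \<Longrightarrow> norm (U1 s) \<le> M"
    using U1_bounded unfolding bounded_iff by blast
  define W where "W = (cross2 (T s0) w)\<^sup>2"
  have "W + (inner (T s0) w)\<^sup>2 = (norm w)\<^sup>2"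
    using cross2_sq_add_inner_sq[of "T s0" w] by (simp add: W_def T_norm)
  \<comment> \<open>w is orthogonal to the unit tangent, so W is the squared norm of w, that is, the
    squared curvature at \<open>s0\<close>.\<close>
  then have W: "W > 0" using T_orthogonal[of s0] w_nz by (simp add: w_def)
  define C where "C = (251 * (M + 1)\<^sup>2 + \<bar>lam\<bar> + 1) * (4 * norm w + 1024 * (norm w)\<^sup>2)"
  have C0: "C \<ge> 0" unfolding C_def by (intro mult_nonneg_nonneg) auto
  define \<kappa> where "\<kappa> = (\<lambda>s. cross2 (T s) (T1 s) * cross2 (T s) w)"
  have "continuous_on UNIV \<kappa>" unfolding \<kappa>_def
    by (intro continuous_intros cross2.continuous_on T_cont T1_cont)
  then obtain \<delta> where \<delta>: "\<delta> > 0" "\<And>s. dist s s0 < \<delta> \<Longrightarrow> dist (\<kappa> s) (\<kappa> s0) < W / 128"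
    unfolding continuous_on_iff using W by (metis UNIV_I divide_pos_pos zero_less_numeral)
  have \<kappa>0: "\<kappa> s0 = W" by (simp add: \<kappa>_def W_def w_def power2_eq_square)
  define n1 where "n1 = norm w + 1"
  have n1: "n1 > 0" "norm w \<le> n1" by (auto simp: n1_def add_nonneg_pos)
  \<comment> \<open>In turn: the support stays in the interval and clear of \<open>s1\<close>;
    powers of d decrease; m varies by at most W/128; the perturbations are admissible for
    \<open>energy_density_perturb\<close>; they are below e/2; the remainder satisfies C d < W.
    \<open>n1\<close> replaces the norm of w to have a positive denominator.\<close>
  define d where "d = min (min (min s0 S) (min 1 (\<delta> / 2))) (min (min (1 / (32 * n1)) (e / (64 * n1))) (W / (2 * (C + 1))))"
  have dp: "0 < d" using breakpoints S_pos \<delta> n1 e W C0 by (simp add: d_def)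
  have d: "d \<le> s0" "d \<le> S" "d \<le> 1" "d \<le> \<delta> / 2" "d \<le> 1 / (32 * n1)" "d \<le> e / (64 * n1)" "d \<le> W / (2 * (C + 1))"
    by (simp_all only: d_def min_le_iff_disj order_refl simp_thms)
  have dw: "32 * d * norm w \<le> 1"
  proof -
    have "32 * d * norm w \<le> 32 * d * n1" using n1 dp by (intro mult_left_mono) auto
    also have "\<dots> \<le> 1" using d(5) n1 by (simp add: le_divide_eq mult_ac)
    finally show ?thesis .
  qed
  have dw2: "32 * d * norm w \<le> e / 2"
  proof -
    have "32 * d * norm w \<le> 32 * d * n1" using n1 dp by (intro mult_left_mono) auto
    also have "\<dots> \<le> e / 2" using d(6) n1 by (simp add: le_divide_eq mult_ac)
    finally show ?thesis .
  qed
  have dC: "C * d < W"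
  proof -
    have "2 * ((C + 1) * d) \<le> W" using d(7) C0 by (simp add: le_divide_eq mult_ac)
    moreover have "C * d < (C + 1) * d" using dp by simp
    moreover have "0 \<le> C * d" using C0 dp by simp
    ultimately show ?thesis using W by linarith
  qed
  have \<kappa>d: "\<bar>cross2 (T (s0 + x)) (T1 (s0 + x)) * cross2 (T (s0 + x)) w - W\<bar> \<le> W / 128" if "\<bar>x\<bar> \<le> d" for x
    using \<delta>(2)[of "s0 + x"] that d(4) \<delta>(1) by (simp add: dist_real_def \<kappa>0) (simp add: \<kappa>_def)
  have d34: "d ^ 4 \<le> d" "d ^ 3 \<le> d"
    using power_decreasing[of 1 4 d] power_decreasing[of 1 3 d] dp d(3) by auto
  have G1d: "norm (G1 d s - T s) \<le> e" and G2d: "norm (G2 d s - T1 s) \<le> e" if s: "s \<in> {0..L}" for s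
  proof -
    have U: "norm (U s - T s) \<le> e / 2" "norm (U1 s - T1 s) \<le> e / 2"
      using close[OF s] e by (auto simp: U_def U1_def)
    have "4 * d ^ 4 \<le> 32 * d" "32 * d ^ 3 \<le> 32 * d" using d34 dp by linarith+
    then have "4 * d ^ 4 * norm w \<le> 32 * d * norm w" "32 * d ^ 3 * norm w \<le> 32 * d * norm w"
      by (meson mult_right_mono norm_ge_zero)+
    then have b: "norm (bump1 d (s - s0) *\<^sub>R w) \<le> e / 2" "norm (bump2 d (s - s0) *\<^sub>R w) \<le> e / 2"
      using bump_vectors[OF dp d(1,2), of "s - s0"] dw2 by linarith+
    have eq: "G1 d s - T s = (U s - T s) - bump1 d (s - s0) *\<^sub>R w"
      "G2 d s - T1 s = (U1 s - T1 s) - bump2 d (s - s0) *\<^sub>R w"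
      by (simp_all add: G1_def[OF dp d(1,2)] G2_def[OF dp d(1,2)])
    show "norm (G1 d s - T s) \<le> e" "norm (G2 d s - T1 s) \<le> e"
      unfolding eq using U b norm_triangle_ineq4[of "U s - T s" "bump1 d (s - s0) *\<^sub>R w"]
        norm_triangle_ineq4[of "U1 s - T1 s" "bump2 d (s - s0) *\<^sub>R w"] by linarith+
  qed
  show ?thesis
  proof (intro exI conjI ballI impI)
    show "piecewise_C2_on L {s0, s1, s0 - d, s0 + d} (G d) (G1 d) (G2 d)" by (rule G_C2[OF dp d(1,2)])
    show "G d 0 = \<Gamma> 0" by (simp add: G_def[OF dp d(1,2)])
    show "G d L = \<Gamma> L" by (rule G_end[OF dp d(1,2)])
    show "integral {0..L} (\<lambda>s. energy_density lam (G1 d s) (G2 d s)) < integral {0..L} (\<lambda>s. energy_density lam (T s) (T1 s))"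
      if "(\<lambda>s. energy_density lam (G1 d s) (G2 d s)) integrable_on {0..L}"
      by (rule G_energy_less[OF dp d(1,2) M d(3) dw W_def W \<kappa>d C_def dC that])
  qed (use G1d G2d in auto)
qed

end

context symmetric_wave
begin

lemma competitor:
  assumes L: "3 * S \<le> L" and e: "e > 0"
  shows "\<exists>N G G1 G2. piecewise_C2_on L N G G1 G2 \<and> G 0 = \<Gamma> 0 \<and> G L = \<Gamma> L \<and>
     (\<forall>s\<in>{0..L}. norm (G1 s - T s) \<le> e \<and> norm (G2 s - T1 s) \<le> e) \<and>
     ((\<lambda>s. energy_density lam (G1 s) (G2 s)) integrable_on {0..L} \<longrightarrow>
      integral {0..L} (\<lambda>s. energy_density lam (G1 s) (G2 s)) < integral {0..L} (\<lambda>s. energy_density lam (T s) (T1 s)))"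
proof -
  have u1: "uniformly_continuous_on {0..L + 2 * S} T"
    by (rule compact_uniformly_continuous[OF T_cont]) simp
  have u2: "uniformly_continuous_on {0..L + 2 * S} T1"
    by (rule compact_uniformly_continuous[OF continuous_on_subset[OF T1_cont]]) auto
  obtain \<delta>1 where \<delta>1: "\<delta>1 > 0" "\<And>x y. x \<in> {0..L + 2 * S} \<Longrightarrow> y \<in> {0..L + 2 * S} \<Longrightarrow> dist y x < \<delta>1 \<Longrightarrow> dist (T y) (T x) < e / 2"
    using u1[unfolded uniformly_continuous_on_def, rule_format, of "e / 2"] e by auto
  obtain \<delta>2 where \<delta>2: "\<delta>2 > 0" "\<And>x y. x \<in> {0..L + 2 * S} \<Longrightarrow> y \<in> {0..L + 2 * S} \<Longrightarrow> dist y x < \<delta>2 \<Longrightarrow> dist (T1 y) (T1 x) < e / 2"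
    using u2[unfolded uniformly_continuous_on_def, rule_format, of "e / 2"] e by auto
  \<comment> \<open>The shift is 2 r, so a quarter keeps it below both moduli of continuity, and
    also below 2 S, so that shifted points remain in the compact interval used above.\<close>
  define r where "r = min S (min \<delta>1 \<delta>2) / 4"
  have rb: "0 < r" "r < S" "2 * r < \<delta>1" "2 * r < \<delta>2" "2 * r \<le> 2 * S" using \<delta>1(1) \<delta>2(1) S_pos by (auto simp: r_def)
  interpret shifted_wave \<Gamma> T T1 S r L
    by unfold_locales (use rb L in auto)
  show ?thesis
  proof (rule competitor_exists[OF e])
    fix s assume s: "s \<in> {0..L}"
    have "s \<in> {0..L + 2 * S}" "s + 2 * r \<in> {0..L + 2 * S}" "dist (s + 2 * r) s < \<delta>1" "dist (s + 2 * r) s < \<delta>2"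
      using s rb by (auto simp: dist_real_def)
    then show "norm (T (s + 2 * r) - T s) \<le> e / 2 \<and> norm (T1 (s + 2 * r) - T1 s) \<le> e / 2"
      using \<delta>1(2) \<delta>2(2) by (simp add: dist_norm less_imp_le)
  qed
qed

text \<open>What needs proof is that the speed v has a square-integrable weak derivative. Since the
  derivative of \<gamma> is v times the unit vector T o \<sigma>, v is the inner product of T o
  \<sigma> with it. The product rule then applies, T o \<sigma> being the factor with bounded
  derivative, and the norm is never differentiated.\<close>

lemma arclength_reparametrization:
  assumes \<gamma>: "W22 \<gamma>" and nz: "\<And>t. t \<in> {0..1} \<Longrightarrow> D1 \<gamma> t \<noteq> 0" and ap: "arclength_param_is \<gamma> \<Gamma> L"
  shows "\<exists>g. reparametrization (\<lambda>t. integral {0..t} (\<lambda>u. norm (D1 \<gamma> u))) (\<lambda>t. norm (D1 \<gamma> t)) g L"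
proof -
  obtain h where h: "is_D2 \<gamma> h" using \<gamma> by (auto simp: W22_def)
  then have h_abs: "h absolutely_integrable_on {0..1}" and h_sq: "(\<lambda>t. (norm (h t))\<^sup>2) integrable_on {0..1}"
    and h_int: "\<And>t. t \<in> {0..1} \<Longrightarrow> (h has_integral (D1 \<gamma> t - D1 \<gamma> 0)) {0..t}"
    by (auto simp: is_D2_def)
  define v where "v = (\<lambda>t. norm (D1 \<gamma> t))"
  define \<sigma> where "\<sigma> = (\<lambda>t. integral {0..t} v)"
  have D1c: "continuous_on {0..1} (D1 \<gamma>)" using h_int by (rule indefinite_integral_continuous_on)
  have vc: "continuous_on {0..1} v" unfolding v_def by (intro continuous_intros D1c)
  have v0: "v t > 0" if "t \<in> {0..1}" for t using nz[OF that] by (simp add: v_def)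
  have \<sigma>': "(\<sigma> has_vector_derivative v t) (at t within {0..1})" if "t \<in> {0..1}" for t
    unfolding \<sigma>_def by (rule integral_has_vector_derivative[OF vc that])
  have \<gamma>_eq: "\<gamma> t = \<Gamma> (\<sigma> t)" if "t \<in> {0..1}" for t
    using ap that by (auto simp: arclength_param_is_def \<sigma>_def v_def)
  have comp: "((\<lambda>t. f (\<sigma> t)) has_vector_derivative v t *\<^sub>R f' (\<sigma> t)) (at t within {0..1})"
    if f: "\<And>s. (f has_vector_derivative f' s) (at s)" and t: "t \<in> {0..1}" for f f' :: "real \<Rightarrow> real \<times> real" and t
    using vector_diff_chain_within[OF \<sigma>'[OF t] has_vector_derivative_at_within[OF f]] by (simp add: o_def)
  have D1: "D1 \<gamma> t = v t *\<^sub>R T (\<sigma> t)" if t: "t \<in> {0..1}" for t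
    by (rule D1_eqI[OF has_vector_derivative_transform[OF t \<gamma>_eq comp[OF \<Gamma>_deriv t]] t])
  have v_eq: "inner (T (\<sigma> t)) (D1 \<gamma> t) = v t" if "t \<in> {0..1}" for t
    using D1[OF that] T_norm by (simp add: dot_square_norm)
  have \<sigma>c: "continuous_on {0..1} \<sigma>" by (rule continuous_on_vector_derivative) (rule \<sigma>')
  have T1c: "continuous_on {0..1} (\<lambda>t. v t *\<^sub>R T1 (\<sigma> t))"
    by (intro continuous_intros vc continuous_on_compose2[OF T1_cont \<sigma>c]) auto
  have m: "((\<lambda>t. v t *\<^sub>R T1 (\<sigma> t)) has_integral (T (\<sigma> t) - T (\<sigma> 0))) {0..t}" if t: "t \<in> {0..1}" for t
  proof (rule fundamental_theorem_of_calculus)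
    show "((\<lambda>t. T (\<sigma> t)) has_vector_derivative v x *\<^sub>R T1 (\<sigma> x)) (at x within {0..t})" if "x \<in> {0..t}" for x
      by (rule has_vector_derivative_within_subset[OF comp[OF T_deriv]]) (use t that in auto)
  qed (use t in auto)
  have "bounded ((\<lambda>t. v t *\<^sub>R T1 (\<sigma> t)) ` {0..1})"
    by (rule compact_imp_bounded[OF compact_continuous_image[OF T1c]]) simp
  then obtain B where B: "\<And>t. t \<in> {0..1} \<Longrightarrow> norm (v t *\<^sub>R T1 (\<sigma> t)) \<le> B" unfolding bounded_iff by blast
  define g1 g2 where "g1 = (\<lambda>t. inner (v t *\<^sub>R T1 (\<sigma> t)) (D1 \<gamma> t))" and "g2 = (\<lambda>t. inner (T (\<sigma> t)) (h t))"
  note P = product_rule_indefinite_integral[OF bounded_bilinear_inner m B h_int h_abs zero_le_one]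
  have P1: "g1 absolutely_integrable_on {0..1}" unfolding g1_def by (rule P(1))
  have P2: "g2 absolutely_integrable_on {0..1}" unfolding g2_def by (rule P(2))
  have P3: "((\<lambda>t. g1 t + g2 t) has_integral (v t - v 0)) {0..t}" if t: "t \<in> {0..1}" for t
  proof -
    have "((\<lambda>t. g1 t + g2 t) has_integral (inner (T (\<sigma> t)) (D1 \<gamma> t) - inner (T (\<sigma> 0)) (D1 \<gamma> 0))) {0..t}"
      unfolding g1_def g2_def using t by (rule P(3)[rotated -1])
    then show ?thesis using v_eq[OF t] v_eq[of 0] by simp
  qed
  have A: "(\<lambda>t. g1 t + g2 t) absolutely_integrable_on {0..1}" by (rule set_integral_add(1)[OF P1 P2])
  have "bounded (D1 \<gamma> ` {0..1})" by (rule compact_imp_bounded[OF compact_continuous_image[OF D1c]]) simp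
  then obtain B1 where B1: "\<And>t. t \<in> {0..1} \<Longrightarrow> norm (D1 \<gamma> t) \<le> B1" unfolding bounded_iff by blast
  have sq: "(\<lambda>t. (g1 t + g2 t)\<^sup>2) integrable_on {0..1}"
  proof (rule measurable_bounded_by_integrable_imp_integrable_real)
    show "(\<lambda>t. (g1 t + g2 t)\<^sup>2) \<in> borel_measurable (lebesgue_on {0..1})"
      using absolutely_integrable_imp_borel_measurable[OF A] by simp
    show "(\<lambda>t. 2 * (B * B1)\<^sup>2 + 2 * (norm (h t))\<^sup>2) integrable_on {0..1}"
      by (intro integrable_add integrable_on_mult_right h_sq integrable_const_ivl)
    fix t :: real assume t: "t \<in> {0..1}"
    have "\<bar>g1 t\<bar> \<le> B * B1"
      unfolding g1_def using Cauchy_Schwarz_ineq2[of "v t *\<^sub>R T1 (\<sigma> t)" "D1 \<gamma> t"] mult_mono[OF B[OF t] B1[OF t]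
        order_trans[OF norm_ge_zero B[OF t]] norm_ge_zero] by linarith
    then have 1: "(g1 t)\<^sup>2 \<le> (B * B1)\<^sup>2" by (metis abs_ge_zero power2_abs power_mono)
    have "\<bar>g2 t\<bar> \<le> norm (h t)"
      unfolding g2_def using Cauchy_Schwarz_ineq2[of "T (\<sigma> t)" "h t"] by (simp add: T_norm)
    then have 2: "(g2 t)\<^sup>2 \<le> (norm (h t))\<^sup>2" by (metis abs_ge_zero power2_abs power_mono)
    have "(g1 t + g2 t)\<^sup>2 \<le> 2 * (g1 t)\<^sup>2 + 2 * (g2 t)\<^sup>2"
      using zero_le_power2[of "g1 t - g2 t"] by (simp add: power2_sum power2_diff)
    then show "\<bar>(g1 t + g2 t)\<^sup>2\<bar> \<le> 2 * (B * B1)\<^sup>2 + 2 * (norm (h t))\<^sup>2" using 1 2 by simp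
  qed simp
  have "reparametrization \<sigma> v (\<lambda>t. g1 t + g2 t) L"
  proof
    show "\<sigma> 1 = L" using ap by (simp add: arclength_param_is_def curve_length_def \<sigma>_def v_def)
  qed (use \<sigma>' v0 P3 A sq in \<open>simp_all add: \<sigma>_def\<close>)
  then show ?thesis unfolding \<sigma>_def v_def by blast
qed

text \<open>The competitor \<eta> = G o \<sigma> shares the arclength function of \<gamma>, so
  \<eta> - \<gamma> is (G - \<Gamma>) o \<sigma> and closeness in arclength carries over with the
  factor sqrt weight, known before e is chosen.\<close>

lemma not_local_minimizer:
  assumes ap: "arclength_param_is \<gamma> \<Gamma> L" and L: "3 * S \<le> L"
  shows "\<not> local_minimizer lam l \<gamma>"
proof
  assume lm: "local_minimizer lam l \<gamma>"
  then have \<gamma>: "\<gamma> \<in> A_class l" by (simp add: local_minimizer_def)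
  obtain \<delta> where \<delta>: "\<delta> > 0" "\<And>\<eta>. \<eta> \<in> A_class l \<Longrightarrow> w22_norm (\<lambda>t. \<eta> t - \<gamma> t) < \<delta> \<Longrightarrow> energy lam \<gamma> \<le> energy lam \<eta>"
    using lm unfolding local_minimizer_def by blast
  define \<sigma> where "\<sigma> = (\<lambda>t. integral {0..t} (\<lambda>u. norm (D1 \<gamma> u)))"
  obtain g where g: "reparametrization \<sigma> (\<lambda>t. norm (D1 \<gamma> t)) g L"
    using arclength_reparametrization[of \<gamma> L] \<gamma> ap unfolding \<sigma>_def A_class_def by auto
  interpret reparametrization \<sigma> "\<lambda>t. norm (D1 \<gamma> t)" g L by (rule g)
  have \<gamma>_eq: "\<gamma> t = \<Gamma> (\<sigma> t)" if "t \<in> {0..1}" for t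
    using ap that by (auto simp: arclength_param_is_def \<sigma>_def)
  have L0: "L > 0" using L S_pos by linarith
  define k where "k = sqrt weight"
  have "weight \<ge> 0" unfolding weight_def by (rule integral_nonneg[OF weight_integrable(1)]) simp
  then have k: "k \<ge> 0" by (simp add: k_def)
  \<comment> \<open>1/2 keeps \<open>G1\<close> away from 0, as T has norm 1; the other bound makes
    e times sqrt weight smaller than \<delta>.\<close>
  define e where "e = min (1 / 2) (\<delta> / (2 * (k + 1)))"
  have e: "e > 0" "e \<le> 1 / 2"
    using \<delta>(1) k min.cobounded1[of "1 / 2" "\<delta> / (2 * (k + 1))"] by (simp_all only: e_def) simp
  have ek: "e * k < \<delta>"
  proof -
    have "e \<le> \<delta> / (2 * (k + 1))" by (simp add: e_def)
    then have "2 * (e * (k + 1)) \<le> \<delta>" using k by (simp add: le_divide_eq mult_ac)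
    moreover have "0 \<le> e * k" "e * (k + 1) = e * k + e" using e k by (simp_all add: algebra_simps)
    ultimately show ?thesis using e by linarith
  qed
  \<comment> \<open>Integrating a tangent error of e' over length L must leave a position error of
    at most e, with e' itself also at most e.\<close>
  define e' where "e' = e / (L + 1)"
  have e': "e' > 0" "e' \<le> e" "e' * L \<le> e"
  proof -
    show "e' > 0" using e L0 by (simp add: e'_def)
    have "e' * (L + 1) = e" using L0 by (simp add: e'_def)
    then have "e' * L + e' = e" by (simp add: distrib_left)
    moreover have "0 \<le> e' * L" using \<open>e' > 0\<close> L0 by simp
    ultimately show "e' \<le> e" "e' * L \<le> e" using \<open>e' > 0\<close> by linarith+
  qed
  obtain N G G1 G2 where G: "piecewise_C2_on L N G G1 G2" "G 0 = \<Gamma> 0" "G L = \<Gamma> L"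
    and Gc: "\<And>s. s \<in> {0..L} \<Longrightarrow> norm (G1 s - T s) \<le> e' \<and> norm (G2 s - T1 s) \<le> e'"
    and Ge: "(\<lambda>s. energy_density lam (G1 s) (G2 s)) integrable_on {0..L} \<Longrightarrow>
      integral {0..L} (\<lambda>s. energy_density lam (G1 s) (G2 s)) < integral {0..L} (\<lambda>s. energy_density lam (T s) (T1 s))"
    using competitor[OF L e'(1), of lam] by blast
  define \<eta> where "\<eta> = (\<lambda>t. G (\<sigma> t))"
  have G1nz: "G1 s \<noteq> 0" if s: "s \<in> {0..L}" for s
    using Gc[OF s] e' e T_norm[of s] by force
  have Tnz: "T s \<noteq> 0" for s using T_norm[of s] by auto
  have \<eta>A: "\<eta> \<in> A_class l"
    unfolding A_class_def
  proof (intro CollectI conjI ballI)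
    show "W22 \<eta>" by (rule compose_W22[OF G(1)]) (simp add: \<eta>_def)
    show "D1 \<eta> t \<noteq> 0" if t: "t \<in> {0..1}" for t
    proof -
      have "D1 \<eta> t = norm (D1 \<gamma> t) *\<^sub>R G1 (\<sigma> t)"
        by (rule compose_D1[OF G(1) _ t]) (simp add: \<eta>_def)
      then show ?thesis using G1nz[OF \<sigma>_range[OF t]] v_pos[OF t] by simp
    qed
    show "\<eta> 0 = (0, 0)" using \<gamma>_eq[of 0] \<gamma> by (simp add: \<eta>_def \<sigma>_0 G(2) A_class_def)
    show "\<eta> 1 = (l, 0)" using \<gamma>_eq[of 1] \<gamma> by (simp add: \<eta>_def \<sigma>_1 G(3) A_class_def)
  qed
  have Gclose: "norm (G s - \<Gamma> s) \<le> e" if s: "s \<in> {0..L}" for s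
  proof -
    have "((\<lambda>s. G s - \<Gamma> s) has_vector_derivative (G1 x - T x)) (at x within {0..s})" if "x \<in> {0..s}" for x
    proof (rule has_vector_derivative_within_subset)
      show "((\<lambda>s. G s - \<Gamma> s) has_vector_derivative (G1 x - T x)) (at x within {0..L})"
        using G(1) that s by (intro has_vector_derivative_diff has_vector_derivative_at_within[OF \<Gamma>_deriv])
          (auto simp: piecewise_C2_on_def)
    qed (use s in auto)
    then have "((\<lambda>x. G1 x - T x) has_integral ((G s - \<Gamma> s) - (G 0 - \<Gamma> 0))) {0..s}"
      using s by (intro fundamental_theorem_of_calculus) auto
    then have "norm ((G s - \<Gamma> s) - (G 0 - \<Gamma> 0)) \<le> e' * measure lborel (cbox 0 s)"
      using e'(1) Gc s by (intro has_integral_bound[of e' "\<lambda>x. G1 x - T x"]) auto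
    also have "\<dots> \<le> e' * L" using s e'(1) by simp
    finally show ?thesis using e'(3) G(2) by simp
  qed
  have "w22_norm (\<lambda>t. \<eta> t - \<gamma> t) \<le> e * sqrt weight"
  proof (rule compose_w22_norm_le[OF piecewise_C2_on_diff[OF G(1) wave_C2]])
    show "\<eta> t - \<gamma> t = G (\<sigma> t) - \<Gamma> (\<sigma> t)" if "t \<in> {0..1}" for t
      using \<gamma>_eq[OF that] by (simp add: \<eta>_def)
    show "norm (G s - \<Gamma> s) \<le> e \<and> norm (G1 s - T s) \<le> e \<and> norm (G2 s - T1 s) \<le> e" if "s \<in> {0..L}" for s
      using Gclose[OF that] Gc[OF that] e'(2) by auto
  qed (use e in auto)
  also have "\<dots> < \<delta>" using ek by (simp add: k_def)
  finally have "energy lam \<gamma> \<le> energy lam \<eta>" by (rule \<delta>(2)[OF \<eta>A])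
  moreover have "energy lam \<gamma> = integral {0..L} (\<lambda>s. energy_density lam (T s) (T1 s))"
    by (rule compose_energy(1)[OF wave_C2]) (use \<gamma>_eq Tnz in auto)
  moreover have "energy lam \<eta> = integral {0..L} (\<lambda>s. energy_density lam (G1 s) (G2 s))"
    by (rule compose_energy(1)[OF G(1)]) (use G1nz in \<open>auto simp: \<eta>_def\<close>)
  moreover have "(\<lambda>s. energy_density lam (G1 s) (G2 s)) integrable_on {0..L}"
    by (rule compose_energy(2)[OF G(1), of \<eta>]) (use G1nz in \<open>auto simp: \<eta>_def\<close>)
  ultimately show False using Ge by linarith
qed

end

section \<open>Application to arcs and loops\<close>

lemma (in elastica_curve) symmetric_wave: "symmetric_wave pos tang acc hp"
  by unfold_locales
     (use pos_deriv tang_deriv acc_continuous norm_tang hp_pos tang_periodic tang_symmetric acc_nonzero in auto)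

text \<open>The total length is n times the half period \<open>hp\<close>, so having at least three
  arcs is the condition 3 S \<le> L.\<close>

lemma (in elastica_curve) not_local_minimizer:
  assumes "arclength_param_is \<gamma> \<Gamma> (2 * real n * ellK q / \<alpha>)" "n \<ge> 3"
    and "\<And>s. \<Gamma> s = pos s"
  shows "\<not> local_minimizer lam l \<gamma>"
proof -
  interpret symmetric_wave pos tang acc hp by (rule symmetric_wave)
  have "\<Gamma> = pos" using assms(3) by (rule ext)
  moreover have "2 * real n * ellK q / \<alpha> = real n * hp" by (simp add: hp_def)
  moreover have "3 * hp \<le> real n * hp" using assms(2) hp_pos by (intro mult_right_mono) auto
  ultimately show ?thesis using symmetric_wave.not_local_minimizer[OF symmetric_wave] assms(1) by simp
qed

lemma arc_not_local_minimizer: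
  assumes q: "1 / sqrt 2 < q" "q < qstar" and l: "l > 0" and n: "n \<ge> 3"
    and ap: "arclength_param_is \<gamma> (arc_formula q (arc_alpha l n q)) (2 * real n * ellK q / arc_alpha l n q)"
  shows "\<not> local_minimizer lam l \<gamma>"
proof -
  have q0: "0 < q" "q < 1" using q qstar(2) inv_sqrt2(1) by linarith+
  have "0 < 2 * ellEc q - ellK q" using plen_pos[OF q0(1) q(2)] by (simp add: plen_def)
  then have \<alpha>: "arc_alpha l n q > 0" using l n by (simp add: arc_alpha_def)
  interpret elastica_curve q "arc_alpha l n q" 1
    by unfold_locales (use q0 \<alpha> in auto)
  show ?thesis
    by (rule not_local_minimizer[OF ap n]) (simp add: arc_formula_def pos_def ph_def cn_def Let_def)
qed

text \<open>Beyond \<open>qstar\<close> the distance 2E - K is negative; \<open>loop_alpha\<close>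
  reverses its sign, so \<alpha> is positive, and the reversed first coordinate of the loop formula
  is the choice \<kappa> = -1.\<close>

lemma loop_not_local_minimizer:
  assumes q: "qstar < q" "q < 1" and l: "l > 0" and n: "n \<ge> 3"
    and ap: "arclength_param_is \<gamma> (loop_formula q (loop_alpha l n q)) (2 * real n * ellK q / loop_alpha l n q)"
  shows "\<not> local_minimizer lam l \<gamma>"
proof -
  have q0: "0 < q" using q critical_moduli_pos by linarith
  have "0 < ellK q - 2 * ellEc q" using plen_neg[OF q] by (simp add: plen_def)
  then have \<alpha>: "loop_alpha l n q > 0" using l n by (simp add: loop_alpha_def)
  interpret elastica_curve q "loop_alpha l n q" "- 1"
    by unfold_locales (use q0 q \<alpha> in auto)
  show ?thesis
  proof (rule not_local_minimizer[OF ap n])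
    fix s
    have "x - 2 * y - 2 * z = - (2 * y + 2 * z - x)" for x y z :: real by simp
    then show "loop_formula q (loop_alpha l n q) s = pos s"
      by (simp add: loop_formula_def pos_def ph_def cn_def Let_def minus_divide_left)
  qed
qed

theorem theorem3p7:
  fixes lam l :: real and \<gamma> :: "real \<Rightarrow> real \<times> real" and n :: nat
  assumes "lam > 0" and "l > 0"
    and "penalized_pinned_elastica lam l \<gamma>"
    and "n \<ge> 3"
    and "(int n \<ge> nlam lam l \<and> arclength_param_is \<gamma> (gamma_sarc lam l n) (len_sarc lam l n))
       \<or> (int n \<ge> nlam lam l \<and> arclength_param_is \<gamma> (gamma_larc lam l n) (len_larc lam l n))
       \<or> arclength_param_is \<gamma> (gamma_loop lam l n) (len_loop lam l n)"
  shows "\<not> local_minimizer lam l \<gamma>"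
proof -
  have n: "n > 0" using assms(4) by simp
  have c: "0 < lam * l\<^sup>2 / (real n)\<^sup>2" using assms(1,2) n by simp
  consider (sarc) "int n \<ge> nlam lam l" "arclength_param_is \<gamma> (gamma_sarc lam l n) (len_sarc lam l n)"
    | (larc) "int n \<ge> nlam lam l" "arclength_param_is \<gamma> (gamma_larc lam l n) (len_larc lam l n)"
    | (loop) "arclength_param_is \<gamma> (gamma_loop lam l n) (len_loop lam l n)"
    using assms(5) by blast
  then show ?thesis
  proof cases
    case sarc
    note c' = nlam_imp_le_lamhat[OF assms(1,2) n sarc(1)]
    show ?thesis
      by (rule arc_not_local_minimizer[OF _ _ assms(2,4) sarc(2)[unfolded gamma_sarc_def len_sarc_def]])
         (use q1_range[OF c'] in \<open>simp_all add: sarc_q_def\<close>)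
  next
    case larc
    note c' = nlam_imp_le_lamhat[OF assms(1,2) n larc(1)]
    show ?thesis
      by (rule arc_not_local_minimizer[OF _ _ assms(2,4) larc(2)[unfolded gamma_larc_def len_larc_def]])
         (use q2_range[OF c'] in \<open>simp_all add: larc_q_def\<close>)
  next
    case loop
    show ?thesis
      by (rule loop_not_local_minimizer[OF _ _ assms(2,4) loop[unfolded gamma_loop_def len_loop_def]])
         (use q3_range[OF c] in \<open>simp_all add: loop_q_def\<close>)
  qed
qed

end
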